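(* Let $N\ge0$ be an integer, $k,l\in\{0,\dots,N\}$, and let $\Lambda,M,\omega\in\mathbb{C}$, $z\in\mathbb{C}\setminus\{0\}$ be generic (no denominator below vanishes, apart from the removable cases described in the context). Then the following bi-orthogonality relation holds: $$\begin{aligned} \delta_{kl}h_k=\sum_{j=0}^N w_j\;&{}_{10}\omega_9\big(q^{2(\Lambda-2l-j+1)};\,q^{-2j},\,q^{-2l},\,q^{2(\Lambda-l-N+1)},\,q^{2(\Lambda-l-\omega+M+1)},\\ &\qquad q^{2(\Lambda-l+M+2)},\,zq^{2(N-M-j-l)+\omega-1},\,q^{-2(M+j+l-2)+\omega-1}/z\big)\\ \times\;&{}_{10}\omega_9\big(q^{2(\Lambda-2k-j+1)};\,q^{-2j},\,q^{-2k},\,q^{2(\Lambda-k-N+1)},\,q^{2(\Lambda-k-\omega+M+1)},\\ &\qquad q^{2(\Lambda-k+M+2)},\,zq^{2(N-M-j-k)+\omega-3},\,q^{-2(M+j+k-2)+\omega+1}/z\big), \end{aligned}$$ where the quadratic norm $h_k$ is $$\begin{aligned} h_k=\;&\frac{(q^2,\,q^{-2(\Lambda+M+1)},\,q^{-2(\Lambda-\omega+M)},\,q^{-2(\Lambda-N)})_k}{(q^{2(M+1)},\,q^{-2N},\,q^{-2(\omega-M)},\,q^{-2\Lambda})_k}\;\frac{(q^{-2(\Lambda+1)})_{2k}}{(q^{-2\Lambda})_{2k}}\\ &\times\frac{(zq^{2M-\omega-1},\,q^{2(M-N)-\omega+5}/z)_k}{(q^{-2(\Lambda+M)+\omega+1}/z,\,zq^{2(N-\Lambda-M)+\omega-5})_k}\\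 &\times\frac{(q^{-2(\Lambda-\omega+2M+1)},\,q^{-2\Lambda})_N}{(q^{-2(\Lambda+M+1)},\,q^{-2(\Lambda-\omega+M)})_N}\;\frac{(zq^{\omega-1},\,zq^{-\omega-3})_N}{(zq^{2M-\omega-1},\,zq^{-2M+\omega-3})_N}, \end{aligned}$$ and the weight function is $w_j=w_1(j,k)\,w_2(j,l)$ with $$\begin{aligned} w_1(j,k)=\;&q^{2j-2k}\,\frac{\theta(q^{2(\Lambda-\omega+2M-N+1+2j)})}{\theta(q^{2(\Lambda-\omega+2M-N+1)})}\;\frac{(q^{2(\Lambda-\omega+2M-N+1)})_j}{(q^{2(\Lambda-\omega+2M+2)})_j}\;\frac{(zq^{2(\Lambda-k+M)-\omega-1})_j}{(q^{-2(N-2-M-k)-\omega+1}/z)_j}\\ &\times\frac{(q^{2(M+k+1)},\,q^{-2(N-k)},\,q^{-2(\Lambda-k+1)},\,q^{-2(\omega-M-k)})_j}{(q^2,\,q^{2(\Lambda-N+M+2)},\,q^{2(M+1)},\,q^{-2(\Lambda-2k+1)},\,q^{-2N},\,q^{-2(\omega-M)},\,q^{2(\Lambda-N-\omega+M+1)})_j},\\ w_2(j,l)=\;&\frac{(q^{2(M+l+1)},\,q^{-2(N-l)},\,q^{-2(\Lambda-l+1)},\,q^{-2(\omega-M-l)})_j}{(q^{-2(\Lambda-2l+1)})_j}\;\frac{(q^{-2(N-3-\Lambda+l-M)-\omega-1}/z)_j}{(zq^{2(M+l)-\omega-1})_j}. \end{aligned}$$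
   Context: $0<p,q<1$ are fixed and generic (it suffices that they are algebraically independent over $\mathbb{Q}$); $q^x=\exp(x\log q)$. $\theta(z)=\prod_{j\ge0}(1-zp^j)(1-p^{j+1}/z)$; $(a)_n=\prod_{i=0}^{n-1}\theta(aq^{2i})$; $(a_1,\dots,a_r)_n=(a_1)_n\cdots(a_r)_n$; $\delta_{kl}$ is the Kronecker delta. The balanced very-well-poised elliptic hypergeometric series (base $q^2,p$) is $${}_{r+1}\omega_r(a_1;a_4,\dots,a_{r+1})=\sum_{s\ge0}\frac{\theta(a_1q^{4s})}{\theta(a_1)}\frac{(a_1,a_4,\dots,a_{r+1})_s\,q^{2s}}{(q^2,a_1q^2/a_4,\dots,a_1q^2/a_{r+1})_s},\qquad (a_4\cdots a_{r+1})^2=a_1^{r-3}q^{2(r-5)}.$$ A series with parameters $q^{-2j},q^{-2l}$ terminates, and its sum is taken over $0\le s\le\min(j,l)$. Removable cases: the series with parameters $q^{-2j},q^{-2l}$ and $q^{2(\Lambda-l-N+1)}$ has the denominator factor $(q^{2(N-l-j+1)})_s$, which may vanish if $j+l>N$. It is compensated by the factor $(q^{-2(N-l)})_j=(-1)^jq^{-2j(N-l)+j(j-1)}(q^{2(N-l-j+1)})_j$ of $w_2(j,l)$, with $(q^{2(N-l-j+1)})_j/(q^{2(N-l-j+1)})_s$ understood as $(q^{2(N-l-j+1+s)})_{j-s}$. The same applies to the second series and the factor $(q^{-2(N-k)})_j$ of $w_1(j,k)$.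
   Formalization: The norm h_k is corrected: in the denominator of its first quotient q^{-2Λ} is replaced by q^{-2(Λ+1)}, and a factor q^{-4k} is added; genericity refers to the corrected denominators. The printed h_k fails already for N=k=l=1. *)

theory Defs
  imports "HOL-Analysis.Analysis" "HOL-Computational_Algebra.Polynomial"
begin

definition alg_independent :: "real \<Rightarrow> real \<Rightarrow> bool" where
  "alg_independent x y \<longleftrightarrow>
     (\<forall>P :: rat poly poly. poly (poly (map_poly (map_poly of_rat) P) [:y:]) x = 0 \<longrightarrow> P = 0)"

definition qpow :: "real \<Rightarrow> complex \<Rightarrow> complex" where
  "qpow q x = exp (x * of_real (ln q))"

definition ell_theta :: "real \<Rightarrow> complex \<Rightarrow> complex" where
  "ell_theta p x = (\<Prod>j. (1 - x * of_real p ^ j) * (1 - of_real p ^ Suc j / x))"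

text \<open>\<open>ell_fact p q a n\<close> is $(a)_n$ in base $q^2$ and \<open>ell_facts p q as n\<close> is $(a_1,\dots,a_r)_n$.\<close>

definition ell_fact :: "real \<Rightarrow> real \<Rightarrow> complex \<Rightarrow> nat \<Rightarrow> complex" where
  "ell_fact p q a n = (\<Prod>i<n. ell_theta p (a * of_real q ^ (2 * i)))"

definition ell_facts :: "real \<Rightarrow> real \<Rightarrow> complex list \<Rightarrow> nat \<Rightarrow> complex" where
  "ell_facts p q as n = (\<Prod>a\<leftarrow>as. ell_fact p q a n)"


section \<open>Terminating very-well-poised elliptic hypergeometric series\<close>

text \<open>\<open>ell_omega p q n a1 as\<close> is ${}_{r+1}\omega_r(a_1;a_4,\dots,a_{r+1})$ with \<open>as\<close> the list
  $a_4,\dots,a_{r+1}$ (so $r$ is \<open>length as + 2\<close>), summed over $0\le s\le n$.\<close>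

definition ell_balanced :: "real \<Rightarrow> complex \<Rightarrow> complex list \<Rightarrow> bool" where
  "ell_balanced q a1 as \<longleftrightarrow>
     prod_list as ^ 2 = a1 ^ (length as - 1) * of_real q powi (2 * (int (length as) - 3))"

definition ell_omega :: "real \<Rightarrow> real \<Rightarrow> nat \<Rightarrow> complex \<Rightarrow> complex list \<Rightarrow> complex" where
  "ell_omega p q n a1 as =
     (\<Sum>s\<le>n. ell_theta p (a1 * of_real q ^ (4 * s)) / ell_theta p a1
        * (ell_facts p q (a1 # as) s * of_real q ^ (2 * s))
        / ell_facts p q (of_real q ^ 2 # map (\<lambda>a. a1 * of_real q ^ 2 / a) as) s)"

text \<open>The product of $(a_1q^2/b)_j$ and the series with parameters \<open>as @ b # bs\<close>, where the
  quotient $(a_1q^2/b)_j/(a_1q^2/b)_s$ occurring in its $s$-th term is read as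
  $(a_1q^{2+2s}/b)_{j-s}$; it makes sense also if $(a_1q^2/b)_s=0$ for some $s\le n$.\<close>

definition ell_omega_reg ::
    "real \<Rightarrow> real \<Rightarrow> nat \<Rightarrow> nat \<Rightarrow> complex \<Rightarrow> complex list \<Rightarrow> complex \<Rightarrow> complex list \<Rightarrow> complex" where
  "ell_omega_reg p q j n a1 as b bs =
     (\<Sum>s\<le>n. ell_theta p (a1 * of_real q ^ (4 * s)) / ell_theta p a1
        * (ell_facts p q (a1 # as @ b # bs) s * of_real q ^ (2 * s))
        / ell_facts p q (of_real q ^ 2 # map (\<lambda>a. a1 * of_real q ^ 2 / a) (as @ bs)) s
        * ell_fact p q (a1 * of_real q ^ (2 + 2 * s) / b) (j - s))"

definition ell_omega_defined ::
    "real \<Rightarrow> real \<Rightarrow> nat \<Rightarrow> complex \<Rightarrow> complex list \<Rightarrow> bool" where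
  "ell_omega_defined p q n a1 as \<longleftrightarrow> ell_theta p a1 \<noteq> 0 \<and>
     (\<forall>s\<le>n. ell_facts p q (of_real q ^ 2 # map (\<lambda>a. a1 * of_real q ^ 2 / a) as) s \<noteq> 0)"

lemma ell_fact_split:
  assumes "s \<le> j"
  shows "ell_fact p q a j = ell_fact p q a s * ell_fact p q (a * of_real q ^ (2 * s)) (j - s)"
proof -
  have "{..<j} = {..<s} \<union> (\<lambda>i. s + i) ` {..<j - s}"
  proof (intro equalityI subsetI)
    fix x assume "x \<in> {..<j}"
    then show "x \<in> {..<s} \<union> (\<lambda>i. s + i) ` {..<j - s}"
      by (cases "x < s") (auto intro!: image_eqI[of _ _ "x - s"])
  qed (use assms in auto)
  moreover have "{..<s} \<inter> (\<lambda>i. s + i) ` {..<j - s} = {}" by auto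
  ultimately have "ell_fact p q a j = ell_fact p q a s *
      (\<Prod>i\<in>(\<lambda>i. s + i) ` {..<j - s}. ell_theta p (a * of_real q ^ (2 * i)))"
    by (simp add: ell_fact_def prod.union_disjoint)
  also have "(\<Prod>i\<in>(\<lambda>i. s + i) ` {..<j - s}. ell_theta p (a * of_real q ^ (2 * i)))
      = ell_fact p q (a * of_real q ^ (2 * s)) (j - s)"
    by (subst prod.reindex) (auto simp: ell_fact_def power_add distrib_left mult_ac)
  finally show ?thesis .
qed

lemma ell_omega_reg_eq:
  assumes "n \<le> j" and nz: "\<And>s. s \<le> n \<Longrightarrow> ell_fact p q (a1 * of_real q ^ 2 / b) s \<noteq> 0"
  shows "ell_omega_reg p q j n a1 as b bs =
           ell_fact p q (a1 * of_real q ^ 2 / b) j * ell_omega p q n a1 (as @ b # bs)"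
proof -
  let ?c = "a1 * of_real q ^ 2 / b"
  have "ell_fact p q (a1 * of_real q ^ (2 + 2 * s) / b) (j - s)
          = ell_fact p q ?c j / ell_fact p q ?c s" if "s \<le> n" for s
  proof -
    have "a1 * of_real q ^ (2 + 2 * s) / b = ?c * of_real q ^ (2 * s)"
      by (simp only: power_add times_divide_eq_left mult.assoc)
    moreover have "ell_fact p q ?c j = ell_fact p q ?c s * ell_fact p q (?c * of_real q ^ (2 * s)) (j - s)"
      using that assms(1) by (intro ell_fact_split) simp
    ultimately show ?thesis
      by (simp only: nonzero_mult_div_cancel_left[OF nz[OF that]])
  qed
  then show ?thesis
    unfolding ell_omega_reg_def ell_omega_def sum_distrib_left
    by (intro sum.cong refl) (simp add: ell_facts_def mult_ac)
qed


section \<open>The two families, the weight and the norm\<close>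

context
  fixes p q :: real and N :: nat and \<Lambda> M \<omega> z :: complex
begin

definition lead_par :: "nat \<Rightarrow> nat \<Rightarrow> complex" where
  "lead_par j l = qpow q (2 * (\<Lambda> - 2 * of_nat l - of_nat j + 1))"

definition init_pars :: "nat \<Rightarrow> nat \<Rightarrow> complex list" where
  "init_pars j l = [qpow q (- 2 * of_nat j), qpow q (- 2 * of_nat l)]"

definition rem_par :: "nat \<Rightarrow> complex" where
  "rem_par l = qpow q (2 * (\<Lambda> - of_nat l - of_nat N + 1))"

definition tail_pars1 :: "nat \<Rightarrow> nat \<Rightarrow> complex list" where
  "tail_pars1 j l =
    [qpow q (2 * (\<Lambda> - of_nat l - \<omega> + M + 1)),
     qpow q (2 * (\<Lambda> - of_nat l + M + 2)),
     z * qpow q (2 * (of_nat N - M - of_nat j - of_nat l) + \<omega> - 1),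
     qpow q (- 2 * (M + of_nat j + of_nat l - 2) + \<omega> - 1) / z]"

definition tail_pars2 :: "nat \<Rightarrow> nat \<Rightarrow> complex list" where
  "tail_pars2 j k =
    [qpow q (2 * (\<Lambda> - of_nat k - \<omega> + M + 1)),
     qpow q (2 * (\<Lambda> - of_nat k + M + 2)),
     z * qpow q (2 * (of_nat N - M - of_nat j - of_nat k) + \<omega> - 3),
     qpow q (- 2 * (M + of_nat j + of_nat k - 2) + \<omega> + 1) / z]"

definition series1 :: "nat \<Rightarrow> nat \<Rightarrow> complex" where
  "series1 j l = ell_omega p q (min j l) (lead_par j l)
     (init_pars j l @ rem_par l # tail_pars1 j l)"

definition series2 :: "nat \<Rightarrow> nat \<Rightarrow> complex" where
  "series2 j k = ell_omega p q (min j k) (lead_par j k)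
     (init_pars j k @ rem_par k # tail_pars2 j k)"

definition w1_denominators :: "nat \<Rightarrow> nat \<Rightarrow> complex" where
  "w1_denominators j k =
     ell_theta p (qpow q (2 * (\<Lambda> - \<omega> + 2 * M - of_nat N + 1)))
     * ell_fact p q (qpow q (2 * (\<Lambda> - \<omega> + 2 * M + 2))) j
     * ell_fact p q (qpow q (- 2 * (of_nat N - 2 - M - of_nat k) - \<omega> + 1) / z) j
     * ell_facts p q
         [qpow q 2,
          qpow q (2 * (\<Lambda> - of_nat N + M + 2)),
          qpow q (2 * (M + 1)),
          qpow q (- 2 * (\<Lambda> - 2 * of_nat k + 1)),
          qpow q (- 2 * of_nat N),
          qpow q (- 2 * (\<omega> - M)),
          qpow q (2 * (\<Lambda> - of_nat N - \<omega> + M + 1))] j"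

text \<open>\<open>w1_rest j k\<close> and \<open>w2_rest j l\<close> are the weight factors $w_1(j,k)$ and $w_2(j,l)$ without their
  respective factors $(q^{-2(N-k)})_j$ and $(q^{-2(N-l)})_j$.\<close>

definition w1_rest :: "nat \<Rightarrow> nat \<Rightarrow> complex" where
  "w1_rest j k =
     qpow q (2 * of_nat j - 2 * of_nat k)
     * ell_theta p (qpow q (2 * (\<Lambda> - \<omega> + 2 * M - of_nat N + 1 + 2 * of_nat j)))
     * ell_fact p q (qpow q (2 * (\<Lambda> - \<omega> + 2 * M - of_nat N + 1))) j
     * ell_fact p q (z * qpow q (2 * (\<Lambda> - of_nat k + M) - \<omega> - 1)) j
     * ell_facts p q
         [qpow q (2 * (M + of_nat k + 1)),
          qpow q (- 2 * (\<Lambda> - of_nat k + 1)),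
          qpow q (- 2 * (\<omega> - M - of_nat k))] j
     / w1_denominators j k"

definition w1 :: "nat \<Rightarrow> nat \<Rightarrow> complex" where
  "w1 j k = w1_rest j k * ell_fact p q (qpow q (- 2 * (of_nat N - of_nat k))) j"

definition w2_denominators :: "nat \<Rightarrow> nat \<Rightarrow> complex" where
  "w2_denominators j l =
     ell_fact p q (qpow q (- 2 * (\<Lambda> - 2 * of_nat l + 1))) j
     * ell_fact p q (z * qpow q (2 * (M + of_nat l) - \<omega> - 1)) j"

definition w2_rest :: "nat \<Rightarrow> nat \<Rightarrow> complex" where
  "w2_rest j l =
     ell_facts p q
       [qpow q (2 * (M + of_nat l + 1)),
        qpow q (- 2 * (\<Lambda> - of_nat l + 1)),
        qpow q (- 2 * (\<omega> - M - of_nat l))] j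
     * ell_fact p q (qpow q (- 2 * (of_nat N - 3 - \<Lambda> + of_nat l - M) - \<omega> - 1) / z) j
     / w2_denominators j l"

definition w2 :: "nat \<Rightarrow> nat \<Rightarrow> complex" where
  "w2 j l = w2_rest j l * ell_fact p q (qpow q (- 2 * (of_nat N - of_nat l))) j"

text \<open>The products $(q^{-2(N-l)})_j\cdot{}$\<open>series1 j l\<close> and $(q^{-2(N-k)})_j\cdot{}$\<open>series2 j k\<close>.
  The first factor is written as
  $(q^{-2(N-l)})_j=(-1)^jq^{-2j(N-l)+j(j-1)}(q^{2(N-l-j+1)})_j$, and $q^{2(N-l-j+1)}$ is $a_1q^2/b$ for
  the parameter $b=q^{2(\Lambda-l-N+1)}$ of the series, so that a zero of the denominator factor
  $(q^{2(N-l-j+1)})_s$, which occurs for $j+l>N$, cancels.\<close>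

definition fact_series1 :: "nat \<Rightarrow> nat \<Rightarrow> complex" where
  "fact_series1 j l =
     (- 1) ^ j * qpow q (- 2 * of_nat j * (of_nat N - of_nat l) + of_nat j * (of_nat j - 1))
     * ell_omega_reg p q j (min j l) (lead_par j l) (init_pars j l) (rem_par l) (tail_pars1 j l)"

definition fact_series2 :: "nat \<Rightarrow> nat \<Rightarrow> complex" where
  "fact_series2 j k =
     (- 1) ^ j * qpow q (- 2 * of_nat j * (of_nat N - of_nat k) + of_nat j * (of_nat j - 1))
     * ell_omega_reg p q j (min j k) (lead_par j k) (init_pars j k) (rem_par k) (tail_pars2 j k)"

definition biorth_summand :: "nat \<Rightarrow> nat \<Rightarrow> nat \<Rightarrow> complex" where
  "biorth_summand j k l = w1_rest j k * w2_rest j l * fact_series1 j l * fact_series2 j k"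

text \<open>The source formula for $h_k$ has $q^{-2\Lambda}$ in place of $q^{-2(\Lambda+1)}$ in the
  denominator of the first quotient and lacks the factor $q^{-4k}$. With that formula the relation
  fails generically for $k=l\ge1$ (already for $N=k=l=1$ and in the limit $p\to0$); the two corrections give the
  right normalization with the weight left unchanged.\<close>

definition norm_denominators :: "nat \<Rightarrow> complex" where
  "norm_denominators k =
     ell_facts p q
       [qpow q (2 * (M + 1)), qpow q (- 2 * of_nat N), qpow q (- 2 * (\<omega> - M)), qpow q (- 2 * (\<Lambda> + 1))] k
     * ell_fact p q (qpow q (- 2 * \<Lambda>)) (2 * k)
     * ell_facts p q
         [qpow q (- 2 * (\<Lambda> + M) + \<omega> + 1) / z, z * qpow q (2 * (of_nat N - \<Lambda> - M) + \<omega> - 5)] k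
     * ell_facts p q
         [qpow q (- 2 * (\<Lambda> + M + 1)), qpow q (- 2 * (\<Lambda> - \<omega> + M))] N
     * ell_facts p q
         [z * qpow q (2 * M - \<omega> - 1), z * qpow q (- 2 * M + \<omega> - 3)] N"

definition norm_h :: "nat \<Rightarrow> complex" where
  "norm_h k =
     qpow q (- 4 * of_nat k)
     * ell_facts p q
         [qpow q 2, qpow q (- 2 * (\<Lambda> + M + 1)), qpow q (- 2 * (\<Lambda> - \<omega> + M)), qpow q (- 2 * (\<Lambda> - of_nat N))] k
     * ell_fact p q (qpow q (- 2 * (\<Lambda> + 1))) (2 * k)
     * ell_facts p q
         [z * qpow q (2 * M - \<omega> - 1), qpow q (2 * (M - of_nat N) - \<omega> + 5) / z] k
     * ell_facts p q
         [qpow q (- 2 * (\<Lambda> - \<omega> + 2 * M + 1)), qpow q (- 2 * \<Lambda>)] N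
     * ell_facts p q
         [z * qpow q (\<omega> - 1), z * qpow q (- \<omega> - 3)] N
     / norm_denominators k"

text \<open>No denominator vanishes; the denominator factor belonging to \<open>rem_par\<close> is exempted in both
  series.\<close>

definition generic_params :: "nat \<Rightarrow> nat \<Rightarrow> bool" where
  "generic_params k l \<longleftrightarrow>
     norm_denominators k \<noteq> 0 \<and>
     (\<forall>j\<le>N. w1_denominators j k \<noteq> 0 \<and> w2_denominators j l \<noteq> 0 \<and>
        ell_omega_defined p q (min j l) (lead_par j l) (init_pars j l @ tail_pars1 j l) \<and>
        ell_omega_defined p q (min j k) (lead_par j k) (init_pars j k @ tail_pars2 j k))"

end


section \<open>Consistency of the conventions\<close>

lemma qpow_add: "qpow q (x + y) = qpow q x * qpow q y"
  by (simp add: qpow_def distrib_right exp_add)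

lemma qpow_diff: "qpow q (x - y) = qpow q x / qpow q y"
  by (simp add: qpow_def left_diff_distrib exp_diff)

lemma qpow_nonzero [simp]: "qpow q x \<noteq> 0"
  by (simp add: qpow_def)

lemma qpow_of_nat: "0 < q \<Longrightarrow> qpow q (of_nat n) = of_real q ^ n"
  by (simp add: qpow_def exp_of_nat_mult exp_of_real)

lemma qpow_power: "qpow q x ^ n = qpow q (of_nat n * x)"
  by (simp add: qpow_def exp_of_nat_mult mult.assoc)

lemma series_balanced:
  assumes "0 < q" "z \<noteq> 0"
  shows "ell_balanced q (lead_par q \<Lambda> j l)
           (init_pars q j l @ rem_par q N \<Lambda> l # tail_pars1 q N \<Lambda> M \<omega> z j l)"
    and "ell_balanced q (lead_par q \<Lambda> j l)
           (init_pars q j l @ rem_par q N \<Lambda> l # tail_pars2 q N \<Lambda> M \<omega> z j l)"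
proof -
  have *: "complex_of_real q ^ 8 = qpow q 8"
    using qpow_of_nat[OF assms(1), of 8] by simp
  show "ell_balanced q (lead_par q \<Lambda> j l)
           (init_pars q j l @ rem_par q N \<Lambda> l # tail_pars1 q N \<Lambda> M \<omega> z j l)"
    unfolding ell_balanced_def init_pars_def rem_par_def tail_pars1_def lead_par_def
    using assms(2)
    by (simp add: power_int_def * qpow_power power_mult_distrib power_divide
        flip: qpow_add) (simp add: algebra_simps)
  show "ell_balanced q (lead_par q \<Lambda> j l)
           (init_pars q j l @ rem_par q N \<Lambda> l # tail_pars2 q N \<Lambda> M \<omega> z j l)"
    unfolding ell_balanced_def init_pars_def rem_par_def tail_pars2_def lead_par_def
    using assms(2)
    by (simp add: power_int_def * qpow_power power_mult_distrib power_divide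
        flip: qpow_add) (simp add: algebra_simps)
qed

lemma theta_factor:
  fixes x :: complex
  assumes "0 < p" "p < 1"
  shows "convergent_prod (\<lambda>j. 1 - x * of_real p ^ j)"
    and "(\<Prod>j. 1 - x * of_real p ^ j) = (1 - x) * (\<Prod>j. 1 - x * of_real p ^ Suc j)"
proof -
  have "summable (\<lambda>j. norm (1 - x * of_real p ^ j - 1))"
    using assms by (simp add: norm_mult norm_power summable_mult summable_geometric)
  then show conv: "convergent_prod (\<lambda>j. 1 - x * of_real p ^ j)"
    by (intro abs_convergent_prod_imp_convergent_prod summable_imp_abs_convergent_prod)
  show "(\<Prod>j. 1 - x * of_real p ^ j) = (1 - x) * (\<Prod>j. 1 - x * of_real p ^ Suc j)"
    using has_prod_unique[OF has_prod_ignore_initial_segment'[OF conv, of 1]] by simp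
qed

lemma ell_theta_inverse:
  assumes "0 < p" "p < 1" "x \<noteq> 0"
  shows "ell_theta p (1 / x) = - ell_theta p x / x"
proof -
  define G where "G y = (\<Prod>j. 1 - y * complex_of_real p ^ j)" for y
  have head: "G y = (1 - y) * G (y * of_real p)" for y
    using theta_factor(2)[OF assms(1,2), of y] by (simp add: G_def mult.assoc)
  have theta: "ell_theta p y = G y * G (of_real p / y)" for y
    unfolding ell_theta_def G_def
    using prodinf_mult[OF theta_factor(1)[OF assms(1,2), of y]
        theta_factor(1)[OF assms(1,2), of "of_real p / y"]] by simp
  have "ell_theta p (1 / x) = (1 - 1 / x) * G (of_real p / x) * G (x * of_real p)"
    using head[of "1 / x"] by (simp add: theta mult_ac)
  moreover have "ell_theta p x = (1 - x) * G (x * of_real p) * G (of_real p / x)"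
    using head[of x] by (simp add: theta)
  moreover have "1 - 1 / x = - (1 - x) / x"
    using assms(3) by (simp add: field_simps)
  ultimately show ?thesis
    by (simp only:) (use assms(3) in \<open>simp add: field_simps\<close>)
qed

lemma ell_fact_reflect:
  assumes "0 < p" "p < 1" "0 < q"
  shows "ell_fact p q (qpow q (- 2 * a)) j =
    (- 1) ^ j * qpow q (- 2 * of_nat j * a + of_nat j * (of_nat j - 1))
      * ell_fact p q (qpow q (2 * (a - of_nat j + 1))) j"
proof -
  have "ell_fact p q (qpow q (- 2 * a)) j = (\<Prod>i<j. ell_theta p (1 / qpow q (2 * (a - of_nat i))))"
    unfolding ell_fact_def
    by (simp add: qpow_of_nat[OF assms(3), symmetric] qpow_diff right_diff_distrib)
       (simp add: qpow_def exp_minus divide_simps)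
  also have "\<dots> = (\<Prod>i<j. - 1 * qpow q (- 2 * (a - of_nat i)) * ell_theta p (qpow q (2 * (a - of_nat i))))"
    by (intro prod.cong refl, subst ell_theta_inverse)
       (simp_all add: assms qpow_diff right_diff_distrib)
  also have "\<dots> = (- 1) ^ j * (\<Prod>i<j. qpow q (- 2 * (a - of_nat i)))
      * (\<Prod>i<j. ell_theta p (qpow q (2 * (a - of_nat i))))"
    by (simp only: prod.distrib) simp
  also have "(\<Prod>i<j. qpow q (- 2 * (a - of_nat i)))
      = qpow q (- 2 * of_nat j * a + of_nat j * (of_nat j - 1))"
  proof (induction j)
    case 0
    then show ?case by (simp add: qpow_def)
  next
    case (Suc j)
    then show ?case
      by (simp only: prod.lessThan_Suc qpow_add[symmetric]) (simp add: algebra_simps)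
  qed
  also have "(\<Prod>i<j. ell_theta p (qpow q (2 * (a - of_nat i))))
      = (\<Prod>i<j. ell_theta p (qpow q (2 * (a - of_nat (j - Suc i)))))"
    by (rule prod.nat_diff_reindex[symmetric])
  also have "\<dots> = ell_fact p q (qpow q (2 * (a - of_nat j + 1))) j"
    unfolding ell_fact_def
    by (intro prod.cong refl arg_cong[of _ _ "ell_theta p"])
       (simp add: qpow_of_nat[OF assms(3), symmetric] qpow_add[symmetric] of_nat_diff algebra_simps)
  finally show ?thesis .
qed

text \<open>Where the removable denominator factors do not vanish, \<open>biorth_summand\<close> is literally the weight
  $w_j=w_1(j,k)w_2(j,l)$ times the two series.\<close>

lemma biorth_summand_eq:
  assumes "0 < p" "p < 1" "0 < q"
    and "\<And>s. s \<le> min j l \<Longrightarrow> ell_fact p q (qpow q (2 * (of_nat N - of_nat l - of_nat j + 1))) s \<noteq> 0"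
    and "\<And>s. s \<le> min j k \<Longrightarrow> ell_fact p q (qpow q (2 * (of_nat N - of_nat k - of_nat j + 1))) s \<noteq> 0"
  shows "biorth_summand p q N \<Lambda> M \<omega> z j k l =
           w1 p q N \<Lambda> M \<omega> z j k * w2 p q N \<Lambda> M \<omega> z j l
           * series1 p q N \<Lambda> M \<omega> z j l * series2 p q N \<Lambda> M \<omega> z j k"
proof -
  have c: "lead_par q \<Lambda> j m * of_real q ^ 2 / rem_par q N \<Lambda> m
      = qpow q (2 * (of_nat N - of_nat m - of_nat j + 1))" for m
    using qpow_of_nat[OF assms(3), of 2, symmetric]
    by (simp add: lead_par_def rem_par_def qpow_add[symmetric] qpow_diff[symmetric])
       (simp add: algebra_simps)
  have 1: "fact_series1 p q N \<Lambda> M \<omega> z j l =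
      ell_fact p q (qpow q (- 2 * (of_nat N - of_nat l))) j * series1 p q N \<Lambda> M \<omega> z j l"
    unfolding fact_series1_def series1_def
    by (subst ell_omega_reg_eq) (use assms in \<open>simp_all only: c min.cobounded1 ell_fact_reflect mult.assoc simp_thms\<close>)
  have 2: "fact_series2 p q N \<Lambda> M \<omega> z j k =
      ell_fact p q (qpow q (- 2 * (of_nat N - of_nat k))) j * series2 p q N \<Lambda> M \<omega> z j k"
    unfolding fact_series2_def series2_def
    by (subst ell_omega_reg_eq) (use assms in \<open>simp_all only: c min.cobounded1 ell_fact_reflect mult.assoc simp_thms\<close>)
  show ?thesis
    unfolding biorth_summand_def w1_def w2_def 1 2 by (simp only: mult_ac)
qed

end

theory Submission
  imports Defs "HOL-Complex_Analysis.Complex_Analysis"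
begin

text \<open>Put $S(u)=q^{-u}\theta(q^{2u})$, an odd entire function with the three-term addition formula
\<open>sig_addition\<close>; in this normalization every power of $q$ in a balanced formula disappears, and
$(q^{2u})_n$ becomes $[u]_n=\prod_{i<n}S(u+i)$. Let $h_n(x;a)=[a+x]_n[a-x]_n$. For generic $a,b$ the
functions $e_k(a,b)=h_k(x;a)h_{N-k}(x;b)$, $0\le k\le N$, of $x$ are linearly independent, and the
biorthogonality relation is the statement that passing from the functions $e_l(a,b)$ to the functions
$e_j(c,d)$ and back is the identity.

Passing between these bases rests on the elliptic binomial theorem (\<open>elliptic_binomial\<close>), which
expands $h_n(x;a)$ in the products $h_k(x;b)h_{n-k}(x;c)$; its coefficients satisfy a Pascal
recursion that is the addition formula. Expanding the two factors of $e_l(a,b)$ one after the other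
gives the coefficient $R_l^j(a,b;c,d)$ of $e_j(c,d)$ as a single sum. The two orders of expansion give
two different sums, and they agree by linear independence (\<open>conn1_eq_conn2\<close>). The composition with
the inverse change of basis is \<open>conn_inverse\<close>.

It remains to recognize the two series of the theorem. With $a-b=N-1-\Lambda$, $a+c=M+1$,
$b+d=1-N-M+\omega$ and $z=q^{3-N-a-b+c+d}$, the series with index $k$ is the second sum for
$R_j^k(c,d;a,b)$ up to an explicit factor (\<open>vwp_series_eq\<close>). The series with index $l$ is obtained from
it by $(a,b,c,d)\mapsto(g-b,g-a,g-d,g-c)$ with $2g=a+b+c+d$, so it is a multiple of
$R_j^l(g-d,g-c;g-b,g-a)$. Now the first sum is self-dual: term by term it shows that this coefficient
is an explicit multiple of $R_l^j(a,b;c,d)$ (\<open>conn1_duality\<close>). Thus the products of the two series are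
the products in \<open>conn_inverse\<close>, and the remaining factors multiply up to the weight times a factor
that does not depend on $j$ (\<open>weight_eq\<close>) and is the norm for $k=l$ (\<open>pairing_const_diag\<close>). The
identities for these factors hold because each coset $\pm a\pm b+\mathbb Z$, $\pm a\pm c+\mathbb Z$, ...
of arguments of $S$ cancels separately.

The removable cases $j+l>N$ are covered because the regularized factor
$(q^{2(N-l-j+1+s)})_{j-s}$ vanishes exactly for those $s$ for which the corresponding pair of binomial
coefficients does not occur in the second sum. All of this is carried out where $S$ has no zero on
the relevant cosets. A suitable real line through a given point in the space of
$(a,b,c,d)$ meets the excluded set in countably many points, and both sides are continuous wherever the denominators
of the theorem do not vanish (\<open>biorthogonality\<close>).\<close>

section \<open>The theta function in additive notation\<close>

definition half_theta :: "real \<Rightarrow> complex \<Rightarrow> complex" where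
  "half_theta p x = (\<Prod>j. 1 - x * of_real p ^ j)"

lemma half_theta_step:
  assumes "0 < p" "p < 1"
  shows "half_theta p x = (1 - x) * half_theta p (of_real p * x)"
  using theta_factor(2)[OF assms, of x] by (simp add: half_theta_def mult_ac)

lemma ell_theta_eq_half_theta:
  assumes "0 < p" "p < 1"
  shows "ell_theta p x = half_theta p x * half_theta p (of_real p / x)"
  unfolding ell_theta_def half_theta_def
  using prodinf_mult[OF theta_factor(1)[OF assms, of x] theta_factor(1)[OF assms, of "of_real p / x"]]
  by simp

lemma half_theta_nonzero:
  assumes "0 < p" "p < 1" "\<And>j. x * of_real p ^ j \<noteq> 1"
  shows "half_theta p x \<noteq> 0"
  unfolding half_theta_def
  by (rule prodinf_nonzero[OF theta_factor(1)[OF assms(1,2)]]) (use assms(3) in auto)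

text \<open>The partial products converge uniformly on each disc, by comparison with a geometric series.\<close>

lemma half_theta_holomorphic:
  assumes "0 < p" "p < 1"
  shows "half_theta p holomorphic_on UNIV"
proof (rule holomorphic_uniform_sequence)
  show "(\<lambda>x. \<Prod>j<n. 1 - x * of_real p ^ j) holomorphic_on UNIV" for n
    by (intro holomorphic_intros)
  fix x :: complex
  let ?K = "cball x 1"
  have lim: "(\<lambda>n. \<Prod>j<n. 1 - y * of_real p ^ j) \<longlonglongrightarrow> half_theta p y" for y
    unfolding half_theta_def
    by (intro has_prod_imp_tendsto' convergent_prod_has_prod theta_factor(1) assms)
  have "uniformly_convergent_on ?K (\<lambda>n y. \<Prod>j<n. 1 - y * of_real p ^ j)"
  proof (rule uniformly_convergent_on_prod')
    show "uniformly_convergent_on ?K (\<lambda>n y. \<Sum>j<n. norm (1 - y * of_real p ^ j - 1))"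
    proof (rule Weierstrass_m_test'[where M = "\<lambda>j. (norm x + 1) * p ^ j"])
      show "summable (\<lambda>j. (norm x + 1) * p ^ j)"
        using assms by (intro summable_mult summable_geometric) auto
      fix j y assume "y \<in> ?K"
      then have "norm y \<le> norm x + 1"
        using norm_triangle_ineq2[of y x] by (simp add: dist_norm norm_minus_commute)
      then show "norm (norm (1 - y * of_real p ^ j - 1)) \<le> (norm x + 1) * p ^ j"
        using assms by (simp add: norm_mult norm_power mult_right_mono)
    qed
  qed (auto intro!: continuous_intros)
  then have "uniform_limit ?K (\<lambda>n y. \<Prod>j<n. 1 - y * of_real p ^ j) (half_theta p) sequentially"
    by (simp add: uniformly_convergent_uniform_limit_iff limI[OF lim])
  then show "\<exists>d>0. cball x d \<subseteq> UNIV
      \<and> uniform_limit (cball x d) (\<lambda>n y. \<Prod>j<n. 1 - y * of_real p ^ j) (half_theta p) sequentially"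
    by (intro exI[of _ 1]) auto
qed auto

lemma ell_theta_shift:
  assumes "0 < p" "p < 1" "x \<noteq> 0"
  shows "ell_theta p (of_real p * x) = - ell_theta p x / x"
proof -
  have "x = 1 \<or> ell_theta p (of_real p * x) = - ell_theta p x / x"
  proof -
    have "ell_theta p (of_real p * x) = half_theta p (of_real p * x) * half_theta p (1 / x)"
      using assms(1) by (simp add: ell_theta_eq_half_theta[OF assms(1,2)])
    also have "half_theta p (1 / x) = (1 - 1 / x) * half_theta p (of_real p / x)"
      using half_theta_step[OF assms(1,2), of "1 / x"] by simp
    finally have "(1 - x) * ell_theta p (of_real p * x)
        = ((1 - x) * half_theta p (of_real p * x)) * ((1 - 1 / x) * half_theta p (of_real p / x))"
      by simp
    also have "\<dots> = (1 - 1 / x) * ell_theta p x"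
      by (simp add: half_theta_step[OF assms(1,2), of x, symmetric] ell_theta_eq_half_theta[OF assms(1,2)])
    also have "\<dots> = (1 - x) * (- ell_theta p x / x)"
      using assms(3) by (simp add: divide_simps) (simp add: algebra_simps)
    finally have "(1 - x) * ell_theta p (of_real p * x) = (1 - x) * (- ell_theta p x / x)" .
    then show ?thesis by (simp only: mult_cancel_left) (metis diff_eq_eq add_0)
  qed
  moreover have "half_theta p 1 = 0"
    using half_theta_step[OF assms(1,2), of 1] by simp
  ultimately show ?thesis
    using assms by (cases "x = 1") (simp_all add: ell_theta_eq_half_theta)
qed

text \<open>The factor $C$ is $(-1)^mp^{-m(m-1)/2}$.\<close>

lemma ell_theta_shift_int:
  fixes m :: int
  assumes "0 < p" "p < 1"
  obtains C where "C \<noteq> 0"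
    and "\<And>x. x \<noteq> 0 \<Longrightarrow> ell_theta p (of_real p powi m * x) = C * x powi (- m) * ell_theta p x"
proof -
  have "\<exists>C. C \<noteq> 0 \<and> (\<forall>x. x \<noteq> 0 \<longrightarrow>
      ell_theta p (of_real p powi m * x) = C * x powi (- m) * ell_theta p x)"
  proof (induction m rule: int_induct[where k = 0])
    case base
    then show ?case by (intro exI[of _ 1]) simp
  next
    case (step1 m)
    then obtain C where C: "C \<noteq> 0"
      "\<And>x. x \<noteq> 0 \<Longrightarrow> ell_theta p (of_real p powi m * x) = C * x powi (- m) * ell_theta p x"
      by blast
    have "ell_theta p (of_real p powi (m + 1) * x)
        = (- C / of_real p powi m) * x powi (- (m + 1)) * ell_theta p x" if "x \<noteq> 0" for x
    proof -
      have "of_real p powi (m + 1) * x = of_real p * (of_real p powi m * x)"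
        using assms by (simp add: power_int_add)
      then have "ell_theta p (of_real p powi (m + 1) * x)
          = - (C * x powi (- m) * ell_theta p x) / (of_real p powi m * x)"
        using that assms(1) ell_theta_shift[OF assms, of "of_real p powi m * x"] C(2)[OF that]
        by (simp only:) simp
      also have "x powi (- m) = x * x powi (- (m + 1))"
        using that by (simp add: power_int_diff power_int_minus)
      finally show ?thesis
        using that by simp
    qed
    then show ?case
      using C(1) assms by (intro exI[of _ "- C / of_real p powi m"]) simp
  next
    case (step2 m)
    then obtain C where C: "C \<noteq> 0"
      "\<And>x. x \<noteq> 0 \<Longrightarrow> ell_theta p (of_real p powi m * x) = C * x powi (- m) * ell_theta p x"
      by blast
    have "ell_theta p (of_real p powi (m - 1) * x)
        = (- C * of_real p powi (m - 1)) * x powi (- (m - 1)) * ell_theta p x" if "x \<noteq> 0" for x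
    proof -
      have "of_real p powi m * x = of_real p * (of_real p powi (m - 1) * x)"
        using assms by (simp add: power_int_diff)
      then have "- ell_theta p (of_real p powi (m - 1) * x) / (of_real p powi (m - 1) * x)
          = C * x powi (- m) * ell_theta p x"
        using that assms(1) ell_theta_shift[OF assms, of "of_real p powi (m - 1) * x"] C(2)[OF that]
        by (simp add: mult.assoc)
      then show ?thesis
        using that assms by (simp add: power_int_minus power_int_diff field_simps) (metis minus_minus)
    qed
    then show ?case
      using C(1) assms by (intro exI[of _ "- C * of_real p powi (m - 1)"]) simp
  qed
  then show ?thesis using that by blast
qed

lemma ell_theta_eq_0_iff:
  assumes "0 < p" "p < 1" "x \<noteq> 0"
  shows "ell_theta p x = 0 \<longleftrightarrow> (\<exists>m::int. x = of_real p powi m)"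
proof
  assume "ell_theta p x = 0"
  then consider "half_theta p x = 0" | "half_theta p (of_real p / x) = 0"
    by (auto simp: ell_theta_eq_half_theta[OF assms(1,2)])
  then show "\<exists>m::int. x = of_real p powi m"
  proof cases
    case 1
    then obtain j where "x * of_real p ^ j = 1"
      using half_theta_nonzero[OF assms(1,2)] by blast
    then have "x = of_real p powi (- int j)"
      using assms(1) by (simp add: power_int_minus field_simps)
    then show ?thesis by blast
  next
    case 2
    then obtain j where "of_real p / x * of_real p ^ j = 1"
      using half_theta_nonzero[OF assms(1,2)] by blast
    then have "x = of_real p powi (int (Suc j))"
      using assms(3) by (simp only: power_int_of_nat) (simp add: field_simps)
    then show ?thesis by blast
  qed
next
  assume "\<exists>m::int. x = of_real p powi m"
  then obtain m :: int where m: "x = of_real p powi m" by blast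
  obtain C where "\<And>x. x \<noteq> 0 \<Longrightarrow> ell_theta p (of_real p powi m * x) = C * x powi (- m) * ell_theta p x"
    using ell_theta_shift_int[OF assms(1,2)] by blast
  from this[of 1] m have "ell_theta p x = C * ell_theta p 1" by simp
  also have "ell_theta p 1 = 0"
    using half_theta_step[OF assms(1,2), of 1] by (simp add: ell_theta_eq_half_theta[OF assms(1,2)])
  finally show "ell_theta p x = 0" by simp
qed

text \<open>The factor $q^{-u}$ makes the theta function odd in the additive variable, so that reflecting an
  argument costs a sign and no power of $q$.\<close>

definition sig :: "real \<Rightarrow> real \<Rightarrow> complex \<Rightarrow> complex" where
  "sig p q u = qpow q (- u) * ell_theta p (qpow q (2 * u))"

lemma qpow_holomorphic [holomorphic_intros]:
  assumes "f holomorphic_on A"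
  shows "(\<lambda>u. qpow q (f u)) holomorphic_on A"
  unfolding qpow_def using assms by (intro holomorphic_intros)

lemma qpow_0 [simp]: "qpow q 0 = 1" by (simp add: qpow_def)

lemma qpow_minus: "qpow q (- x) = 1 / qpow q x"
  by (simp add: qpow_def exp_minus field_simps)

lemma qpow_powi: "qpow q x powi m = qpow q (of_int m * x)"
  by (simp add: qpow_def exp_power_int mult_ac)

locale nome =
  fixes p q :: real
  assumes p: "0 < p" "p < 1" and q: "0 < q" "q < 1"
begin

abbreviation "S \<equiv> sig p q"

lemma sig_holomorphic: "S holomorphic_on UNIV"
proof -
  have h: "(\<lambda>u. half_theta p (g u)) holomorphic_on UNIV" if "g holomorphic_on UNIV" for g
    using holomorphic_on_compose_gen[OF that half_theta_holomorphic[OF p]] by (simp add: o_def)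
  have "(\<lambda>u. qpow q (- u) * (half_theta p (qpow q (2 * u)) * half_theta p (of_real p / qpow q (2 * u))))
      holomorphic_on UNIV"
    by (intro holomorphic_intros h) auto
  then show ?thesis
    by (simp add: sig_def[abs_def] ell_theta_eq_half_theta[OF p])
qed

lemma sig_has_deriv: "(S has_field_derivative deriv S u) (at u)"
  using holomorphic_derivI[OF sig_holomorphic] by simp

lemma sig_isCont: "isCont S u"
  using sig_has_deriv DERIV_isCont by blast

lemma sig_minus: "S (- u) = - S u"
proof -
  have "ell_theta p (qpow q (- (2 * u))) = - ell_theta p (qpow q (2 * u)) / qpow q (2 * u)"
    using ell_theta_inverse[OF p, of "qpow q (2 * u)"] by (simp add: qpow_minus)
  moreover have "qpow q (2 * u) = qpow q u * qpow q u"
    by (simp add: qpow_add[symmetric])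
  ultimately show ?thesis
    by (simp add: sig_def qpow_minus field_simps)
qed

lemma sig_0: "S 0 = 0"
  using sig_minus[of 0] by simp

lemma sig_eq_0_iff: "S u = 0 \<longleftrightarrow> (\<exists>m::int. qpow q (2 * u) = of_real p powi m)"
  using ell_theta_eq_0_iff[OF p, of "qpow q (2 * u)"] by (simp add: sig_def)

lemma sig_quasi_period:
  assumes "S w = 0"
  obtains C B where "C \<noteq> 0" "\<And>u. S (u + w) = C * exp (B * u) * S u"
proof -
  obtain m :: int where m: "qpow q (2 * w) = of_real p powi m"
    using assms sig_eq_0_iff by blast
  obtain C where C: "C \<noteq> 0"
    "\<And>x. x \<noteq> 0 \<Longrightarrow> ell_theta p (of_real p powi m * x) = C * x powi (- m) * ell_theta p x"
    using ell_theta_shift_int[OF p] by blast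
  have "S (u + w) = (qpow q (- w) * C) * exp (- (2 * of_int m * of_real (ln q)) * u) * S u" for u
  proof -
    have "S (u + w) = qpow q (- u) * qpow q (- w) * ell_theta p (of_real p powi m * qpow q (2 * u))"
      by (simp add: sig_def m[symmetric] qpow_add[symmetric] algebra_simps)
    also have "\<dots> = qpow q (- w) * C * qpow q (- (of_int m * (2 * u))) * S u"
      by (subst C(2)) (simp_all add: qpow_powi sig_def)
    finally show ?thesis by (simp add: qpow_def mult_ac)
  qed
  then show ?thesis
    by (intro that[of "qpow q (- w) * C" "- (2 * of_int m * of_real (ln q))"]) (use C(1) in auto)
qed

text \<open>Near $x=1$ the theta function is $1-x$ times a function that does not vanish at $1$.\<close>

lemma sig_deriv_0: "deriv S 0 \<noteq> 0"
proof -
  let ?f = "\<lambda>u. qpow q (- u) * (half_theta p (of_real p * qpow q (2 * u)) * half_theta p (of_real p / qpow q (2 * u)))"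
  have h: "(\<lambda>u. half_theta p (g u)) holomorphic_on UNIV" if "g holomorphic_on UNIV" for g
    using holomorphic_on_compose_gen[OF that half_theta_holomorphic[OF p]] by (simp add: o_def)
  have "?f holomorphic_on UNIV"
    by (intro holomorphic_intros h) auto
  then have f': "(?f has_field_derivative deriv ?f 0) (at 0)"
    using holomorphic_derivI[of ?f UNIV 0] by simp
  have g': "((\<lambda>u. 1 - qpow q (2 * u)) has_field_derivative - (2 * of_real (ln q))) (at 0)"
    unfolding qpow_def by (auto intro!: derivative_eq_intros)
  have "S = (\<lambda>u. (1 - qpow q (2 * u)) * ?f u)"
    unfolding sig_def fun_eq_iff ell_theta_eq_half_theta[OF p] half_theta_step[OF p, of "qpow q (2 * u)" for u]
    by simp
  then have "(S has_field_derivative - (2 * of_real (ln q)) * ?f 0) (at 0)"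
    using DERIV_mult[OF g' f'] by simp
  then have "deriv S 0 = - (2 * of_real (ln q)) * ?f 0"
    by (rule DERIV_imp_deriv)
  moreover have "half_theta p (of_real p) \<noteq> 0"
  proof (rule half_theta_nonzero[OF p])
    fix j
    have "p ^ Suc j < 1" using p by (intro power_Suc_less_one) auto
    then show "of_real p * of_real p ^ j \<noteq> (1::complex)"
      by (metis less_irrefl of_real_eq_1_iff of_real_power power_Suc)
  qed
  ultimately show ?thesis using q by simp
qed

text \<open>The zeros form a lattice, and a translation by a zero multiplies $S$ by a function without zeros;
  so the simple zero at the origin is copied to all others.\<close>

lemma sig_simple_zero:
  assumes "S w = 0"
  shows "deriv S w \<noteq> 0"
proof -
  obtain C B where CB: "C \<noteq> 0" "\<And>u. S (u + w) = C * exp (B * u) * S u"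
    using sig_quasi_period[OF assms] by blast
  have S0: "(S has_field_derivative deriv S 0) (at 0)"
    by (rule sig_has_deriv)
  have "((\<lambda>u. C * exp (B * u) * S u) has_field_derivative C * deriv S 0) (at 0)"
    by (rule derivative_eq_intros S0 refl | simp add: sig_0)+
  moreover have "((\<lambda>u. S (u + w)) has_field_derivative deriv S w) (at 0)"
    using DERIV_shift[of S "deriv S w" 0 w] sig_has_deriv[of w] by simp
  ultimately have "C * deriv S 0 = deriv S w"
    unfolding CB(2) by (rule DERIV_unique)
  then show ?thesis using CB(1) sig_deriv_0 by auto
qed

lemma sig_eventually_nonzero: "eventually (\<lambda>u. S u \<noteq> 0) (at w)"
proof (cases "S w = 0")
  case True
  have "eventually (\<lambda>u. (S u - S w) / (u - w) \<noteq> 0) (at w)"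
    by (rule tendsto_imp_eventually_ne[OF has_field_derivativeD[OF sig_has_deriv] sig_simple_zero[OF True]])
  then show ?thesis
    by eventually_elim (use True in auto)
next
  case False
  then show ?thesis
    using sig_isCont[of w] tendsto_imp_eventually_ne unfolding isCont_def by blast
qed


lemma sig_linear_eventually_nonzero:
  assumes "c \<noteq> 0"
  shows "eventually (\<lambda>x. S (c * x + b) \<noteq> 0) (at y)"
proof -
  have "filterlim (\<lambda>x. c * x + b) (at (c * y + b)) (at y)"
    unfolding filterlim_at using assms
    by (auto intro!: tendsto_eq_intros simp: eventually_at_filter)
  then show ?thesis
    using sig_eventually_nonzero by (auto simp: filterlim_iff)
qed

lemma sig_lattice:
  "S (Complex (of_int m * (ln p / (2 * ln q))) (of_int n * (pi / ln q))) = 0"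
proof -
  have "2 * Complex (of_int m * (ln p / (2 * ln q))) (of_int n * (pi / ln q)) * of_real (ln q)
      = of_int m * of_real (ln p) + of_int n * (2 * of_real pi * \<i>)"
    using q by (simp add: complex_eq_iff)
  then have "qpow q (2 * Complex (of_int m * (ln p / (2 * ln q))) (of_int n * (pi / ln q)))
      = exp (of_int m * of_real (ln p)) * exp (of_int n * (2 * of_real pi * \<i>))"
    by (simp add: qpow_def exp_add)
  also have "exp (of_int m * complex_of_real (ln p)) = of_real p powi m"
    using p by (subst exp_power_int[symmetric]) (simp add: exp_of_real)
  also have "exp (of_int n * (2 * complex_of_real pi * \<i>)) = 1"
    by (simp add: exp_power_int[symmetric])
  finally show ?thesis
    using sig_eq_0_iff by auto
qed

text \<open>The point is that \<open>E u\<close> does not depend on \<open>v\<close>: all terms of the addition formula have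
  the same quasi-periods in \<open>u\<close>, and quotients of such terms are elliptic functions.\<close>

lemma sig_mult_shift:
  assumes "S w = 0"
  obtains E where "\<And>u. E u \<noteq> 0" "\<And>u v. S (u + w + v) * S (u + w - v) = E u * (S (u + v) * S (u - v))"
proof -
  obtain C B where CB: "C \<noteq> 0" "\<And>u. S (u + w) = C * exp (B * u) * S u"
    using sig_quasi_period[OF assms] by blast
  have "S (u + w + v) * S (u + w - v) = (C\<^sup>2 * exp (2 * B * u)) * (S (u + v) * S (u - v))" for u v
  proof -
    have "S (u + w + v) * S (u + w - v) = C\<^sup>2 * (exp (B * (u + v)) * exp (B * (u - v))) * (S (u + v) * S (u - v))"
      using CB(2)[of "u + v"] CB(2)[of "u - v"] by (simp add: power2_eq_square algebra_simps)
    also have "exp (B * (u + v)) * exp (B * (u - v)) = exp (2 * B * u)"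
      by (simp add: exp_add[symmetric] algebra_simps)
    finally show ?thesis .
  qed
  then show ?thesis
    using CB(1) by (intro that[of "\<lambda>u. C\<^sup>2 * exp (2 * B * u)"]) auto
qed

text \<open>As functions of \<open>u\<close> the left-hand side \<open>f\<close> and \<open>D u = S (u + y) * S (u - y)\<close> have the same
  quasi-periods, and \<open>f\<close> vanishes at all zeros of \<open>D\<close>, which are simple because \<open>S (2 * y) \<noteq> 0\<close>.
  So \<open>f / D\<close> extends to an entire function with two independent periods, which is constant by
  Liouville's theorem; the constant is found at \<open>u = w\<close>.\<close>

lemma sig_addition_generic:
  assumes y: "S (2 * y) \<noteq> 0" and w: "S (w + y) \<noteq> 0" "S (w - y) \<noteq> 0"
  shows "S (u + v) * S (u - v) * (S (w + y) * S (w - y)) + S (u + w) * S (u - w) * (S (y + v) * S (y - v))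
    = S (w + v) * S (w - v) * (S (u + y) * S (u - y))"
proof -
  define D where "D u = S (u + y) * S (u - y)" for u
  define f where "f u = S (u + v) * S (u - v) * (S (w + y) * S (w - y))
    + S (u + w) * S (u - w) * (S (y + v) * S (y - v))" for u
  define r where "r = remove_sings (\<lambda>u. f u / D u)"
  have comp: "(\<lambda>u. S (g u)) holomorphic_on A" if "g holomorphic_on A" for g A
    using holomorphic_on_compose_gen[OF that sig_holomorphic] by (simp add: o_def)
  have f_hol: "f holomorphic_on UNIV" and D_hol: "D holomorphic_on UNIV"
    unfolding f_def[abs_def] D_def[abs_def] by (intro holomorphic_intros comp)+
  have D_ev: "eventually (\<lambda>u. D u \<noteq> 0) (at z)" for z
  proof -
    have "eventually (\<lambda>u. S (u + c) \<noteq> 0) (at z)" for c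
      using sig_linear_eventually_nonzero[of 1 c z] by simp
    from eventually_conj[OF this[of y] this[of "- y"]] show ?thesis
      by (simp add: D_def)
  qed
  have zeros: "f z = 0 \<and> deriv D z \<noteq> 0" if "D z = 0" for z
  proof -
    have m: "S (x - t) = - S (t - x)" "S (- y - t) = - S (y + t)" for x t
      using sig_minus[of "t - x"] sig_minus[of "y + t"] by simp_all
    have "S (- y + t) = - S (y - t)" for t
      using m(1)[of t y] by (simp add: add.commute)
    then have fy: "f y = 0" and fy': "f (- y) = 0"
      using m(1)[of w y] by (simp_all add: f_def m(2) add.commute)
    have shift: "f (u + t) = 0" if "S t = 0" "f u = 0" for u t
    proof -
      obtain E where E: "\<And>u. E u \<noteq> 0" "\<And>u v. S (u + t + v) * S (u + t - v) = E u * (S (u + v) * S (u - v))"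
        using sig_mult_shift[OF \<open>S t = 0\<close>] by blast
      have "f (u + t) = E u * f u"
        unfolding f_def E(2) by (simp add: distrib_left mult_ac)
      then show ?thesis using that by simp
    qed
    have dD: "deriv D z = deriv S (z + y) * S (z - y) + S (z + y) * deriv S (z - y)"
    proof (rule DERIV_imp_deriv)
      have a: "((\<lambda>u. S (u + c)) has_field_derivative deriv S (z + c)) (at z)" for c
        using DERIV_shift[of S "deriv S (z + c)" z c] sig_has_deriv[of "z + c"] by simp
      show "(D has_field_derivative deriv S (z + y) * S (z - y) + S (z + y) * deriv S (z - y)) (at z)"
        unfolding D_def[abs_def] using DERIV_mult[OF a[of y] a[of "- y"]] by (simp add: add_ac mult_ac)
    qed
    have S2: "\<not> (S (z + y) = 0 \<and> S (z - y) = 0)"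
    proof
      assume *: "S (z + y) = 0 \<and> S (z - y) = 0"
      then obtain C B where "\<And>u. S (u + (z + y)) = C * exp (B * u) * S u"
        using sig_quasi_period by blast
      from this[of "- (z - y)"] * have "S (2 * y) = 0"
        using sig_minus[of "z - y"] by simp
      with y show False ..
    qed
    from that consider "S (z + y) = 0" | "S (z - y) = 0" by (auto simp: D_def)
    then show ?thesis
    proof cases
      case 1
      with shift[OF _ fy', of "z + y"] S2 sig_simple_zero[of "z + y"] show ?thesis
        by (simp add: dD)
    next
      case 2
      with shift[OF _ fy, of "z - y"] S2 sig_simple_zero[of "z - y"] show ?thesis
        by (simp add: dD)
    qed
  qed
  have r_eq: "r z = f z / D z" if "D z \<noteq> 0" for z
    unfolding r_def
  proof (rule remove_sings_at_analytic)
    show "(\<lambda>u. f u / D u) analytic_on {z}"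
      using f_hol D_hol that by (intro analytic_intros) (auto simp: analytic_on_open holomorphic_on_imp_analytic_at)
  qed
  have r_an: "r analytic_on {z}" for z
  proof (cases "D z = 0")
    case False
    have "(\<lambda>u. f u / D u) analytic_on {z}"
      using f_hol D_hol False by (intro analytic_intros) (auto simp: holomorphic_on_imp_analytic_at)
    then show ?thesis unfolding r_def by (rule remove_sings_analytic_on)
  next
    case True
    obtain e where e: "e > 0" "\<And>u. u \<in> ball z e - {z} \<Longrightarrow> D u \<noteq> 0"
      using D_ev[of z] unfolding eventually_at by (auto simp: dist_commute)
    have "(\<lambda>u. f u / D u) holomorphic_on (ball z e - {z})"
      by (intro holomorphic_intros holomorphic_on_subset[OF f_hol] holomorphic_on_subset[OF D_hol] e(2)) auto
    then have iso: "isolated_singularity_at (\<lambda>u. f u / D u) z"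
      using e(1) isolated_singularity_at_holomorphic[of _ "ball z e" z] by auto
    have "((\<lambda>u. f u / D u) \<longlongrightarrow> deriv f z / deriv D z) (at z)"
      by (rule lhopital_complex_simple[of f "deriv f z" z D "deriv D z"])
        (use zeros[OF True] True in \<open>auto intro!: holomorphic_derivI[OF f_hol] holomorphic_derivI[OF D_hol]\<close>)
    with iso show ?thesis unfolding r_def by (rule remove_sings_analytic_at)
  qed
  have r_hol: "r holomorphic_on UNIV"
    using r_an analytic_imp_holomorphic analytic_on_analytic_at by blast
  have ratio_shift: "D (u + t) \<noteq> 0 \<and> f (u + t) / D (u + t) = f u / D u" if "S t = 0" "D u \<noteq> 0" for u t
  proof -
    obtain E where E: "\<And>u. E u \<noteq> 0" "\<And>u v. S (u + t + v) * S (u + t - v) = E u * (S (u + v) * S (u - v))"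
      using sig_mult_shift[OF \<open>S t = 0\<close>] by blast
    have "f (u + t) = E u * f u" "D (u + t) = E u * D u"
      unfolding f_def D_def E(2) by (simp_all add: distrib_left mult_ac)
    then show ?thesis using E(1) that by simp
  qed
  \<comment> \<open>The lattice of zeros is rectangular: it is generated by \<open>T1\<close> and \<open>\<i> * T2\<close>.\<close>
  define T1 T2 where "T1 = ln p / (2 * ln q)" and "T2 = pi / ln q"
  have T: "T1 > 0" "T2 < 0"
    using p q by (auto simp: T1_def T2_def divide_neg_neg divide_pos_neg)
  let ?K = "cbox (Complex 0 T2) (Complex T1 0)"
  have "compact (r ` ?K)"
    by (intro compact_continuous_image holomorphic_on_imp_continuous_on
        holomorphic_on_subset[OF r_hol] compact_cbox) simp
  then have "bounded (r ` ?K)"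
    by (rule compact_imp_bounded)
  then obtain B where "\<forall>x \<in> r ` ?K. norm x \<le> B"
    unfolding bounded_iff by (rule exE)
  then have B: "norm (r u) \<le> B" if "u \<in> ?K" for u
    using that by (simp only: ball_simps)
  have bound: "norm (r u) \<le> B" if "D u \<noteq> 0" for u
  proof -
    define w where "w = Complex (of_int (- \<lfloor>Re u / T1\<rfloor>) * T1) (of_int (- \<lfloor>Im u / T2\<rfloor>) * T2)"
    have "S w = 0"
      unfolding w_def T1_def T2_def by (rule sig_lattice)
    from ratio_shift[OF this that] have "r (u + w) = r u"
      using that by (simp add: r_eq)
    moreover have "u + w \<in> ?K"
    proof -
      have fl: "of_int \<lfloor>x\<rfloor> \<le> x" "x \<le> of_int \<lfloor>x\<rfloor> + 1" for x :: real
        by linarith+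
      have "of_int \<lfloor>Re u / T1\<rfloor> * T1 \<le> Re u" "Re u \<le> (of_int \<lfloor>Re u / T1\<rfloor> + 1) * T1"
        using fl[of "Re u / T1"] unfolding pos_le_divide_eq[OF T(1)] pos_divide_le_eq[OF T(1)] by auto
      moreover have "of_int \<lfloor>Im u / T2\<rfloor> * T2 \<ge> Im u" "Im u \<ge> (of_int \<lfloor>Im u / T2\<rfloor> + 1) * T2"
        using fl[of "Im u / T2"] unfolding neg_le_divide_eq[OF T(2)] neg_divide_le_eq[OF T(2)] by auto
      ultimately show ?thesis
        by (auto simp: w_def in_cbox_complex_iff algebra_simps)
    qed
    ultimately show ?thesis using B[of "u + w"] by simp
  qed
  have "norm (r u) \<le> B" for u
  proof (rule tendsto_upperbound)
    have "isCont r u" using r_an analytic_at_imp_isCont by blast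
    then show "((\<lambda>x. norm (r x)) \<longlongrightarrow> norm (r u)) (at u)"
      by (intro tendsto_norm) (simp add: isCont_def)
    show "eventually (\<lambda>x. norm (r x) \<le> B) (at u)"
      using D_ev[of u] by eventually_elim (rule bound)
  qed simp
  then have "bounded (range r)"
    unfolding bounded_iff by blast
  then obtain c where c: "\<And>u. r u = c"
    using Liouville_theorem[OF r_hol] unfolding constant_on_def by blast
  have f_eq: "f u = c * D u" for u
    using zeros[of u] r_eq[of u] c[of u] by (cases "D u = 0") (auto simp: field_simps)
  have "f w = S (w + v) * S (w - v) * D w"
    by (simp add: f_def D_def sig_0)
  with f_eq[of w] w have "c = S (w + v) * S (w - v)"
    by (simp add: D_def)
  with f_eq[of u] show ?thesis
    by (simp add: f_def D_def)
qed

text \<open>The exceptional values of \<open>y\<close> are isolated, and both sides are continuous in \<open>y\<close>.\<close>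

lemma sig_addition:
  "S (u + v) * S (u - v) * (S (w + y) * S (w - y)) + S (u + w) * S (u - w) * (S (y + v) * S (y - v))
    = S (w + v) * S (w - v) * (S (u + y) * S (u - y))" (is "?l y = ?r y")
proof -
  have "eventually (\<lambda>x. ?l x = ?r x) (at y)"
    using sig_linear_eventually_nonzero[of 2 0 y, simplified]
      sig_linear_eventually_nonzero[of 1 w y, simplified] sig_linear_eventually_nonzero[of "-1" w y, simplified]
    by eventually_elim (intro sig_addition_generic, simp_all add: add_ac)
  moreover have cont: "((\<lambda>x. S (g x)) \<longlongrightarrow> S (g y)) (at y)" if "(g \<longlongrightarrow> g y) (at y)" for g
    using isCont_tendsto_compose[OF sig_isCont that] .
  have "(?l \<longlongrightarrow> ?l y) (at y)" "(?r \<longlongrightarrow> ?r y) (at y)"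
    by (intro tendsto_intros cont)+
  ultimately show ?thesis
    using tendsto_unique[of "at y" ?l "?l y" "?r y"] tendsto_cong[of ?l ?r "at y" "?r y"] by simp
qed

end

section \<open>The elliptic binomial theorem\<close>

text \<open>Everything up to \<open>vwp_biorthogonality\<close> uses only that $S$ is odd,
  satisfies the addition formula and has no zero at a positive integer.\<close>

locale odd_addition =
  fixes S :: "complex \<Rightarrow> complex"
  assumes S_minus: "S (- u) = - S u"
    and S_addition: "S (u + v) * S (u - v) * (S (w + y) * S (w - y))
        + S (u + w) * S (u - w) * (S (y + v) * S (y - v))
      = S (w + v) * S (w - v) * (S (u + y) * S (u - y))"
    and S_nat_nonzero: "0 < n \<Longrightarrow> S (of_nat n) \<noteq> 0"
begin

lemma S_0: "S 0 = 0"
  using S_minus[of 0] by simp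

lemma S_diff: "S (u - v) = - S (v - u)"
  using S_minus[of "v - u"] by simp

definition poch :: "complex \<Rightarrow> nat \<Rightarrow> complex" where
  "poch u n = (\<Prod>i<n. S (u + of_nat i))"

definition fct :: "nat \<Rightarrow> complex" where
  "fct n = poch 1 n"

text \<open>The genericity condition on a coset: then all $[u+m]_n$ with $m\in\mathbb Z$ may be divided by.\<close>

definition gen :: "complex \<Rightarrow> bool" where
  "gen u \<longleftrightarrow> (\<forall>m::int. S (u + of_int m) \<noteq> 0)"

lemma gen_S: "gen u \<Longrightarrow> S u \<noteq> 0"
  unfolding gen_def by (metis add_0_right of_int_0)

lemma gen_add_int: "gen (u + of_int m) \<longleftrightarrow> gen u"
proof
  assume *: "gen (u + of_int m)"
  have "S (u + of_int n) \<noteq> 0" for n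
    using *[unfolded gen_def, rule_format, of "n - m"] by simp
  then show "gen u" by (simp add: gen_def)
next
  assume *: "gen u"
  have "S (u + of_int m + of_int n) \<noteq> 0" for n
    using *[unfolded gen_def, rule_format, of "m + n"] by (simp add: add.assoc)
  then show "gen (u + of_int m)" by (simp add: gen_def)
qed

lemma gen_shift [simp]:
  "gen (u + of_nat n) \<longleftrightarrow> gen u" "gen (u - of_nat n) \<longleftrightarrow> gen u"
  "gen (u + 1) \<longleftrightarrow> gen u" "gen (u - 1) \<longleftrightarrow> gen u"
  "gen (of_nat n + u) \<longleftrightarrow> gen u" "gen (1 + u) \<longleftrightarrow> gen u"
  using gen_add_int[of u "int n"] gen_add_int[of u "- int n"] gen_add_int[of u 1] gen_add_int[of u "-1"]
  by (simp_all add: add.commute)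

lemma gen_minus: "gen (- u) \<longleftrightarrow> gen u"
proof -
  have "gen (- u)" if "gen u" for u
  proof -
    have "S (- u + of_int m) \<noteq> 0" for m
      using that[unfolded gen_def, rule_format, of "- m"] S_minus[of "u - of_int m"] by simp
    then show ?thesis by (simp add: gen_def)
  qed
  from this[of u] this[of "- u"] show ?thesis by auto
qed

lemma gen_diff_commute: "gen (u - v) \<longleftrightarrow> gen (v - u)"
  using gen_minus[of "u - v"] by simp

lemma poch_0 [simp]: "poch u 0 = 1"
  by (simp add: poch_def)

lemma poch_Suc: "poch u (Suc n) = poch u n * S (u + of_nat n)"
  by (simp add: poch_def)

lemma poch_add: "poch u (m + n) = poch u m * poch (u + of_nat m) n"
  by (induction n) (simp_all add: poch_Suc add_ac)

lemma poch_Suc_left: "poch u (Suc n) = S u * poch (u + 1) n"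
  using poch_add[of u 1 n] by (simp add: poch_Suc)

lemma poch_nonzero: "gen u \<Longrightarrow> poch u n \<noteq> 0"
  by (simp add: poch_def gen_def) (metis of_int_of_nat_eq)

lemma poch_reflect: "poch u n = (- 1) ^ n * poch (1 - u - of_nat n) n"
proof -
  have "poch (1 - u - of_nat n) n = (\<Prod>i<n. S (1 - u - of_nat n + of_nat (n - Suc i)))"
    unfolding poch_def by (rule prod.nat_diff_reindex[symmetric])
  also have "\<dots> = (\<Prod>i<n. - 1 * S (u + of_nat i))"
  proof (rule prod.cong)
    fix i assume "i \<in> {..<n}"
    then have *: "1 - u - of_nat n + of_nat (n - Suc i) = - (u + of_nat i)"
      by (simp add: of_nat_diff)
    show "S (1 - u - of_nat n + of_nat (n - Suc i)) = - 1 * S (u + of_nat i)"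
      unfolding * S_minus by simp
  qed simp
  also have "\<dots> = (- 1) ^ n * poch u n"
    by (simp only: prod.distrib poch_def) simp
  finally show ?thesis
    by (simp flip: mult.assoc power_add)
qed

lemma fct_Suc: "fct (Suc n) = fct n * S (of_nat (Suc n))"
  by (simp add: fct_def poch_Suc add.commute)

lemma fct_nonzero: "fct n \<noteq> 0"
  by (induction n) (simp_all add: fct_Suc S_nat_nonzero del: of_nat_Suc, simp add: fct_def)

text \<open>The coefficient of $h_k(x;b)h_m(x;c)$ in $h_{k+m}(x;a)$. The two indices \<open>k\<close> and \<open>m\<close> (rather than
  \<open>k + m\<close> and \<open>k\<close>) make it symmetric under the exchange of \<open>(k, b)\<close> and \<open>(m, c)\<close>.\<close>

definition ebin :: "nat \<Rightarrow> nat \<Rightarrow> complex \<Rightarrow> complex \<Rightarrow> complex \<Rightarrow> complex" where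
  "ebin k m a b c = fct (k + m) / (fct k * fct m)
     * (poch (a + c + of_nat m) k * poch (a - c) k * poch (a + b + of_nat k) m * poch (a - b) m)
     / (poch (b + c) (k + m) * poch (b - c - of_nat m) k * poch (c - b - of_nat k) m)"

definition hprod :: "nat \<Rightarrow> complex \<Rightarrow> complex \<Rightarrow> complex" where
  "hprod n x a = poch (a + x) n * poch (a - x) n"

lemma hprod_0 [simp]: "hprod 0 x a = 1"
  by (simp add: hprod_def)

lemma hprod_add: "hprod (m + n) x a = hprod m x a * hprod n x (a + of_nat m)"
  by (simp add: hprod_def poch_add algebra_simps)

lemma hprod_Suc: "hprod (Suc n) x a = hprod n x a * (S (a + of_nat n + x) * S (a + of_nat n - x))"
  by (simp add: hprod_def poch_Suc algebra_simps)

text \<open>This is the addition formula, read as the expansion of $S(a+x)S(a-x)$ in a two-dimensional space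
  of functions of \<open>x\<close>.\<close>

lemma S_pair_interpolation:
  assumes "S (b + c) \<noteq> 0" "S (b - c) \<noteq> 0"
  shows "S (a + x) * S (a - x) =
      S (a + c) * S (a - c) / (S (b + c) * S (b - c)) * (S (b + x) * S (b - x))
    + S (a + b) * S (a - b) / (S (b + c) * S (c - b)) * (S (c + x) * S (c - x))"
proof -
  have "S (c - b) = - S (b - c)" by (rule S_diff)
  with S_addition[of a x b c] assms show ?thesis
    by (simp add: field_simps)
qed

lemma ebin_right_0: "gen (b - c) \<Longrightarrow> gen (b + c) \<Longrightarrow>
    ebin (Suc k) 0 a b c = ebin k 0 a b c * (S (a + of_nat k + c) * S (a + of_nat k - c)
      / (S (b + of_nat k + c) * S (b + of_nat k - c)))"
  using fct_nonzero[of k] fct_nonzero[of "Suc k"]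
  by (simp add: ebin_def poch_Suc algebra_simps) 

lemma ebin_swap: "ebin k m a b c = ebin m k a c b"
  by (simp add: ebin_def add_ac mult_ac)

text \<open>The common factor of the three terms of Pascal's recursion for \<open>ebin\<close>.\<close>

definition ebin_core :: "nat \<Rightarrow> nat \<Rightarrow> complex \<Rightarrow> complex \<Rightarrow> complex \<Rightarrow> complex" where
  "ebin_core k m a b c = fct (Suc (k + m)) / (fct (Suc k) * fct (Suc m))
     * (poch (a + c + of_nat m + 1) k * poch (a - c) (Suc k)
        * poch (a + b + of_nat k + 1) m * poch (a - b) (Suc m))
     / (poch (b + c) (Suc (Suc (k + m))) * poch (b - c - of_nat m - 1) (Suc k)
        * poch (c - b - of_nat k - 1) (Suc m))"

lemma ebin_core_swap: "ebin_core k m a b c = ebin_core m k a c b"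
  by (simp add: ebin_core_def add_ac mult_ac)

lemma ebin_Suc_Suc:
  assumes "u = of_nat k" "v = of_nat m"
  shows "ebin (Suc k) (Suc m) a b c = ebin_core k m a b c
      * (S (u + v + 2) * S (a + c + u + v + 1) * S (a + b + u + v + 1))"
proof -
  have e1: "poch (a + c + v + 1) (Suc k) = poch (a + c + v + 1) k * S (a + c + u + v + 1)"
    and e2: "poch (a + b + u + 1) (Suc m) = poch (a + b + u + 1) m * S (a + b + u + v + 1)"
    and e3: "fct (Suc (Suc (k + m))) = fct (Suc (k + m)) * S (u + v + 2)"
    by (simp_all add: poch_Suc fct_Suc assms add_ac)
  have "ebin (Suc k) (Suc m) a b c = fct (Suc (Suc (k + m))) / (fct (Suc k) * fct (Suc m))
     * (poch (a + c + v + 1) (Suc k) * poch (a - c) (Suc k) * poch (a + b + u + 1) (Suc m) * poch (a - b) (Suc m))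
     / (poch (b + c) (Suc (Suc (k + m))) * poch (b - c - v - 1) (Suc k) * poch (c - b - u - 1) (Suc m))"
    by (simp add: ebin_def assms add_ac diff_diff_eq)
  then show ?thesis
    unfolding e1 e2 e3 ebin_core_def assms[symmetric] by simp
qed

text \<open>Up to \<open>ebin_swap\<close> this describes both terms on the right of Pascal's recursion.\<close>

lemma ebin_step:
  assumes "gen (b - c)" "gen (b + c)" and uv: "u = of_nat k" "v = of_nat m"
  shows "ebin k (Suc m) a b c * (S (a + c + u + 2 * v + 2) * S (a - c + u)
        / (S (b + c + u + v + 1) * S (b - c + u - v - 1)))
      = ebin_core k m a b c * (S (u + 1) * S (a + c + u + 2 * v + 2) * S (a + b + u)
          * S (c - b - u - 1) / S (c - b + v - u))"
proof -
  have e1: "poch (a + b + u) (Suc m) = S (a + b + u) * poch (a + b + u + 1) m"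
    by (rule poch_Suc_left)
  have e2: "poch (c - b - u) (Suc m) * S (c - b - u - 1) = poch (c - b - u - 1) (Suc m) * S (c - b + v - u)"
    using poch_Suc_left[of "c - b - u - 1" "Suc m"] poch_Suc[of "c - b - u - 1" "Suc m"]
    by (simp add: uv algebra_simps)
  have e3: "poch (b - c - v - 1) (Suc k) = poch (b - c - v - 1) k * S (b - c + u - v - 1)"
    by (simp add: poch_Suc uv algebra_simps)
  have e4: "poch (a - c) (Suc k) = poch (a - c) k * S (a - c + u)"
    by (simp add: poch_Suc uv)
  have e5: "poch (b + c) (Suc (Suc (k + m))) = poch (b + c) (Suc (k + m)) * S (b + c + u + v + 1)"
    by (simp add: poch_Suc[of "b + c" "Suc (k + m)"] uv algebra_simps)
  have e6: "fct (Suc k) = fct k * S (u + 1)"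
    by (simp add: fct_Suc uv add.commute)
  have E: "ebin k (Suc m) a b c = fct (Suc (k + m)) / (fct k * fct (Suc m))
     * (poch (a + c + v + 1) k * poch (a - c) k * poch (a + b + u) (Suc m) * poch (a - b) (Suc m))
     / (poch (b + c) (Suc (k + m)) * poch (b - c - v - 1) k * poch (c - b - u) (Suc m))"
    by (simp add: ebin_def uv add_ac diff_diff_eq)
  have nz: "S (c - b - u - 1) \<noteq> 0"
    using assms(1) gen_diff_commute[of b c] by (intro gen_S) (simp add: uv)
  have e7: "poch (c - b - u) (Suc m)
      = poch (c - b - u - 1) (Suc m) * S (c - b + v - u) / S (c - b - u - 1)"
    using e2 nz by (simp add: field_simps)
  have "S (c - b + v - u) \<noteq> 0" "S (b + c + u + v + 1) \<noteq> 0" "S (b - c + u - v - 1) \<noteq> 0"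
    using assms(1,2) gen_diff_commute[of b c] by (intro gen_S; simp add: uv)+
  moreover have "S (u + 1) \<noteq> 0"
    using S_nat_nonzero[of "Suc k"] by (simp add: uv add.commute)
  ultimately show ?thesis
    unfolding E ebin_core_def uv[symmetric] e1 e7 e3 e4 e5 e6
    using nz by (simp add: divide_simps)
qed

text \<open>Apart from the common factor \<open>ebin_core\<close> this is the addition formula at points that are half-integral
  combinations of \<open>b\<close> and \<open>c\<close>. The two quotients are the coefficients of \<open>S_pair_interpolation\<close> for
  $S(a+n+x)S(a+n-x)$ and the next factors of $h_k(x;b)$ and $h_m(x;c)$.\<close>

lemma ebin_pascal:
  assumes gen: "gen (b - c)" "gen (b + c)" and uv: "u = of_nat k" "v = of_nat m"
  shows "ebin (Suc k) (Suc m) a b c =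
      ebin k (Suc m) a b c * (S (a + c + u + 2 * v + 2) * S (a - c + u)
        / (S (b + c + u + v + 1) * S (b - c + u - v - 1)))
    + ebin (Suc k) m a b c * (S (a + b + 2 * u + v + 2) * S (a - b + v)
        / (S (b + c + u + v + 1) * S (c - b + v - u - 1)))"
proof -
  let ?d = "S (c - b + v - u)"
  have left: "ebin k (Suc m) a b c * (S (a + c + u + 2 * v + 2) * S (a - c + u)
        / (S (b + c + u + v + 1) * S (b - c + u - v - 1)))
      = ebin_core k m a b c * (S (u + 1) * S (a + c + u + 2 * v + 2) * S (a + b + u) * S (c - b - u - 1) / ?d)"
    by (rule ebin_step[OF gen uv])
  have gen': "gen (c - b)" "gen (c + b)"
    using gen gen_diff_commute[of b c] by (simp_all add: add.commute)
  have "S (b - c + u - v) = - ?d"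
    using S_diff[of "b - c + u" v] S_minus[of "c - b + v - u"] by (simp add: algebra_simps)
  then have right: "ebin (Suc k) m a b c * (S (a + b + 2 * u + v + 2) * S (a - b + v)
        / (S (b + c + u + v + 1) * S (c - b + v - u - 1)))
      = - ebin_core k m a b c * (S (v + 1) * S (a + b + 2 * u + v + 2) * S (a + c + v) * S (b - c - v - 1) / ?d)"
    using ebin_step[OF gen' uv(2,1), of a] ebin_swap[of "Suc k" m a b c] ebin_core_swap[of k m a b c]
    by (simp add: add_ac)
  let ?h = "(c - b) / 2"
  have args: "?h + v + 1 + ?h = c - b + v + 1" "?h + v + 1 - ?h = v + 1"
      "a + (b + c) / 2 + u + v + 1 + (u + 1 - ?h) = a + b + 2 * u + v + 2"
      "a + (b + c) / 2 + u + v + 1 - (u + 1 - ?h) = a + c + v"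
      "?h + v + 1 + (a + (b + c) / 2 + u + v + 1) = a + c + u + 2 * v + 2"
      "?h + v + 1 - (a + (b + c) / 2 + u + v + 1) = - (a + b + u)"
      "u + 1 - ?h + ?h = u + 1" "u + 1 - ?h - ?h = - (c - b - u - 1)"
      "a + (b + c) / 2 + u + v + 1 + ?h = a + c + u + v + 1"
      "a + (b + c) / 2 + u + v + 1 - ?h = a + b + u + v + 1"
      "?h + v + 1 + (u + 1 - ?h) = u + v + 2" "?h + v + 1 - (u + 1 - ?h) = c - b + v - u"
    by (simp_all add: field_simps)
  have "S (c - b + v + 1) * S (v + 1) * (S (a + b + 2 * u + v + 2) * S (a + c + v))
      + S (a + c + u + 2 * v + 2) * (- S (a + b + u)) * (S (u + 1) * (- S (c - b - u - 1)))
      = S (a + c + u + v + 1) * S (a + b + u + v + 1) * (S (u + v + 2) * ?d)"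
    using S_addition[of "?h + v + 1" ?h "a + (b + c) / 2 + u + v + 1" "u + 1 - ?h"]
    unfolding args S_minus .
  moreover have "S (c - b + v + 1) = - S (b - c - v - 1)"
    using S_minus[of "b - c - v - 1"] by (simp add: algebra_simps)
  moreover have "?d \<noteq> 0"
    using gen'(1) by (intro gen_S) (simp add: uv)
  ultimately show ?thesis
    unfolding left right ebin_Suc_Suc[OF uv] by (simp add: divide_simps) (simp add: algebra_simps)
qed


lemma pascal_sum:
  fixes D A B H :: "nat \<Rightarrow> nat \<Rightarrow> complex"
  assumes "\<And>k m. D (Suc k) (Suc m) = A k (Suc m) + B (Suc k) m"
    and "\<And>k. D (Suc k) 0 = A k 0" "\<And>m. D 0 (Suc m) = B 0 m"
  shows "(\<Sum>k\<le>Suc n. D k (Suc n - k) * H k (Suc n - k))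
    = (\<Sum>k\<le>n. A k (n - k) * H (Suc k) (n - k)) + (\<Sum>k\<le>n. B k (n - k) * H k (Suc (n - k)))"
proof -
  have D: "D k (Suc n - k) * H k (Suc n - k)
      = (case k of 0 \<Rightarrow> 0 | Suc i \<Rightarrow> A i (n - i) * H (Suc i) (n - i))
      + (if k \<le> n then B k (n - k) * H k (Suc (n - k)) else 0)" if "k \<le> Suc n" for k
  proof (cases "k \<le> n")
    case True
    show ?thesis
    proof (cases k)
      case 0
      then show ?thesis using assms by simp
    next
      case (Suc i)
      with True have "n - i = Suc (n - Suc i)" by simp
      with Suc True assms show ?thesis by (simp add: distrib_right)
    qed
  next
    case False
    with that have "k = Suc n" by simp
    then show ?thesis using assms by simp
  qed
  have "(\<Sum>k\<le>Suc n. D k (Suc n - k) * H k (Suc n - k))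
      = (\<Sum>k\<le>Suc n. case k of 0 \<Rightarrow> 0 | Suc i \<Rightarrow> A i (n - i) * H (Suc i) (n - i))
      + (\<Sum>k\<le>Suc n. if k \<le> n then B k (n - k) * H k (Suc (n - k)) else 0)"
    unfolding sum.distrib[symmetric] by (intro sum.cong refl D) simp
  also have "(\<Sum>k\<le>Suc n. case k of 0 \<Rightarrow> 0 | Suc i \<Rightarrow> A i (n - i) * H (Suc i) (n - i))
      = (\<Sum>k\<le>n. A k (n - k) * H (Suc k) (n - k))"
    by (subst sum.atMost_Suc_shift) simp
  also have "(\<Sum>k\<le>Suc n. if k \<le> n then B k (n - k) * H k (Suc (n - k)) else 0)
      = (\<Sum>k\<le>n. B k (n - k) * H k (Suc (n - k)))"
    by simp
  finally show ?thesis .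
qed

text \<open>The last factor of $h_{n+1}(x;a)$ is interpolated, in each term of the expansion of $h_n(x;a)$, by
  the next factors of $h_k(x;b)$ and of $h_{n-k}(x;c)$; Pascal's recursion collects the terms.\<close>

theorem elliptic_binomial:
  assumes gen: "gen (b - c)" "gen (b + c)"
  shows "hprod n x a = (\<Sum>k\<le>n. ebin k (n - k) a b c * (hprod k x b * hprod (n - k) x c))"
proof (induction n)
  case 0
  then show ?case by (simp add: ebin_def fct_def)
next
  case (Suc n)
  define A where "A k m = ebin k m a b c * (S (a + of_nat (k + m) + (c + of_nat m)) * S (a + of_nat (k + m) - (c + of_nat m))
      / (S (b + of_nat k + (c + of_nat m)) * S (b + of_nat k - (c + of_nat m))))" for k m
  define B where "B k m = ebin k m a b c * (S (a + of_nat (k + m) + (b + of_nat k)) * S (a + of_nat (k + m) - (b + of_nat k))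
      / (S (b + of_nat k + (c + of_nat m)) * S (c + of_nat m - (b + of_nat k))))" for k m
  define H where "H k m = hprod k x b * hprod m x c" for k m
  have B_swap: "B k m = ebin m k a c b * (S (a + of_nat (m + k) + (b + of_nat k)) * S (a + of_nat (m + k) - (b + of_nat k))
      / (S (c + of_nat m + (b + of_nat k)) * S (c + of_nat m - (b + of_nat k))))" for k m
    by (simp add: B_def ebin_swap[of k m] add_ac)
  have gen': "gen (c - b)" "gen (c + b)"
    using gen gen_diff_commute[of b c] by (simp_all add: add.commute)
  have step: "ebin k m a b c * H k m * (S (a + of_nat (k + m) + x) * S (a + of_nat (k + m) - x))
      = A k m * H (Suc k) m + B k m * H k (Suc m)" for k m
  proof -
    have "gen (b + of_nat k + (c + of_nat m))" "gen (b + of_nat k - (c + of_nat m))"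
      using gen gen_add_int[of "b + c" "int (k + m)"] gen_add_int[of "b - c" "int k - int m"]
      by (simp_all add: algebra_simps)
    from S_pair_interpolation[OF this[THEN gen_S], of "a + of_nat (k + m)" x]
    show ?thesis
      unfolding A_def B_def H_def hprod_Suc by (simp add: algebra_simps)
  qed
  have "hprod (Suc n) x a = (\<Sum>k\<le>n. A k (n - k) * H (Suc k) (n - k) + B k (n - k) * H k (Suc (n - k)))"
    unfolding hprod_Suc Suc.IH sum_distrib_right
  proof (rule sum.cong)
    fix k assume "k \<in> {..n}"
    then have "k + (n - k) = n" by simp
    then show "ebin k (n - k) a b c * (hprod k x b * hprod (n - k) x c) * (S (a + of_nat n + x) * S (a + of_nat n - x))
        = A k (n - k) * H (Suc k) (n - k) + B k (n - k) * H k (Suc (n - k))"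
      using step[of k "n - k"] by (simp add: H_def)
  qed simp
  also have "\<dots> = (\<Sum>k\<le>Suc n. ebin k (Suc n - k) a b c * H k (Suc n - k))"
    unfolding sum.distrib
  proof (rule pascal_sum[symmetric])
    fix k m
    show "ebin (Suc k) (Suc m) a b c = A k (Suc m) + B (Suc k) m"
      using ebin_pascal[OF gen refl refl, of k m a]
      by (simp add: A_def B_def algebra_simps)
    show "ebin (Suc k) 0 a b c = A k 0"
      using ebin_right_0[OF gen, of k a] by (simp add: A_def)
    show "ebin 0 (Suc m) a b c = B 0 m"
      using ebin_right_0[OF gen', of m a] ebin_swap[of 0 "Suc m"] by (simp add: B_swap)
  qed
  finally show ?case by (simp add: H_def)
qed

section \<open>Connection coefficients\<close>

definition basis :: "nat \<Rightarrow> nat \<Rightarrow> complex \<Rightarrow> complex \<Rightarrow> complex \<Rightarrow> complex" where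
  "basis N k x a b = hprod k x a * hprod (N - k) x b"

lemma poch_zero: "k < n \<Longrightarrow> poch (- of_nat k) n = 0"
  using S_0 by (auto simp: poch_def intro!: bexI[of _ k])

lemma poch_neg_nonzero: "n \<le> k \<Longrightarrow> poch (- of_nat k) n \<noteq> 0"
proof -
  assume "n \<le> k"
  have "S (- of_nat k + of_nat i) \<noteq> 0" if "i < n" for i
  proof -
    have "- of_nat k + of_nat i = - (of_nat (k - i) :: complex)"
      using that \<open>n \<le> k\<close> by (simp add: of_nat_diff)
    then show ?thesis
      using S_nat_nonzero[of "k - i"] that \<open>n \<le> k\<close> by (simp only: S_minus) simp
  qed
  then show ?thesis by (simp add: poch_def)
qed

text \<open>At $x=a+k$ the functions with index greater than $k$ vanish and the one with index $k$ does not, so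
  the system of equations for the coefficients is triangular.\<close>

lemma basis_independent:
  assumes gen: "gen (2 * a)" "gen (a + b)" "gen (a - b)"
    and zero: "\<And>x. (\<Sum>k\<le>N. f k * basis N k x a b) = 0" and "k \<le> N"
  shows "f k = 0"
  using \<open>k \<le> N\<close>
proof (induction k rule: less_induct)
  case (less k)
  let ?x = "a + of_nat k"
  have "(\<Sum>i\<le>N. f i * basis N i ?x a b) = (\<Sum>i\<in>{k}. f i * basis N i ?x a b)"
  proof (rule sum.mono_neutral_right)
    show "\<forall>i\<in>{..N} - {k}. f i * basis N i ?x a b = 0"
    proof
      fix i assume i: "i \<in> {..N} - {k}"
      show "f i * basis N i ?x a b = 0"
      proof (cases "i < k")
        case True
        then show ?thesis using less i by simp
      next
        case False
        with i have "k < i" by simp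
        then show ?thesis using poch_zero[of k i] by (simp add: basis_def hprod_def)
      qed
    qed
  qed (use less in auto)
  then have "f k * basis N k ?x a b = 0"
    using zero[of ?x] by simp
  moreover have "basis N k ?x a b \<noteq> 0"
  proof -
    \<comment> \<open>The value at $x=a+k$ is $[2a+k]_k[-k]_k[a+b+k]_{N-k}[b-a-k]_{N-k}$.\<close>
    have "gen (a + ?x)" "gen (b + ?x)" "gen (b - ?x)"
      using gen gen_add_int[of "2 * a" "int k"] gen_add_int[of "a + b" "int k"]
        gen_add_int[of "b - a" "- int k"] gen_diff_commute[of a b]
      by (simp_all add: algebra_simps)
    then show ?thesis
      using poch_neg_nonzero[of k k] by (simp add: basis_def hprod_def poch_nonzero)
  qed
  ultimately show ?case by simp
qed

text \<open>The coefficient of $e_j(c,d)$ in $e_l(a,b)$ found by expanding first $h_l(x;a)$ in terms of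
  $h_s(x;c)$ and $h_{l-s}(x;b+N-l)$, which completes $h_{N-l}(x;b)$ to $h_{N-s}(x;b)$, and then the latter.\<close>

definition conn1 :: "nat \<Rightarrow> nat \<Rightarrow> nat \<Rightarrow> complex \<Rightarrow> complex \<Rightarrow> complex \<Rightarrow> complex \<Rightarrow> complex" where
  "conn1 N l j a b c d = (\<Sum>s\<le>l. if s \<le> j
     then ebin s (l - s) a c (b + of_nat (N - l)) * ebin (j - s) (N - j) b (c + of_nat s) d else 0)"

text \<open>The same coefficient found by expanding first $h_{N-l}(x;b)$, and then $h_l(x;a)$ in such a way that
  its factors continue those already produced.\<close>

definition conn2 :: "nat \<Rightarrow> nat \<Rightarrow> nat \<Rightarrow> complex \<Rightarrow> complex \<Rightarrow> complex \<Rightarrow> complex \<Rightarrow> complex" where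
  "conn2 N l j a b c d = (\<Sum>s\<le>l. if s \<le> j \<and> j - s \<le> N - l
     then ebin (j - s) (N - l - (j - s)) b c d
        * ebin s (l - s) a (c + of_nat (j - s)) (d + of_nat (N - l - (j - s))) else 0)"

lemma sum_atMost_shift:
  fixes f :: "nat \<Rightarrow> complex"
  assumes "s + n \<le> N"
  shows "(\<Sum>u\<le>n. f u) = (\<Sum>j\<le>N. if s \<le> j \<and> j - s \<le> n then f (j - s) else 0)"
proof -
  have "(\<Sum>j\<le>N. if s \<le> j \<and> j - s \<le> n then f (j - s) else 0)
      = (\<Sum>j\<in>{s..s + n}. f (j - s))"
    using assms by (intro sum.mono_neutral_cong_right) auto
  also have "\<dots> = (\<Sum>u\<le>n. f u)"
    by (rule sum.reindex_bij_witness[of _ "\<lambda>u. u + s" "\<lambda>j. j - s"]) auto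
  finally show ?thesis ..
qed

text \<open>A pair \<open>s\<close>, \<open>u\<close> of summation indices of the two expansions contributes to the coefficient with
  index \<open>j = s + u\<close>.\<close>

lemma conn1_expansion:
  assumes gen: "gen (b - c)" "gen (b + c)" "gen (c - d)" "gen (c + d)" and "l \<le> N"
  shows "basis N l x a b = (\<Sum>j\<le>N. conn1 N l j a b c d * basis N j x c d)"
proof -
  let ?b = "b + of_nat (N - l)"
  have gen_b: "gen (c - ?b)" "gen (c + ?b)"
    using gen gen_add_int[of "c - b" "- int (N - l)"] gen_add_int[of "b + c" "int (N - l)"] gen_diff_commute[of b c]
    by (simp_all add: algebra_simps)
  have "basis N l x a b = (\<Sum>s\<le>l. ebin s (l - s) a c ?b * (hprod s x c * hprod (l - s) x ?b)) * hprod (N - l) x b"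
    unfolding basis_def by (subst elliptic_binomial[OF gen_b]) simp
  also have "\<dots> = (\<Sum>s\<le>l. \<Sum>j\<le>N. if s \<le> j then
      ebin s (l - s) a c ?b * ebin (j - s) (N - j) b (c + of_nat s) d * basis N j x c d else 0)"
    unfolding sum_distrib_right
  proof (rule sum.cong)
    fix s assume "s \<in> {..l}"
    then have s: "s \<le> l" "N - l + (l - s) = N - s" "s \<le> N" using \<open>l \<le> N\<close> by auto
    have gen_s: "gen (c + of_nat s - d)" "gen (c + of_nat s + d)"
      using gen gen_add_int[of "c - d" "int s"] gen_add_int[of "c + d" "int s"] by (simp_all add: algebra_simps)
    have "hprod (l - s) x ?b * hprod (N - l) x b = hprod (N - s) x b"
      using hprod_add[of "N - l" "l - s" x b] by (simp add: s mult.commute)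
    then have "ebin s (l - s) a c ?b * (hprod s x c * hprod (l - s) x ?b) * hprod (N - l) x b
        = ebin s (l - s) a c ?b * (hprod s x c * hprod (N - s) x b)"
      by (simp add: mult_ac)
    also have "\<dots> = (\<Sum>u\<le>N - s. ebin s (l - s) a c ?b * ebin u (N - s - u) b (c + of_nat s) d
        * (hprod s x c * hprod u x (c + of_nat s) * hprod (N - s - u) x d))"
      by (subst elliptic_binomial[OF gen_s]) (simp add: sum_distrib_left mult_ac)
    also have "\<dots> = (\<Sum>j\<le>N. if s \<le> j \<and> j - s \<le> N - s then ebin s (l - s) a c ?b * ebin (j - s) (N - s - (j - s)) b (c + of_nat s) d
        * (hprod s x c * hprod (j - s) x (c + of_nat s) * hprod (N - s - (j - s)) x d) else 0)"
      using s by (intro sum_atMost_shift) simp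
    also have "\<dots> = (\<Sum>j\<le>N. if s \<le> j then
      ebin s (l - s) a c ?b * ebin (j - s) (N - j) b (c + of_nat s) d * basis N j x c d else 0)"
    proof (rule sum.cong)
      fix j assume "j \<in> {..N}"
      then show "(if s \<le> j \<and> j - s \<le> N - s then ebin s (l - s) a c ?b * ebin (j - s) (N - s - (j - s)) b (c + of_nat s) d
          * (hprod s x c * hprod (j - s) x (c + of_nat s) * hprod (N - s - (j - s)) x d) else 0)
        = (if s \<le> j then
          ebin s (l - s) a c ?b * ebin (j - s) (N - j) b (c + of_nat s) d * basis N j x c d else 0)"
        using hprod_add[of s "j - s" x c] by (auto simp: basis_def)
    qed simp
    finally show "ebin s (l - s) a c ?b * (hprod s x c * hprod (l - s) x ?b) * hprod (N - l) x b = \<dots>" .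
  qed simp
  also have "\<dots> = (\<Sum>j\<le>N. conn1 N l j a b c d * basis N j x c d)"
    unfolding conn1_def sum_distrib_right by (subst sum.swap) (intro sum.cong refl, simp)
  finally show ?thesis .
qed

lemma conn2_expansion:
  assumes gen: "gen (c - d)" "gen (c + d)" and "l \<le> N"
  shows "basis N l x a b = (\<Sum>j\<le>N. conn2 N l j a b c d * basis N j x c d)"
proof -
  let ?g = "\<lambda>s t. ebin t (N - l - t) b c d * ebin s (l - s) a (c + of_nat t) (d + of_nat (N - l - t))"
  have prods: "(hprod t x c * hprod (N - l - t) x d)
      * (hprod s x (c + of_nat t) * hprod (l - s) x (d + of_nat (N - l - t)))
      = basis N (s + t) x c d" if "s \<le> l" "t \<le> N - l" for s t
  proof -
    have "N - l - t + (l - s) = N - (s + t)" using that \<open>l \<le> N\<close> by simp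
    then show ?thesis
      using hprod_add[of t s x c] hprod_add[of "N - l - t" "l - s" x d]
      by (simp add: basis_def mult_ac add.commute)
  qed
  have "basis N l x a b = (\<Sum>t\<le>N - l. ebin t (N - l - t) b c d * (hprod t x c * hprod (N - l - t) x d) * hprod l x a)"
    unfolding basis_def by (subst (2) elliptic_binomial[OF gen]) (simp add: sum_distrib_left mult_ac)
  also have "\<dots> = (\<Sum>t\<le>N - l. \<Sum>s\<le>l. ?g s t * basis N (s + t) x c d)"
  proof (rule sum.cong)
    fix t assume t: "t \<in> {..N - l}"
    let ?c = "c + of_nat t" and ?d = "d + of_nat (N - l - t)"
    have gen_t: "gen (?c - ?d)" "gen (?c + ?d)"
      using gen gen_add_int[of "c - d" "int t - int (N - l - t)"] gen_add_int[of "c + d" "int t + int (N - l - t)"]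
      by (simp_all add: algebra_simps)
    show "ebin t (N - l - t) b c d * (hprod t x c * hprod (N - l - t) x d) * hprod l x a
        = (\<Sum>s\<le>l. ?g s t * basis N (s + t) x c d)"
      unfolding elliptic_binomial[OF gen_t, of l x a] sum_distrib_left
    proof (rule sum.cong)
      fix s assume s: "s \<in> {..l}"
      show "ebin t (N - l - t) b c d * (hprod t x c * hprod (N - l - t) x d)
          * (ebin s (l - s) a ?c ?d * (hprod s x ?c * hprod (l - s) x ?d)) = ?g s t * basis N (s + t) x c d"
        using s t by (subst prods[symmetric]) (simp_all add: mult_ac)
    qed simp
  qed simp
  also have "\<dots> = (\<Sum>s\<le>l. \<Sum>t\<le>N - l. ?g s t * basis N (s + t) x c d)"
    by (rule sum.swap)
  also have "\<dots> = (\<Sum>s\<le>l. \<Sum>j\<le>N. if s \<le> j \<and> j - s \<le> N - l then ?g s (j - s) * basis N (s + (j - s)) x c d else 0)"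
    using \<open>l \<le> N\<close> by (intro sum.cong refl sum_atMost_shift) simp
  also have "\<dots> = (\<Sum>j\<le>N. conn2 N l j a b c d * basis N j x c d)"
    unfolding conn2_def sum_distrib_right by (subst sum.swap) (intro sum.cong refl, simp)
  finally show ?thesis .
qed

lemma basis_coeffs_unique:
  assumes gen: "gen (2 * a)" "gen (a + b)" "gen (a - b)"
    and eq: "\<And>x. (\<Sum>k\<le>N. f k * basis N k x a b) = (\<Sum>k\<le>N. g k * basis N k x a b)" and "k \<le> N"
  shows "f k = g k"
  using basis_independent[OF gen, where N = N and f = "\<lambda>k. f k - g k" and k = k] eq \<open>k \<le> N\<close>
  by (simp add: left_diff_distrib sum_subtractf)

lemma conn1_eq_conn2:
  assumes "gen (b - c)" "gen (b + c)" "gen (c - d)" "gen (c + d)" "gen (2 * c)" "l \<le> N" "j \<le> N"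
  shows "conn1 N l j a b c d = conn2 N l j a b c d"
  by (rule basis_coeffs_unique[where a = c and b = d and N = N])
    (use assms conn1_expansion[of b c d l N _ a] conn2_expansion[of c d l N _ a b] in auto)

lemma conn_inverse:
  assumes gen: "gen (b - c)" "gen (b + c)" "gen (c - d)" "gen (c + d)" "gen (a - b)" "gen (a + b)" "gen (2 * a)"
    and "l \<le> N" "k \<le> N"
  shows "(\<Sum>j\<le>N. conn1 N l j a b c d * conn2 N j k c d a b) = (if k = l then 1 else 0)"
proof (rule basis_coeffs_unique[where a = a and b = b and N = N
      and f = "\<lambda>k. \<Sum>j\<le>N. conn1 N l j a b c d * conn2 N j k c d a b" and g = "\<lambda>k. if k = l then 1 else 0"])
  fix x
  have "(\<Sum>k\<le>N. (if k = l then 1 else 0) * basis N k x a b) = basis N l x a b"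
    using \<open>l \<le> N\<close> by (simp add: if_distrib[of "\<lambda>y. y * _"] cong: if_cong)
  also have "\<dots> = (\<Sum>j\<le>N. conn1 N l j a b c d * (\<Sum>k\<le>N. conn2 N j k c d a b * basis N k x a b))"
    unfolding conn1_expansion[OF gen(1-4) \<open>l \<le> N\<close>]
    by (intro sum.cong refl) (simp add: conn2_expansion[OF gen(5,6)])
  also have "\<dots> = (\<Sum>k\<le>N. (\<Sum>j\<le>N. conn1 N l j a b c d * conn2 N j k c d a b) * basis N k x a b)"
    unfolding sum_distrib_left sum_distrib_right by (subst sum.swap) (simp add: mult.assoc)
  finally show "(\<Sum>k\<le>N. (\<Sum>j\<le>N. conn1 N l j a b c d * conn2 N j k c d a b) * basis N k x a b)
      = (\<Sum>k\<le>N. (if k = l then 1 else 0) * basis N k x a b)" by simp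
qed (use assms in auto)

section \<open>Very-well-poised series as connection coefficients\<close>

lemma poch_one_plus: "poch (1 + of_nat m) n = fct (m + n) / fct m"
  using poch_add[of 1 m n] fct_nonzero[of m] by (simp add: fct_def field_simps)

lemma poch_neg: "poch (- of_nat (m + n)) n = (- 1) ^ n * (fct (m + n) / fct m)"
  using poch_reflect[of "- of_nat (m + n)" n] by (simp add: poch_one_plus)

text \<open>The terms of the series of the theorem in additive notation, for the parameters \<open>a\<close>, \<open>b\<close>, \<open>c\<close>, \<open>d\<close>
  of the bases. The last factor is the regularized removable one.\<close>

definition vwp_term :: "nat \<Rightarrow> complex \<Rightarrow> complex \<Rightarrow> complex \<Rightarrow> complex \<Rightarrow> nat \<Rightarrow> nat \<Rightarrow> nat \<Rightarrow> complex" where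
  "vwp_term N a b c d j l s = (let n = of_nat N; j' = of_nat j; l' = of_nat l; \<alpha> = b - a + n - 2 * l' - j' in
     S (\<alpha> + 2 * of_nat s) / S \<alpha>
     * (poch \<alpha> s * poch (- j') s * poch (- l') s * poch (b - a - l') s * poch (1 - a - d - l') s
        * poch (b + c + n - l') s * poch (d - a + n - j' - l') s * poch (1 + b - c + n - j' - l') s)
     / (fct s * poch (1 + \<alpha> + j') s * poch (1 + \<alpha> + l') s * poch (1 - a - c - j' - l') s
        * poch (b + d + n - j' - l') s * poch (1 + b - d - l') s * poch (c - a - l') s)
     * poch (1 + n - j' - l' + of_nat s) (j - s))"

text \<open>The quotient of the terms of the series and those of \<open>conn2\<close>. All factorials are given natural
  lengths, at the price of shifted starting points such as $d-a+N-j-l$.\<close>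

definition vwp_factor :: "nat \<Rightarrow> complex \<Rightarrow> complex \<Rightarrow> complex \<Rightarrow> complex \<Rightarrow> nat \<Rightarrow> nat \<Rightarrow> complex" where
  "vwp_factor N a b c d j l = (let n = of_nat N; j' = of_nat j; l' = of_nat l in
     (- 1) ^ l * (fct l * fct (N - l) * poch (a + b) N * poch (a + d) l * poch (d - a + n - j' - l') l
       * poch (1 + b - a + n - 2 * l' - j') l * poch (b - a - l') (N - l))
     / (fct (N - j) * poch (b + d + n - j' - l') l * poch (d - b) l * poch (a + d) (N - j)
       * poch (d - a) (N - j) * poch (a + c + l') j * poch (c - a - l') j))"

text \<open>In the nonnegative variables \<open>s\<close>, \<open>t\<close>, \<open>u\<close>, \<open>v\<close> all factorials have nonnegative lengths. The
  factors with arguments in one coset are compared separately: after a reflection each comparison is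
  two ways of cutting one factorial into pieces.\<close>

lemma vwp_term_eq:
  assumes gen: "gen (a + b)" "gen (a - b)" "gen (a + c)" "gen (a - c)" "gen (a + d)" "gen (a - d)"
      "gen (b + c)" "gen (b - c)" "gen (b + d)" "gen (b - d)"
    and l: "l = s + t" and j: "j = s + u" and N: "N = s + t + u + v"
  shows "vwp_term N a b c d j l s = vwp_factor N a b c d j l
    * (ebin t v d a b * ebin s u c (a + of_nat t) (b + of_nat v))"
proof -
  define s' t' u' v' where cx: "s' = complex_of_nat s" "t' = complex_of_nat t"
    "u' = complex_of_nat u" "v' = complex_of_nat v"
  note cx' = cx[symmetric]
  define \<gamma> where "\<gamma> = b - a + v' - t' - 2 * s'"
  have genBA: "gen (b - a)" "gen (c - a)" "gen (d - a)" "gen (c - b)" "gen (d - b)"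
    using gen gen_diff_commute[of a b] gen_diff_commute[of a c] gen_diff_commute[of a d]
      gen_diff_commute[of b c] gen_diff_commute[of b d] by simp_all
  have T: "vwp_term N a b c d j l s = S (\<gamma> + 2 * s') / S \<gamma>
     * (poch \<gamma> s * poch (- of_nat (u + s)) s * poch (- of_nat (t + s)) s * poch (b - a - t' - s') s * poch (1 - (a + d) - t' - s') s
        * poch (b + c + u' + v') s * poch (d - a + v' - s') s * poch (1 + b - c + v' - s') s)
     / (fct s * poch (1 + \<gamma> + s' + u') s * poch (1 + \<gamma> + s' + t') s * poch (1 - (a + c) - 2 * s' - t' - u') s
        * poch (b + d + v' - s') s * poch (1 + b - d - t' - s') s * poch (c - a - t' - s') s)
     * poch (1 + of_nat v) u"
    unfolding vwp_term_def Let_def l j N of_nat_add cx'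
    by (simp add: \<gamma>_def algebra_simps)
  have K: "vwp_factor N a b c d j l = (- 1) ^ (s + t) * (fct (s + t) * fct (u + v) * poch (a + b) ((t + v) + (s + u)) * poch (a + d) (t + s)
       * poch (d - a + v' - s') (s + t)
       * poch (1 + \<gamma>) (s + t) * poch (b - a - t' - s') (v + u))
     / (fct (t + v) * poch (b + d + v' - s') (s + t) * poch (d - b) (t + s) * poch (a + d) (t + v)
       * poch (d - a) (v + t) * poch (a + c + s' + t') (u + s) * poch (c - a - t' - s') (s + u))"
    unfolding vwp_factor_def Let_def l j N of_nat_add cx'
    by (simp add: \<gamma>_def algebra_simps)
  have E: "ebin t v d a b * ebin s u c (a + of_nat t) (b + of_nat v) =
     fct (t + v) / (fct t * fct v) * (poch (b + d + v') t * poch (d - b) t * poch (a + d + t') v * poch (d - a) v)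
       / (poch (a + b) (t + v) * poch (a - b - v') t * poch (b - a - t') v)
     * (fct (s + u) / (fct s * fct u)
       * (poch (b + c + u' + v') s * poch (c - b - v') s * poch (a + c + s' + t') u * poch (c - a - t') u)
       / (poch (a + b + t' + v') (s + u) * poch (a - b + t' - v' - u') s * poch (b - a + v' - t' - s') u))"
    unfolding ebin_def cx' by (simp add: algebra_simps)
  have refl: "poch x n = (- 1) ^ n * poch y n" if "y = 1 - x - of_nat n" for x y n
    using poch_reflect[of x n] that by simp
  have add: "poch x (m + n) = poch x m * poch y n" if "y = x + of_nat m" for x y m n
    using poch_add[of x m n] that by simp
  have signs:
    "poch (1 - (a + d) - t' - s') s = (- 1) ^ s * poch (a + d + t') s"
    "poch (1 + b - c + v' - s') s = (- 1) ^ s * poch (c - b - v') s"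
    "poch (1 - (a + c) - 2 * s' - t' - u') s = (- 1) ^ s * poch (a + c + s' + t' + u') s"
    "poch (1 + b - d - t' - s') s = (- 1) ^ s * poch (d - b + t') s"
    "poch (a - b - v') t = (- 1) ^ t * poch (1 + \<gamma> + 2 * s') t"
    "poch (a - b + t' - v' - u') s = (- 1) ^ s * poch (1 + \<gamma> + s' + u') s"
    by (rule refl, simp add: cx \<gamma>_def algebra_simps)+
  have splits:
    "poch (b + d + v' - s') (s + t) = poch (b + d + v' - s') s * poch (b + d + v') t"
    "poch (d - b) (t + s) = poch (d - b) t * poch (d - b + t') s"
    "poch (a + d) (t + s) = poch (a + d) t * poch (a + d + t') s"
    "poch (a + d) (t + v) = poch (a + d) t * poch (a + d + t') v"
    "poch (d - a) (v + t) = poch (d - a) v * poch (d - a + v') t"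
    "poch (d - a + v' - s') (s + t) = poch (d - a + v' - s') s * poch (d - a + v') t"
    "poch (a + b) ((t + v) + (s + u)) = poch (a + b) (t + v) * poch (a + b + t' + v') (s + u)"
    "poch (a + c + s' + t') (u + s) = poch (a + c + s' + t') u * poch (a + c + s' + t' + u') s"
    "poch (c - a - t' - s') (s + u) = poch (c - a - t' - s') s * poch (c - a - t') u"
    "poch (b - a - t' - s') (v + u) = poch (b - a - t' - s') v * poch (b - a + v' - t' - s') u"
    by (rule add, simp add: cx algebra_simps)+
  have "poch (b - a - t' - s') s * poch (b - a - t') v = poch (b - a - t' - s') v * poch (\<gamma> + s') s"
    using add[of "b - a - t'" "b - a - t' - s'" s v] add[of "\<gamma> + s'" "b - a - t' - s'" v s]
    by (simp add: cx \<gamma>_def add.commute)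
  moreover have nz1: "poch (b - a - t') v \<noteq> 0"
    using genBA by (intro poch_nonzero) (simp add: cx)
  ultimately have X: "poch (b - a - t' - s') s = poch (b - a - t' - s') v * poch (\<gamma> + s') s / poch (b - a - t') v"
    by (simp add: field_simps)
  have gen_\<gamma>: "gen \<gamma>"
    using genBA gen_add_int[of "b - a" "int v - int t - 2 * int s"] by (simp add: \<gamma>_def cx algebra_simps)
  \<comment> \<open>Both sides are the factorial of length \<open>2 * s + t + 1\<close> that starts at \<open>\<gamma>\<close>.\<close>
  have key: "poch \<gamma> s * poch (\<gamma> + s') s * (S (\<gamma> + 2 * s') * poch (1 + \<gamma> + 2 * s') t)
      = S \<gamma> * (poch (1 + \<gamma>) (s + t) * poch (1 + \<gamma> + s' + t') s)"
  proof -
    have "poch \<gamma> (s + (s + Suc t)) = poch \<gamma> s * (poch (\<gamma> + s') s * poch (\<gamma> + 2 * s') (Suc t))"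
      using add[of "\<gamma> + s'" \<gamma> s "s + Suc t"] add[of "\<gamma> + 2 * s'" "\<gamma> + s'" s "Suc t"] by (simp add: cx)
    moreover have "poch \<gamma> (Suc ((s + t) + s)) = S \<gamma> * (poch (1 + \<gamma>) (s + t) * poch (1 + \<gamma> + s' + t') s)"
      using poch_Suc_left[of \<gamma> "(s + t) + s"] add[of "1 + \<gamma> + s' + t'" "1 + \<gamma>" "s + t" s]
      by (simp add: cx add_ac)
    moreover have "poch (\<gamma> + 2 * s') (Suc t) = S (\<gamma> + 2 * s') * poch (1 + \<gamma> + 2 * s') t"
      using poch_Suc_left[of "\<gamma> + 2 * s'" t] by (simp add: add_ac)
    ultimately show ?thesis by (simp add: add_ac mult_ac)
  qed
  have nz2: "poch \<gamma> s \<noteq> 0" "poch (\<gamma> + s') s \<noteq> 0" "poch (1 + \<gamma> + 2 * s') t \<noteq> 0" "S \<gamma> \<noteq> 0"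
    using gen_\<gamma> gen_add_int[of \<gamma> "int s"] gen_add_int[of \<gamma> "1 + 2 * int s"]
    by (auto intro!: poch_nonzero gen_S simp: cx algebra_simps)
  have Y: "S (\<gamma> + 2 * s') = S \<gamma> * (poch (1 + \<gamma>) (s + t) * poch (1 + \<gamma> + s' + t') s)
      / (poch \<gamma> s * poch (\<gamma> + s') s * poch (1 + \<gamma> + 2 * s') t)"
    using key nz2 by (simp add: field_simps)
  have e: "(- 1) ^ s = (1 :: complex) \<or> (- 1) ^ s = (- 1 :: complex)" "(- 1) ^ t = (1 :: complex) \<or> (- 1) ^ t = (- 1 :: complex)"
    by (cases "even s"; simp) (cases "even t"; simp)
  have "gen (b + d + v')" "gen (d - b)" "gen (a + d + t')" "gen (d - a)" "gen (a + b)"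
      "gen (a + b + t' + v')" "gen (1 + \<gamma> + s' + u')" "gen (a + c + s' + t' + u')" "gen (b + d + v' - s')"
      "gen (d - b + t')" "gen (c - a - t' - s')" "gen (1 + \<gamma> + s' + t')" "gen (b - a + v' - t' - s')"
      "gen (a + d)" "gen (a + c + s' + t')" "gen (d - a + v')" "gen (c - a - t')"
    using gen genBA gen_\<gamma> by (simp_all add: cx)
  note nz = nz1 nz2 fct_nonzero this[THEN poch_nonzero]
  show ?thesis
    unfolding T K E signs splits X Y poch_neg poch_one_plus power_add
    using e by (elim disjE) (simp_all add: divide_simps nz add.commute[of v u] add.commute[of u s] add.commute[of t s])
qed

lemma vwp_series_eq:
  assumes gen: "gen (a + b)" "gen (a - b)" "gen (a + c)" "gen (a - c)" "gen (a + d)" "gen (a - d)"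
      "gen (b + c)" "gen (b - c)" "gen (b + d)" "gen (b - d)"
    and le: "j \<le> N" "l \<le> N"
  shows "(\<Sum>s\<le>min j l. vwp_term N a b c d j l s) = vwp_factor N a b c d j l * conn2 N j l c d a b"
proof -
  have *: "vwp_term N a b c d j l s = vwp_factor N a b c d j l * (if s \<le> l \<and> l - s \<le> N - j
      then ebin (l - s) (N - j - (l - s)) d a b
        * ebin s (j - s) c (a + of_nat (l - s)) (b + of_nat (N - j - (l - s))) else 0)"
    if "s \<le> j" "s \<le> l" for s
  proof (cases "l - s \<le> N - j")
    case True
    then show ?thesis
      using vwp_term_eq[OF gen, of l s "l - s" j "j - s" N "N - j - (l - s)"] that le by simp
  next
    case False
    \<comment> \<open>The regularized factor runs through \<open>S 0\<close>.\<close>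
    then have "1 + of_nat N - of_nat j - of_nat l + of_nat s = - (of_nat (l - s - (N - j) - 1) :: complex)"
      using that le by (simp add: of_nat_diff)
    moreover have "l - s - (N - j) - 1 < j - s"
      using False that le by linarith
    ultimately have "poch (1 + of_nat N - of_nat j - of_nat l + of_nat s) (j - s) = 0"
      using poch_zero by simp
    with False show ?thesis by (simp add: vwp_term_def Let_def)
  qed
  have "(\<Sum>s\<le>min j l. vwp_term N a b c d j l s)
      = (\<Sum>s\<le>min j l. vwp_factor N a b c d j l * (if s \<le> l \<and> l - s \<le> N - j
      then ebin (l - s) (N - j - (l - s)) d a b
        * ebin s (j - s) c (a + of_nat (l - s)) (b + of_nat (N - j - (l - s))) else 0))"
    by (intro sum.cong refl *) auto
  also have "\<dots> = vwp_factor N a b c d j l * conn2 N j l c d a b"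
    unfolding conn2_def sum_distrib_left by (rule sum.mono_neutral_left) auto
  finally show ?thesis .
qed

section \<open>Duality of the connection coefficients\<close>

definition dual_factor :: "nat \<Rightarrow> complex \<Rightarrow> complex \<Rightarrow> complex \<Rightarrow> complex \<Rightarrow> nat \<Rightarrow> nat \<Rightarrow> complex" where
  "dual_factor N a b c d l j = (let n = of_nat N; j' = of_nat j; l' = of_nat l in
     fct l * fct (N - l) * poch (a - b - n + l') l * poch (b - a - l') (N - l) * poch (a + c) l
       * poch (b + c) (N - l) * poch (b + d) (N - l) * poch (a + d) l
     / (fct j * fct (N - j) * poch (c - d - n + j') j * poch (d - c - j') (N - j) * poch (a + c) j
       * poch (b + c) j * poch (b + d) (N - j) * poch (a + d) (N - j)))"

text \<open>The sums and differences of $g-d,g-c,g-b,g-a$ are those of $a,b,c,d$ with $a-b$ and $c-d$, $b+c$ and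
  $a+d$, and $a-c$ and $b-d$ exchanged. So the two products contain the same factorials up to lengths
  that depend on \<open>s\<close>, and in the quotient this dependence cancels in every coset.\<close>

lemma ebin_duality:
  assumes gen: "gen (a + b)" "gen (a - b)" "gen (a + c)" "gen (a - c)" "gen (a + d)" "gen (a - d)"
      "gen (b + c)" "gen (b - c)" "gen (b + d)" "gen (b - d)" "gen (c + d)" "gen (c - d)"
    and d: "d = 2 * g - a - b - c"
    and l: "l = s + t" and j: "j = s + u" and N: "N = s + t + m" and tm: "t + m = u + n"
  shows "ebin s t a c (b + of_nat m) * ebin u n b (c + of_nat s) d
    = dual_factor N a b c d l j
      * (ebin s u (g - d) (g - b) (g - c + of_nat n) * ebin t m (g - c) (g - b + of_nat s) (g - a))"
proof -
  define s' t' u' m' n' where cx: "s' = complex_of_nat s" "t' = complex_of_nat t"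
    "u' = complex_of_nat u" "m' = complex_of_nat m" "n' = complex_of_nat n"
  note cx' = cx[symmetric]
  have m': "m' = u' + n' - t'"
    using arg_cong[OF tm, of "of_nat :: nat \<Rightarrow> complex"] by (simp add: cx algebra_simps)
  have Nj: "N - j = n" "N - l = m"
    using l j N tm by auto
  have genBA: "gen (b - a)" "gen (c - a)" "gen (d - a)" "gen (c - b)" "gen (d - b)" "gen (d - c)"
    using gen gen_diff_commute[of a b] gen_diff_commute[of a c] gen_diff_commute[of a d]
      gen_diff_commute[of b c] gen_diff_commute[of b d] gen_diff_commute[of c d] by simp_all
  have E1: "ebin s t a c (b + of_nat m) * ebin u n b (c + of_nat s) d =
     fct (s + t) / (fct s * fct t) * (poch (a + b + u' + n') s * poch (a - b - m') s * poch (a + c + s') t * poch (a - c) t)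
       / (poch (b + c + m') (s + t) * poch (c - b - u' - n') s * poch (b - c + m' - s') t)
     * (fct (u + n) / (fct u * fct n) * (poch (b + d + n') u * poch (b - d) u * poch (b + c + s' + u') n * poch (b - c - s') n)
       / (poch (c + d + s') (u + n) * poch (c - d + s' - n') u * poch (d - c - s' - u') n))"
    unfolding ebin_def cx' by (simp add: m' algebra_simps)
  have E2: "ebin s u (g - d) (g - b) (g - c + of_nat n) * ebin t m (g - c) (g - b + of_nat s) (g - a) =
     fct (s + u) / (fct s * fct u) * (poch (a + b + u' + n') s * poch (c - d - n') s * poch (a + c + s') u * poch (b - d) u)
       / (poch (a + d + n') (s + u) * poch (c - b - u' - n') s * poch (b - c + n' - s') u)
     * (fct (u + n) / (fct t * fct m) * (poch (b + d + m') t * poch (a - c) t * poch (a + d + s' + t') m * poch (b - c - s') m)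
       / (poch (c + d + s') (u + n) * poch (a - b + s' - m') t * poch (b - a - s' - t') m))"
    unfolding ebin_def cx' tm by (simp add: m' d algebra_simps)
  have M: "dual_factor N a b c d l j =
     fct (s + t) * fct m * poch (a - b - m') (s + t) * poch (b - a - s' - t') m * poch (a + c) (s + t)
       * poch (b + c) m * poch (b + d) m * poch (a + d) (s + t)
     / (fct (s + u) * fct n * poch (c - d - n') (s + u) * poch (d - c - s' - u') n * poch (a + c) (s + u)
       * poch (b + c) (s + u) * poch (b + d) n * poch (a + d) n)"
    unfolding dual_factor_def Let_def Nj unfolding N l j of_nat_add cx'
    by (simp add: m' algebra_simps)
  have add: "poch x (p + q) = poch x p * poch y q" if "y = x + of_nat p" for x y p q
    using poch_add[of x p q] that by simp
  have splits:
    "poch (a - b - m') (s + t) = poch (a - b - m') s * poch (a - b + s' - m') t"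
    "poch (c - d - n') (s + u) = poch (c - d - n') s * poch (c - d + s' - n') u"
    "poch (a + c) (s + t) = poch (a + c) s * poch (a + c + s') t"
    "poch (a + c) (s + u) = poch (a + c) s * poch (a + c + s') u"
    by (rule add, simp add: cx algebra_simps)+
  have cross: "poch x p * poch y q = poch x p2 * poch y2 q2"
    if "p + q = p2 + q2" "y = x + of_nat p" "y2 = x + of_nat p2" for x y y2 p q p2 q2
    using poch_add[of x p q] poch_add[of x p2 q2] that by simp
  have "poch (b + c) m * poch (b + c + m') (s + t) = poch (b + c) (s + u) * poch (b + c + s' + u') n"
       "poch (b + d) m * poch (b + d + m') t = poch (b + d) n * poch (b + d + n') u"
       "poch (a + d) n * poch (a + d + n') (s + u) = poch (a + d) (s + t) * poch (a + d + s' + t') m"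
       "poch (b - c - s') m * poch (b - c + m' - s') t = poch (b - c - s') n * poch (b - c + n' - s') u"
    by (rule cross; use tm in \<open>simp add: cx algebra_simps\<close>)+
  moreover have "gen (b + c)" "gen (b + d)" "gen (a + d)" "gen (b - c - s')"
     "gen (a + c)" "gen (a + c + s')" "gen (c - d + s' - n')" "gen (d - c - s' - u')" "gen (c - d - n')"
     "gen (a - b + s' - m')" "gen (b - a - s' - t')" "gen (c + d + s')" "gen (a + d + n')" "gen (b + c + s' + u')"
     "gen (b + d + n')" "gen (c - b - u' - n')" "gen (b - c + n' - s')" "gen (b - d)" "gen (a - c)"
     "gen (a + d + s' + t')" "gen (b + d + m')"
    using gen genBA by (simp_all add: cx)
  note nz = fct_nonzero this[THEN poch_nonzero]
  ultimately have subst: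
       "poch (b + c + m') (s + t) = poch (b + c) (s + u) * poch (b + c + s' + u') n / poch (b + c) m"
       "poch (b + d + m') t = poch (b + d) n * poch (b + d + n') u / poch (b + d) m"
       "poch (a + d + n') (s + u) = poch (a + d) (s + t) * poch (a + d + s' + t') m / poch (a + d) n"
       "poch (b - c + m' - s') t = poch (b - c - s') n * poch (b - c + n' - s') u / poch (b - c - s') m"
    by (simp_all add: nz divide_simps mult_ac)
  show ?thesis
    unfolding E1 E2 M splits subst by (simp add: divide_simps nz)
qed

lemma conn1_duality:
  assumes gen: "gen (a + b)" "gen (a - b)" "gen (a + c)" "gen (a - c)" "gen (a + d)" "gen (a - d)"
      "gen (b + c)" "gen (b - c)" "gen (b + d)" "gen (b - d)" "gen (c + d)" "gen (c - d)"
    and d: "d = 2 * g - a - b - c" and le: "l \<le> N" "j \<le> N"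
  shows "conn1 N l j a b c d = dual_factor N a b c d l j * conn1 N j l (g - d) (g - c) (g - b) (g - a)"
proof -
  have "conn1 N l j a b c d = (\<Sum>s\<le>min l j. ebin s (l - s) a c (b + of_nat (N - l)) * ebin (j - s) (N - j) b (c + of_nat s) d)"
    unfolding conn1_def by (rule sum.mono_neutral_cong_right) auto
  also have "\<dots> = (\<Sum>s\<le>min l j. dual_factor N a b c d l j
      * (ebin s (j - s) (g - d) (g - b) (g - c + of_nat (N - j)) * ebin (l - s) (N - l) (g - c) (g - b + of_nat s) (g - a)))"
    using le by (intro sum.cong refl ebin_duality[OF gen d]) auto
  also have "\<dots> = dual_factor N a b c d l j * conn1 N j l (g - d) (g - c) (g - b) (g - a)"
    unfolding conn1_def sum_distrib_left by (rule sum.mono_neutral_cong_left) auto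
  finally show ?thesis .
qed

section \<open>Weight and norm\<close>

text \<open>The weight of the theorem in additive notation, without the factors that are attached to the series.\<close>

definition weight :: "nat \<Rightarrow> complex \<Rightarrow> complex \<Rightarrow> complex \<Rightarrow> complex \<Rightarrow> nat \<Rightarrow> nat \<Rightarrow> nat \<Rightarrow> complex" where
  "weight N a b c d j k l = (let n = of_nat N; k' = of_nat k; l' = of_nat l in
     S (c - d - n + 2 * of_nat j) / S (c - d - n) * poch (c - d - n) j / poch (1 + c - d) j
     * poch (c - a - k') j / poch (1 + a - d - n + k') j
     * (poch (a + c + k') j * poch (a - b - n + k') j * poch (1 - b - d - n + k') j)
     / (fct j * poch (b + c) j * poch (a + c) j * poch (a - b - n + 2 * k') j * poch (- n) j
        * poch (1 - b - d - n) j * poch (1 - a - d - n) j)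
     * (poch (a + c + l') j * poch (a - b - n + l') j * poch (1 - b - d - n + l') j)
     / poch (a - b - n + 2 * l') j
     * poch (b - d - l') j / poch (1 + c - b - n + l') j)"

text \<open>What is left of the weight and the factors of the two series after the factors of the connection
  coefficients are removed. It occurs for $k\ne l$ only as a factor of $0$.\<close>

definition pairing_const :: "nat \<Rightarrow> complex \<Rightarrow> complex \<Rightarrow> complex \<Rightarrow> complex \<Rightarrow> nat \<Rightarrow> nat \<Rightarrow> complex" where
  "pairing_const N a b c d k l = (let n = of_nat N; k' = of_nat k in
     (- 1) ^ N * fct k * fct (N - k) / fct N
     * (poch (1 + c - d - n) N * poch (a - b - n + k') k * poch (b - a - k') (N - k) * poch (a + d) k
        * poch (a + b) N * poch (c + d) N)
     / (poch (a + c) l * poch (b + c) (N - l) * poch (b + d + n - k') k * poch (a + d) N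
        * poch (d - a) (N - k) * poch (a - c) l * poch (d - b) k * poch (b - c) (N - l)))"

text \<open>As in \<open>vwp_term_eq\<close> the factors are compared coset by coset. The coset of $c-d$ carries the
  very-well-poised part of the weight; in the other cosets the dependence on \<open>j\<close> cancels by the two ways of
  cutting a factorial of length \<open>j + k\<close>, \<open>j + l\<close> or \<open>N\<close>.\<close>

lemma weight_eq:
  assumes gen: "gen (a + b)" "gen (a - b)" "gen (a + c)" "gen (a - c)" "gen (a + d)" "gen (a - d)"
      "gen (b + c)" "gen (b - c)" "gen (b + d)" "gen (b - d)" "gen (c + d)" "gen (c - d)"
    and d: "d = 2 * g - a - b - c"
    and j: "N = n + j" and k: "N = k2 + k" and l: "N = l2 + l"
  shows "weight N a b c d j k l * vwp_factor N a b c d j k * vwp_factor N (g - b) (g - a) (g - d) (g - c) j l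
    = pairing_const N a b c d k l * dual_factor N a b c d l j"
proof -
  define j' n' k' k2' l' l2' where cx: "j' = complex_of_nat j" "n' = complex_of_nat n"
    "k' = complex_of_nat k" "k2' = complex_of_nat k2" "l' = complex_of_nat l" "l2' = complex_of_nat l2"
  note cx' = cx[symmetric]
  have Nc: "of_nat N = j' + n'" "k2' = j' + n' - k'" "l2' = j' + n' - l'"
    using arg_cong[OF k, of "of_nat :: nat \<Rightarrow> complex"] arg_cong[OF l, of "of_nat :: nat \<Rightarrow> complex"]
    unfolding j by (simp_all add: cx algebra_simps)
  have sub: "N - j = n" "N - k = k2" "N - l = l2"
    using j k l by auto
  have genBA: "gen (b - a)" "gen (c - a)" "gen (d - a)" "gen (c - b)" "gen (d - b)" "gen (d - c)"
    using gen gen_diff_commute[of a b] gen_diff_commute[of a c] gen_diff_commute[of a d]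
      gen_diff_commute[of b c] gen_diff_commute[of b d] gen_diff_commute[of c d] by simp_all
  define X where "X = c - d - j' - n'"
  define x where "x = a - b - j' - n'"
  have W: "weight N a b c d j k l = S (X + 2 * j') / S X * poch X j / poch (1 + c - d) j
     * poch (c - a - k') j / poch (1 - (d - a) - k2') j
     * (poch (a + c + k') j * poch (x + k') j * poch (1 - (b + d) - k2') j)
     / (fct j * poch (b + c) j * poch (a + c) j * poch (x + 2 * k') j * poch (- of_nat (n + j)) j
        * poch (1 - (b + d) - j' - n') j * poch (1 - (a + d) - j' - n') j)
     * (poch (a + c + l') j * poch (x + l') j * poch (1 - (b + d) - l2') j)
     / poch (x + 2 * l') j * poch (b - d - l') j / poch (1 - (b - c) - l2') j"
    unfolding weight_def Let_def j[symmetric] cx' by (simp add: Nc X_def x_def algebra_simps)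
  have K: "vwp_factor N a b c d j k =
     (- 1) ^ k * (fct k * fct k2 * poch (a + b) N * poch (a + d) k * poch (d - a + n' - k') k
       * poch (1 - x - 2 * k' - j') k * poch (b - a - k') k2)
     / (fct n * poch (b + d + n' - k') k * poch (d - b) k * poch (a + d) n
       * poch (d - a) n * poch (a + c + k') j * poch (c - a - k') j)"
    unfolding vwp_factor_def Let_def sub cx' Nc by (simp add: x_def algebra_simps)
  have K': "vwp_factor N (g - b) (g - a) (g - d) (g - c) j l =
     (- 1) ^ l * (fct l * fct l2 * poch (c + d) N * poch (a + d) l * poch (b - c + n' - l') l
       * poch (1 - x - 2 * l' - j') l * poch (b - a - l') l2)
     / (fct n * poch (b + d + n' - l') l * poch (a - c) l * poch (a + d) n
       * poch (b - c) n * poch (a + c + l') j * poch (b - d - l') j)"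
    unfolding vwp_factor_def Let_def sub cx' Nc by (simp add: x_def d algebra_simps)
  have P: "pairing_const N a b c d k l = (- 1) ^ N * fct k * fct k2 / fct N
     * (poch (1 + X) N * poch (x + k') k * poch (b - a - k') k2 * poch (a + d) k
        * poch (a + b) N * poch (c + d) N)
     / (poch (a + c) l * poch (b + c) l2 * poch (b + d + k2') k * poch (a + d) N
        * poch (d - a) k2 * poch (a - c) l * poch (d - b) k * poch (b - c) l2)"
    unfolding pairing_const_def Let_def sub cx' Nc by (simp add: X_def x_def algebra_simps)
  have M: "dual_factor N a b c d l j =
     fct l * fct l2 * poch (x + l') l * poch (b - a - l') l2 * poch (a + c) l
       * poch (b + c) l2 * poch (b + d) l2 * poch (a + d) l
     / (fct j * fct n * poch (X + j') j * poch (d - c - j') n * poch (a + c) j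
       * poch (b + c) j * poch (b + d) n * poch (a + d) n)"
    unfolding dual_factor_def Let_def sub cx' Nc by (simp add: X_def x_def algebra_simps)
  have refl: "poch z i = (- 1) ^ i * poch y i" if "y = 1 - z - of_nat i" for z y i
    using poch_reflect[of z i] that by simp
  have cross: "poch z p * poch y q = poch z p2 * poch y2 q2"
    if "p + q = p2 + q2" "y = z + of_nat p" "y2 = z + of_nat p2" for z y y2 p q p2 q2
    using poch_add[of z p q] poch_add[of z p2 q2] that by simp
  have signs:
    "poch (1 - (d - a) - k2') j = (- 1) ^ j * poch (d - a + n' - k') j"
    "poch (1 - (b + d) - k2') j = (- 1) ^ j * poch (b + d + n' - k') j"
    "poch (1 - (b + d) - l2') j = (- 1) ^ j * poch (b + d + n' - l') j"
    "poch (1 - (b + d) - j' - n') j = (- 1) ^ j * poch (b + d + n') j"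
    "poch (1 - (a + d) - j' - n') j = (- 1) ^ j * poch (a + d + n') j"
    "poch (1 - (b - c) - l2') j = (- 1) ^ j * poch (b - c + n' - l') j"
    "poch (1 - x - 2 * k' - j') k = (- 1) ^ k * poch (x + k' + j') k"
    "poch (1 - x - 2 * l' - j') l = (- 1) ^ l * poch (x + l' + j') l"
    "poch (d - c - j') n = (- 1) ^ n * poch (1 + X + 2 * j') n"
    by (rule refl, simp add: cx[symmetric] Nc X_def algebra_simps)+
  have "gen X" "gen x"
    using gen by (simp_all add: X_def x_def cx)
  then have gens: "gen X" "gen x" "gen (1 + c - d)" "gen (d - a + n' - k')" "gen (x + k')" "gen (x + l')"
     "gen (b + d + n' - k')" "gen (b + d + n' - l')" "gen (b + d + n')" "gen (a + d + n')" "gen (b - c + n' - l')"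
     "gen (b + c)" "gen (a + c)" "gen (a + d)" "gen (a + c + k')" "gen (c - a - k')" "gen (d - a)" "gen (d - b)"
     "gen (b - c)" "gen (a - c)" "gen (b + d)" "gen (a + c + l')" "gen (b - d - l')" "gen (X + j')"
     "gen (b + d + k2')" "gen (b + d + l2')" "gen (d - a + k2')" "gen (b - c + l2')"
     "gen (b - a - l')" "gen (b - a - k')" "gen (x + k' + j')" "gen (x + l' + j')"
    using gen genBA gen_shift(6)[of "c - d", unfolded add_diff_eq] by (simp_all add: cx)
  have gens2: "gen (x + 2 * k')" "gen (x + 2 * l')" "gen (1 + X + 2 * j')"
    using \<open>gen x\<close> \<open>gen X\<close> gen_add_int[of x "2 * int k"] gen_add_int[of x "2 * int l"] gen_add_int[of X "1 + 2 * int j"]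
    by (simp_all add: cx add_ac)
  note nz = fct_nonzero gen_S[OF gens(1)] gens[THEN poch_nonzero] gens2[THEN poch_nonzero]
  have "poch (x + k') j * poch (x + k' + j') k = poch (x + k') k * poch (x + 2 * k') j"
    "poch (x + l') j * poch (x + l' + j') l = poch (x + l') l * poch (x + 2 * l') j"
    "poch (b + d + n' - k') j * poch (b + d + k2') k = poch (b + d + n' - k') k * poch (b + d + n') j"
    "poch (b + d + n' - l') j * poch (b + d + l2') l = poch (b + d + n' - l') l * poch (b + d + n') j"
    "poch (d - a + n' - k') j * poch (d - a + k2') k = poch (d - a + n' - k') k * poch (d - a + n') j"
    "poch (b - c + n' - l') j * poch (b - c + l2') l = poch (b - c + n' - l') l * poch (b - c + n') j"
    by (rule cross, simp_all add: cx[symmetric] Nc)+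
  moreover have "poch (b + d) l2 * poch (b + d + l2') l = poch (b + d) n * poch (b + d + n') j"
    "poch (d - a) k2 * poch (d - a + k2') k = poch (d - a) n * poch (d - a + n') j"
    "poch (b - c) l2 * poch (b - c + l2') l = poch (b - c) n * poch (b - c + n') j"
    by (rule cross; use j k l in \<open>simp add: cx\<close>)+
  ultimately have subst:
    "poch (x + k' + j') k = poch (x + k') k * poch (x + 2 * k') j / poch (x + k') j"
    "poch (x + l' + j') l = poch (x + l') l * poch (x + 2 * l') j / poch (x + l') j"
    "poch (b + d + n' - k') j = poch (b + d + n' - k') k * poch (b + d + n') j / poch (b + d + k2') k"
    "poch (b + d + n' - l') j = poch (b + d + n' - l') l * poch (b + d + n') j / poch (b + d + l2') l"
    "poch (d - a + n' - k') j = poch (d - a + n' - k') k * poch (d - a + n') j / poch (d - a + k2') k"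
    "poch (b - c + n' - l') j = poch (b - c + n' - l') l * poch (b - c + n') j / poch (b - c + l2') l"
    "poch (b + d) l2 = poch (b + d) n * poch (b + d + n') j / poch (b + d + l2') l"
    "poch (d - a) k2 = poch (d - a) n * poch (d - a + n') j / poch (d - a + k2') k"
    "poch (b - c) l2 = poch (b - c) n * poch (b - c + n') j / poch (b - c + l2') l"
    by (simp_all add: nz divide_simps mult_ac)
  have ad: "poch (a + d) N = poch (a + d) n * poch (a + d + n') j"
    using poch_add[of "a + d" n j] by (simp add: j cx)
  have cd: "S (X + 2 * j') = S X * poch (1 + X) N * poch (1 + c - d) j
      / (poch X j * poch (X + j') j * poch (1 + X + 2 * j') n)"
  proof -
    have "poch X j * (poch (X + j') j * poch (X + 2 * j') (Suc n)) = poch X (j + (j + Suc n))"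
      unfolding poch_add cx by (simp add: algebra_simps)
    also have "\<dots> = S X * (poch (1 + X) N * poch (1 + c - d) j)"
    proof -
      have "1 + X + of_nat N = 1 + c - d"
        by (simp add: Nc X_def)
      moreover have "j + (j + Suc n) = Suc (N + j)"
        by (simp add: j)
      ultimately show ?thesis
        using poch_Suc_left[of X "N + j"] poch_add[of "1 + X" N j] by (simp only: add.commute[of X 1])
    qed
    also have "poch (X + 2 * j') (Suc n) = S (X + 2 * j') * poch (1 + X + 2 * j') n"
      using poch_Suc_left[of "X + 2 * j'" n] by (simp add: add_ac)
    finally show ?thesis
      using gens2(3)[THEN poch_nonzero, of n] by (simp add: nz divide_simps mult_ac)
  qed
  have e: "(- 1) ^ i = (1 :: complex) \<or> (- 1) ^ i = (- 1 :: complex)" for i :: nat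
    by (cases "even i") simp_all
  have N: "fct N = fct (n + j)" "(- 1) ^ N = ((- 1) ^ n * (- 1) ^ j :: complex)"
    unfolding j by (simp_all add: power_add)
  have nz2: "poch (d - a + n') j \<noteq> 0" "poch (b - c + n') j \<noteq> 0"
    using genBA gen by (auto intro!: poch_nonzero simp: cx)
  show ?thesis
    unfolding W K K' P M signs subst ad cd poch_neg N
    using e[of n] e[of j] e[of k] e[of l] by (elim disjE) (simp_all add: divide_simps nz nz2)
qed

definition norm_const :: "nat \<Rightarrow> complex \<Rightarrow> complex \<Rightarrow> complex \<Rightarrow> complex \<Rightarrow> nat \<Rightarrow> complex" where
  "norm_const N a b c d k = (let n = of_nat N in
     fct k * poch (1 - b - c - n) k * poch (a + d) k * poch (1 + a - b) k * poch (a - b - n) (2 * k)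
     * (poch (1 + c - b - n) k * poch (1 + a - d - n) k)
     * (poch (d - c) N * poch (1 + a - b - n) N) * (poch (c + d) N * poch (1 - a - b - n) N)
     / (poch (a + c) k * poch (- n) k * poch (1 - b - d - n) k * poch (a - b - n) k
        * poch (1 + a - b - n) (2 * k) * (poch (a - c) k * poch (d - b) k)
        * (poch (1 - b - c - n) N * poch (a + d) N) * (poch (1 + c - b - n) N * poch (d - a) N)))"

text \<open>The factorials of length \<open>N\<close> are reflected or cut after \<open>N - k\<close> factors; in the coset of $a-b$ a
  factorial of length \<open>N + k\<close> is cut in two ways.\<close>

lemma pairing_const_diag:
  assumes gen: "gen (a + b)" "gen (a - b)" "gen (a + c)" "gen (a - c)" "gen (a + d)" "gen (a - d)"
      "gen (b + c)" "gen (b - c)" "gen (b + d)" "gen (b - d)" "gen (c + d)" "gen (c - d)"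
    and k: "N = k2 + k"
  shows "pairing_const N a b c d k k = norm_const N a b c d k"
proof -
  define n' k' k2' where cx: "n' = complex_of_nat N" "k' = complex_of_nat k" "k2' = complex_of_nat k2"
  note cx' = cx[symmetric]
  have n': "n' = k2' + k'"
    using arg_cong[OF k, of "of_nat :: nat \<Rightarrow> complex"] by (simp add: cx)
  have sub: "N - k = k2" using k by simp
  have genBA: "gen (b - a)" "gen (c - a)" "gen (d - a)" "gen (c - b)" "gen (d - b)" "gen (d - c)"
    using gen gen_diff_commute[of a b] gen_diff_commute[of a c] gen_diff_commute[of a d]
      gen_diff_commute[of b c] gen_diff_commute[of b d] gen_diff_commute[of c d] by simp_all
  define x where "x = a - b - n'"
  have P: "pairing_const N a b c d k k = (- 1) ^ N * fct k * fct k2 / fct N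
     * (poch (1 + c - d - n') N * poch (x + k') k * poch (b - a - k') k2 * poch (a + d) k
        * poch (a + b) N * poch (c + d) N)
     / (poch (a + c) k * poch (b + c) k2 * poch (b + d + k2') k * poch (a + d) N
        * poch (d - a) k2 * poch (a - c) k * poch (d - b) k * poch (b - c) k2)"
    unfolding pairing_const_def Let_def sub cx' by (simp add: n' x_def algebra_simps)
  have Q: "norm_const N a b c d k =
     fct k * poch (1 - (b + c) - n') k * poch (a + d) k * poch (1 + a - b) k * poch x (2 * k)
     * (poch (1 - (b - c) - n') k * poch (1 - (d - a) - n') k)
     * (poch (d - c) N * poch (1 + x) N) * (poch (c + d) N * poch (1 - (a + b) - n') N)
     / (poch (a + c) k * poch (- of_nat (k2 + k)) k * poch (1 - (b + d) - n') k * poch x k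
        * poch (1 + x) (2 * k) * (poch (a - c) k * poch (d - b) k)
        * (poch (1 - (b + c) - n') N * poch (a + d) N) * (poch (1 - (b - c) - n') N * poch (d - a) N))"
    unfolding norm_const_def Let_def k[symmetric] cx' by (simp add: x_def algebra_simps)
  have refl: "poch z i = (- 1) ^ i * poch y i" if "y = 1 - z - of_nat i" for z y i
    using poch_reflect[of z i] that by simp
  have signs:
    "poch (1 + c - d - n') N = (- 1) ^ N * poch (d - c) N"
    "poch (b - a - k') k2 = (- 1) ^ k2 * poch (1 + x + 2 * k') k2"
    "poch (1 - (b + c) - n') k = (- 1) ^ k * poch (b + c + k2') k"
    "poch (1 - (b - c) - n') k = (- 1) ^ k * poch (b - c + k2') k"
    "poch (1 - (d - a) - n') k = (- 1) ^ k * poch (d - a + k2') k"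
    "poch (1 - (b + d) - n') k = (- 1) ^ k * poch (b + d + k2') k"
    "poch (1 - (a + b) - n') N = (- 1) ^ N * poch (a + b) N"
    "poch (1 - (b + c) - n') N = (- 1) ^ N * poch (b + c) N"
    "poch (1 - (b - c) - n') N = (- 1) ^ N * poch (b - c) N"
    by (rule refl, simp add: cx[symmetric] n' x_def algebra_simps)+
  have splits:
    "poch (b + c) N = poch (b + c) k2 * poch (b + c + k2') k"
    "poch (b - c) N = poch (b - c) k2 * poch (b - c + k2') k"
    "poch (d - a) N = poch (d - a) k2 * poch (d - a + k2') k"
    "poch x (2 * k) = poch x k * poch (x + k') k"
    unfolding k mult_2 poch_add cx by simp_all
  have ab: "poch (1 + x) N = poch (1 + x) (2 * k) * poch (1 + x + 2 * k') k2 / poch (1 + a - b) k"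
  proof -
    have "2 * k + k2 = N + k"
      by (simp add: k)
    then have "poch (1 + x) (2 * k + k2) = poch (1 + x) (N + k)"
      by (simp only:)
    then have "poch (1 + x) (2 * k) * poch (1 + x + 2 * k') k2 = poch (1 + x) N * poch (1 + a - b) k"
      unfolding poch_add by (simp add: cx[symmetric] x_def algebra_simps)
    moreover have "poch (1 + a - b) k \<noteq> 0"
      using gen by (intro poch_nonzero) (simp add: add_diff_eq[symmetric])
    ultimately show ?thesis by (simp add: field_simps)
  qed
  have "gen x" using gen by (simp add: x_def cx)
  then have "gen x" "gen (1 + x)" "gen (x + k')" "gen (1 + a - b)" "gen (a + c)" "gen (b + c)" "gen (b + d + k2')" "gen (a + d)"
      "gen (d - a)" "gen (a - c)" "gen (d - b)" "gen (b - c)" "gen (d - a + k2')" "gen (b - c + k2')" "gen (b + c + k2')"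
    using gen genBA gen_shift(6)[of "a - b"] by (simp_all add: cx add_diff_eq)
  note nz = fct_nonzero this[THEN poch_nonzero]
  have e: "(- 1) ^ i = (1 :: complex) \<or> (- 1) ^ i = (- 1 :: complex)" for i :: nat
    by (cases "even i") simp_all
  have N: "fct N = fct (k2 + k)" "(- 1) ^ N = ((- 1) ^ k2 * (- 1) ^ k :: complex)"
    unfolding k by (simp_all add: power_add)
  show ?thesis
    unfolding P Q signs splits ab poch_neg N
    using e[of k] e[of k2] by (elim disjE) (simp_all add: divide_simps nz)
qed

section \<open>Biorthogonality for the odd function\<close>

text \<open>The first series belongs to the dual parameters, for which \<open>conn2\<close> must first be replaced by \<open>conn1\<close>,
  since only the latter form is self-dual term by term.\<close>

theorem vwp_biorthogonality:
  assumes gen: "gen (a + b)" "gen (a - b)" "gen (a + c)" "gen (a - c)" "gen (a + d)" "gen (a - d)"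
      "gen (b + c)" "gen (b - c)" "gen (b + d)" "gen (b - d)" "gen (c + d)" "gen (c - d)"
      "gen (2 * a)" "gen (a - b + c + d)"
    and d: "d = 2 * g - a - b - c" and le: "k \<le> N" "l \<le> N"
  shows "(\<Sum>j\<le>N. weight N a b c d j k l
      * (\<Sum>s\<le>min j l. vwp_term N (g - b) (g - a) (g - d) (g - c) j l s)
      * (\<Sum>s\<le>min j k. vwp_term N a b c d j k s))
    = (if k = l then norm_const N a b c d k else 0)"
proof -
  have genBA: "gen (b - a)" "gen (c - a)" "gen (d - a)" "gen (c - b)" "gen (d - b)" "gen (d - c)"
    using gen gen_diff_commute[of a b] gen_diff_commute[of a c] gen_diff_commute[of a d]
      gen_diff_commute[of b c] gen_diff_commute[of b d] gen_diff_commute[of c d] by simp_all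
  have dual: "(g - b) + (g - a) = c + d" "(g - b) - (g - a) = a - b" "(g - b) + (g - d) = a + c"
      "(g - b) - (g - d) = d - b" "(g - b) + (g - c) = a + d" "(g - b) - (g - c) = c - b"
      "(g - a) + (g - d) = b + c" "(g - a) - (g - d) = d - a" "(g - a) + (g - c) = b + d"
      "(g - a) - (g - c) = c - a" "(g - c) - (g - b) = b - c" "(g - c) + (g - b) = a + d"
      "2 * (g - b) = a - b + c + d"
    using d by (simp_all add: algebra_simps)
  have summand: "weight N a b c d j k l
      * (\<Sum>s\<le>min j l. vwp_term N (g - b) (g - a) (g - d) (g - c) j l s)
      * (\<Sum>s\<le>min j k. vwp_term N a b c d j k s)
    = pairing_const N a b c d k l * (conn1 N l j a b c d * conn2 N j k c d a b)" if "j \<le> N" for j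
  proof -
    have "(\<Sum>s\<le>min j l. vwp_term N (g - b) (g - a) (g - d) (g - c) j l s)
        = vwp_factor N (g - b) (g - a) (g - d) (g - c) j l * conn2 N j l (g - d) (g - c) (g - b) (g - a)"
      by (rule vwp_series_eq; (simp only: dual)?) (use gen genBA that le in simp_all)
    also have "conn2 N j l (g - d) (g - c) (g - b) (g - a) = conn1 N j l (g - d) (g - c) (g - b) (g - a)"
      by (rule conn1_eq_conn2[symmetric]; (simp only: dual)?) (use gen genBA that le in simp_all)
    finally have 1: "(\<Sum>s\<le>min j l. vwp_term N (g - b) (g - a) (g - d) (g - c) j l s)
        = vwp_factor N (g - b) (g - a) (g - d) (g - c) j l * conn1 N j l (g - d) (g - c) (g - b) (g - a)" .
    have 2: "(\<Sum>s\<le>min j k. vwp_term N a b c d j k s) = vwp_factor N a b c d j k * conn2 N j k c d a b"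
      by (rule vwp_series_eq) (use gen that le in simp_all)
    have 3: "conn1 N l j a b c d = dual_factor N a b c d l j * conn1 N j l (g - d) (g - c) (g - b) (g - a)"
      by (rule conn1_duality) (use gen d that le in simp_all)
    have 4: "weight N a b c d j k l * vwp_factor N a b c d j k * vwp_factor N (g - b) (g - a) (g - d) (g - c) j l
        = pairing_const N a b c d k l * dual_factor N a b c d l j"
      by (rule weight_eq[where n = "N - j" and ?k2.0 = "N - k" and ?l2.0 = "N - l"]) (use gen d that le in simp_all)
    show ?thesis
      unfolding 1 2 3 using arg_cong[OF 4, of "\<lambda>x. x * conn1 N j l (g - d) (g - c) (g - b) (g - a) * conn2 N j k c d a b"]
      by (simp add: mult_ac)
  qed
  have "(\<Sum>j\<le>N. weight N a b c d j k l
      * (\<Sum>s\<le>min j l. vwp_term N (g - b) (g - a) (g - d) (g - c) j l s)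
      * (\<Sum>s\<le>min j k. vwp_term N a b c d j k s))
    = (\<Sum>j\<le>N. pairing_const N a b c d k l * (conn1 N l j a b c d * conn2 N j k c d a b))"
    by (intro sum.cong refl summand) simp
  also have "\<dots> = pairing_const N a b c d k l * (if k = l then 1 else 0)"
    unfolding sum_distrib_left[symmetric]
    by (subst conn_inverse) (use gen le in simp_all)
  also have "\<dots> = (if k = l then norm_const N a b c d k else 0)"
    using pairing_const_diag[OF gen(1-12), of N "N - k" k] le by auto
  finally show ?thesis .
qed

end

locale independent_nome = nome +
  assumes independent: "alg_independent p q"
begin

text \<open>A zero at \<open>n > 0\<close> would mean $q^{2n}=p^m$ with $m>0$, an algebraic relation.\<close>

lemma sig_of_nat_nonzero:
  assumes "0 < n"
  shows "S (of_nat n) \<noteq> 0"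
proof
  assume "S (of_nat n) = 0"
  then obtain m :: int where "qpow q (of_nat (2 * n)) = of_real p powi m"
    unfolding sig_eq_0_iff by auto
  then have "of_real (q ^ (2 * n)) = complex_of_real (p powi m)"
    using q by (simp only: qpow_of_nat of_real_power of_real_power_int)
  then have eq: "q ^ (2 * n) = p powi m"
    by (simp only: of_real_eq_iff)
  have "q ^ (2 * n) < 1"
    using q assms by (intro power_less_one_iff[THEN iffD2]) auto
  moreover have "p powi m \<ge> 1" if "m \<le> 0"
    using p that by (simp add: power_int_def one_le_inverse power_le_one power_inverse)
  ultimately have "m > 0" using eq by linarith
  then have eq': "q ^ (2 * n) = p ^ nat m"
    using eq by (simp add: power_int_def)
  \<comment> \<open>The outer variable stands for \<open>q\<close> and the inner one for \<open>p\<close>.\<close>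
  define P :: "rat poly poly" where "P = pCons (monom (- 1) (nat m)) (monom 1 (2 * n - 1))"
  have "poly (poly (map_poly (map_poly of_rat) P) [:q:]) p = q * q ^ (2 * n - 1) - p ^ nat m"
    by (simp add: P_def map_poly_pCons map_poly_monom poly_monom)
  also have "q * q ^ (2 * n - 1) = q ^ (2 * n)"
    using assms by (simp flip: power_Suc)
  finally have "P = 0"
    using independent eq' unfolding alg_independent_def by simp
  moreover have "P \<noteq> 0"
    by (simp add: P_def)
  ultimately show False by contradiction
qed

sublocale odd_addition S
  by unfold_locales (rule sig_minus, rule sig_addition, rule sig_of_nat_nonzero)

section \<open>From theta functions to the odd function\<close>

lemma ell_theta_qpow: "x = 2 * u \<Longrightarrow> ell_theta p (qpow q x) = qpow q u * S u"
  by (simp add: sig_def qpow_minus)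

definition poch_exponent :: "nat \<Rightarrow> complex \<Rightarrow> complex" where
  "poch_exponent n u = of_nat n * u + of_nat n * (of_nat n - 1) / 2"

lemma ell_fact_qpow:
  assumes "x = qpow q (2 * u)"
  shows "ell_fact p q x n = qpow q (poch_exponent n u) * poch u n"
proof (induction n)
  case 0
  then show ?case by (simp add: ell_fact_def poch_exponent_def)
next
  case (Suc n)
  have "x * of_real q ^ (2 * n) = qpow q (2 * (u + of_nat n))"
    using qpow_of_nat[OF q(1), of "2 * n"] by (simp add: assms qpow_add distrib_left)
  moreover have "poch_exponent (Suc n) u = poch_exponent n u + (u + of_nat n)"
    by (simp add: poch_exponent_def field_simps)
  ultimately show ?case
    using Suc ell_theta_qpow[OF refl, of "u + of_nat n"] by (simp add: ell_fact_def poch_Suc qpow_add)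
qed

text \<open>The balancing condition makes the powers of $q$ in the \<open>s\<close>-th term independent of \<open>s\<close>; the
  quadratic parts of the exponents cancel between numerator and denominator.\<close>

lemma vwp_series_qpow:
  assumes balanced: "y1 + y2 + y3 + y4 + y5 + y6 + y7 = 3 * \<alpha> + 2" and "n \<le> j"
    and x: "x = qpow q (2 * \<alpha>)" "x1 = qpow q (2 * y1)" "x2 = qpow q (2 * y2)" "x3 = qpow q (2 * y3)"
      "x4 = qpow q (2 * y4)" "x5 = qpow q (2 * y5)" "x6 = qpow q (2 * y6)" "x7 = qpow q (2 * y7)"
  shows "ell_omega_reg p q j n x [x1, x2] x3 [x4, x5, x6, x7]
    = qpow q (poch_exponent j (\<alpha> + 1 - y3)) * (\<Sum>s\<le>n. S (\<alpha> + 2 * of_nat s) / S \<alpha>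
      * (poch \<alpha> s * poch y1 s * poch y2 s * poch y3 s * poch y4 s * poch y5 s * poch y6 s * poch y7 s)
      / (fct s * poch (\<alpha> + 1 - y1) s * poch (\<alpha> + 1 - y2) s * poch (\<alpha> + 1 - y4) s * poch (\<alpha> + 1 - y5) s
         * poch (\<alpha> + 1 - y6) s * poch (\<alpha> + 1 - y7) s)
      * poch (\<alpha> + 1 - y3 + of_nat s) (j - s))"
  unfolding ell_omega_reg_def sum_distrib_left
proof (rule sum.cong)
  fix s assume "s \<in> {..n}"
  with \<open>n \<le> j\<close> have s: "of_nat (j - s) = complex_of_nat j - of_nat s"
    by (simp add: of_nat_diff)
  have q2: "of_real q ^ m = qpow q (of_nat m)" for m
    using qpow_of_nat[OF q(1), of m] by simp
  have th: "ell_theta p (x * of_real q ^ (4 * s)) = qpow q (\<alpha> + 2 * of_nat s) * S (\<alpha> + 2 * of_nat s)"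
    "ell_theta p x = qpow q \<alpha> * S \<alpha>"
    unfolding x q2 qpow_add[symmetric] by (rule ell_theta_qpow, simp add: algebra_simps)+
  have f: "ell_fact p q x s = qpow q (poch_exponent s \<alpha>) * poch \<alpha> s"
    "ell_fact p q x1 s = qpow q (poch_exponent s y1) * poch y1 s"
    "ell_fact p q x2 s = qpow q (poch_exponent s y2) * poch y2 s"
    "ell_fact p q x3 s = qpow q (poch_exponent s y3) * poch y3 s"
    "ell_fact p q x4 s = qpow q (poch_exponent s y4) * poch y4 s"
    "ell_fact p q x5 s = qpow q (poch_exponent s y5) * poch y5 s"
    "ell_fact p q x6 s = qpow q (poch_exponent s y6) * poch y6 s"
    "ell_fact p q x7 s = qpow q (poch_exponent s y7) * poch y7 s"
    "ell_fact p q ((of_real q)\<^sup>2) s = qpow q (poch_exponent s 1) * fct s"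
    "ell_fact p q (x * (of_real q)\<^sup>2 / x1) s = qpow q (poch_exponent s (\<alpha> + 1 - y1)) * poch (\<alpha> + 1 - y1) s"
    "ell_fact p q (x * (of_real q)\<^sup>2 / x2) s = qpow q (poch_exponent s (\<alpha> + 1 - y2)) * poch (\<alpha> + 1 - y2) s"
    "ell_fact p q (x * (of_real q)\<^sup>2 / x4) s = qpow q (poch_exponent s (\<alpha> + 1 - y4)) * poch (\<alpha> + 1 - y4) s"
    "ell_fact p q (x * (of_real q)\<^sup>2 / x5) s = qpow q (poch_exponent s (\<alpha> + 1 - y5)) * poch (\<alpha> + 1 - y5) s"
    "ell_fact p q (x * (of_real q)\<^sup>2 / x6) s = qpow q (poch_exponent s (\<alpha> + 1 - y6)) * poch (\<alpha> + 1 - y6) s"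
    "ell_fact p q (x * (of_real q)\<^sup>2 / x7) s = qpow q (poch_exponent s (\<alpha> + 1 - y7)) * poch (\<alpha> + 1 - y7) s"
    "ell_fact p q (x * of_real q ^ (2 + 2 * s) / x3) (j - s)
      = qpow q (poch_exponent (j - s) (\<alpha> + 1 - y3 + of_nat s)) * poch (\<alpha> + 1 - y3 + of_nat s) (j - s)"
    unfolding x q2 qpow_add[symmetric] qpow_diff[symmetric] fct_def
    by (rule ell_fact_qpow; simp add: algebra_simps)+
  have y7: "y7 = 3 * \<alpha> + 2 - y1 - y2 - y3 - y4 - y5 - y6"
    using balanced by (simp add: algebra_simps)
  have pow: "qpow q (poch_exponent j (\<alpha> + 1 - y3))
    = qpow q (\<alpha> + 2 * of_nat s) * qpow q (- \<alpha>)
      * (qpow q (poch_exponent s \<alpha>) * qpow q (poch_exponent s y1) * qpow q (poch_exponent s y2)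
        * qpow q (poch_exponent s y3) * qpow q (poch_exponent s y4) * qpow q (poch_exponent s y5)
        * qpow q (poch_exponent s y6) * qpow q (poch_exponent s y7) * qpow q (of_nat (2 * s)))
      * (qpow q (- poch_exponent s 1) * qpow q (- poch_exponent s (\<alpha> + 1 - y1))
        * qpow q (- poch_exponent s (\<alpha> + 1 - y2)) * qpow q (- poch_exponent s (\<alpha> + 1 - y4))
        * qpow q (- poch_exponent s (\<alpha> + 1 - y5)) * qpow q (- poch_exponent s (\<alpha> + 1 - y6))
        * qpow q (- poch_exponent s (\<alpha> + 1 - y7)))
      * qpow q (poch_exponent (j - s) (\<alpha> + 1 - y3 + of_nat s))"
    unfolding qpow_add[symmetric]
    by (rule arg_cong[of _ _ "qpow q"]) (simp add: poch_exponent_def s y7 field_simps)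
  have inv: "inverse (qpow q u) = qpow q (- u)" for u
    by (simp add: qpow_minus inverse_eq_divide)
  show "ell_theta p (x * of_real q ^ (4 * s)) / ell_theta p x
      * (ell_facts p q (x # [x1, x2] @ x3 # [x4, x5, x6, x7]) s * of_real q ^ (2 * s))
      / ell_facts p q (of_real q ^ 2 # map (\<lambda>a. x * of_real q ^ 2 / a) ([x1, x2] @ [x4, x5, x6, x7])) s
      * ell_fact p q (x * of_real q ^ (2 + 2 * s) / x3) (j - s)
    = qpow q (poch_exponent j (\<alpha> + 1 - y3)) * (S (\<alpha> + 2 * of_nat s) / S \<alpha>
      * (poch \<alpha> s * poch y1 s * poch y2 s * poch y3 s * poch y4 s * poch y5 s * poch y6 s * poch y7 s)
      / (fct s * poch (\<alpha> + 1 - y1) s * poch (\<alpha> + 1 - y2) s * poch (\<alpha> + 1 - y4) s * poch (\<alpha> + 1 - y5) s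
         * poch (\<alpha> + 1 - y6) s * poch (\<alpha> + 1 - y7) s)
      * poch (\<alpha> + 1 - y3 + of_nat s) (j - s))"
    unfolding pow ell_facts_def append.simps list.map prod_list.Cons prod_list.Nil mult_1_right th f q2[of "2 * s"]
    by (simp only: divide_inverse inverse_mult_distrib inv mult_ac)
qed simp

lemma inverse_qpow: "inverse (qpow q u) = qpow q (- u)"
  by (simp add: qpow_minus inverse_eq_divide)

lemma qpow_cong: "u = v \<Longrightarrow> qpow q u = qpow q v"
  by simp

text \<open>The second exponent belongs to the regularized factor $(q^{2(N-k-j+1)})_j$; the sum is the exponent
  of $(q^{-2(N-k)})_j$, as it must be by reflection.\<close>

lemma removable_prefactor:
  "qpow q (- 2 * of_nat j * (of_nat N - of_nat k) + of_nat j * (of_nat j - 1))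
     * qpow q (poch_exponent j (b - a + of_nat N - 2 * of_nat k - of_nat j + 1 - (b - a - of_nat k)))
   = qpow q (poch_exponent j (of_nat k - of_nat N))"
  unfolding qpow_add[symmetric] poch_exponent_def by (rule qpow_cong) (simp add: field_simps)

context
  fixes N :: nat and a b c d \<Lambda> M \<omega> z :: complex
  assumes \<Lambda>: "\<Lambda> = of_nat N - 1 - a + b" and M: "M = a + c - 1" and \<omega>: "\<omega> = a + b + c + d + of_nat N - 2"
    and z: "z = qpow q (3 - of_nat N - a - b + c + d)"
begin

lemma fact_series2_eq:
  "fact_series2 p q N \<Lambda> M \<omega> z j k = (- 1) ^ j * qpow q (poch_exponent j (of_nat k - of_nat N))
     * (\<Sum>s\<le>min j k. vwp_term N a b c d j k s)"
proof -
  let ?\<alpha> = "b - a + of_nat N - 2 * of_nat k - of_nat j"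
  have "ell_omega_reg p q j (min j k) (lead_par q \<Lambda> j k) (init_pars q j k) (rem_par q N \<Lambda> k) (tail_pars2 q N \<Lambda> M \<omega> z j k)
    = qpow q (poch_exponent j (?\<alpha> + 1 - (b - a - of_nat k))) * (\<Sum>s\<le>min j k. vwp_term N a b c d j k s)"
    unfolding init_pars_def tail_pars2_def lead_par_def rem_par_def
      z qpow_add[symmetric] qpow_diff[symmetric]
    by (subst vwp_series_qpow[where \<alpha> = ?\<alpha> and ?y1.0 = "- of_nat j" and ?y2.0 = "- of_nat k"
        and ?y3.0 = "b - a - of_nat k" and ?y4.0 = "1 - a - d - of_nat k" and ?y5.0 = "b + c + of_nat N - of_nat k"
        and ?y6.0 = "d - a + of_nat N - of_nat j - of_nat k" and ?y7.0 = "1 + b - c + of_nat N - of_nat j - of_nat k"])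
      (simp_all add: \<Lambda> M \<omega> vwp_term_def Let_def algebra_simps)
  then show ?thesis
    unfolding fact_series2_def removable_prefactor[where a = a and b = b, symmetric] by (simp only: mult.assoc)
qed

text \<open>Compared with \<open>fact_series2_eq\<close> only the two parameters with \<open>z\<close> change: a factor $q^2$ moves from one to
  the other, and this is the effect of passing to the dual parameters.\<close>

lemma fact_series1_eq:
  assumes g: "d = 2 * g - a - b - c"
  shows "fact_series1 p q N \<Lambda> M \<omega> z j l = (- 1) ^ j * qpow q (poch_exponent j (of_nat l - of_nat N))
     * (\<Sum>s\<le>min j l. vwp_term N (g - b) (g - a) (g - d) (g - c) j l s)"
proof -
  let ?\<alpha> = "b - a + of_nat N - 2 * of_nat l - of_nat j"
  have "ell_omega_reg p q j (min j l) (lead_par q \<Lambda> j l) (init_pars q j l) (rem_par q N \<Lambda> l) (tail_pars1 q N \<Lambda> M \<omega> z j l)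
    = qpow q (poch_exponent j (?\<alpha> + 1 - (b - a - of_nat l)))
      * (\<Sum>s\<le>min j l. vwp_term N (g - b) (g - a) (g - d) (g - c) j l s)"
    unfolding init_pars_def tail_pars1_def lead_par_def rem_par_def
      z qpow_add[symmetric] qpow_diff[symmetric]
    by (subst vwp_series_qpow[where \<alpha> = ?\<alpha> and ?y1.0 = "- of_nat j" and ?y2.0 = "- of_nat l"
        and ?y3.0 = "b - a - of_nat l" and ?y4.0 = "1 - a - d - of_nat l" and ?y5.0 = "b + c + of_nat N - of_nat l"
        and ?y6.0 = "1 + d - a + of_nat N - of_nat j - of_nat l" and ?y7.0 = "b - c + of_nat N - of_nat j - of_nat l"])
      (simp_all add: \<Lambda> M \<omega> g vwp_term_def Let_def algebra_simps)
  then show ?thesis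
    unfolding fact_series1_def removable_prefactor[where a = a and b = b, symmetric] by (simp only: mult.assoc)
qed

text \<open>The two powers on the left are those split off from the series in \<open>fact_series1_eq\<close> and
  \<open>fact_series2_eq\<close>. With them the total exponent does not depend on \<open>j\<close> and equals that of the norm
  in \<open>norm_h_eq\<close>.\<close>

lemma w1_w2_eq:
  "w1_rest p q N \<Lambda> M \<omega> z j k * w2_rest p q N \<Lambda> M \<omega> z j l
     * (qpow q (poch_exponent j (of_nat k - of_nat N)) * qpow q (poch_exponent j (of_nat l - of_nat N)))
   = qpow q (- 2 * of_nat k) * weight N a b c d j k l"
proof -
  let ?n = "of_nat N :: complex" and ?j = "of_nat j :: complex" and ?k = "of_nat k :: complex" and ?l = "of_nat l :: complex"
  have th: "ell_theta p (qpow q (2 * (\<Lambda> - \<omega> + 2 * M - ?n + 1 + 2 * ?j))) = qpow q (c - d - ?n + 2 * ?j) * S (c - d - ?n + 2 * ?j)"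
    "ell_theta p (qpow q (2 * (\<Lambda> - \<omega> + 2 * M - ?n + 1))) = qpow q (c - d - ?n) * S (c - d - ?n)"
    by (rule ell_theta_qpow, simp add: \<Lambda> M \<omega> algebra_simps)+
  have pe: "ell_fact p q x j = qpow q (poch_exponent j u) * poch u j" if "x = qpow q (2 * u)" for x u
    using that by (rule ell_fact_qpow)
  have f:
    "ell_fact p q (qpow q (2 * (\<Lambda> - \<omega> + 2 * M - ?n + 1))) j = qpow q (poch_exponent j (c - d - ?n)) * poch (c - d - ?n) j"
    "ell_fact p q (z * qpow q (2 * (\<Lambda> - ?k + M) - \<omega> - 1)) j = qpow q (poch_exponent j (c - a - ?k)) * poch (c - a - ?k) j"
    "ell_fact p q (qpow q (2 * (M + ?k + 1))) j = qpow q (poch_exponent j (a + c + ?k)) * poch (a + c + ?k) j"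
    "ell_fact p q (qpow q (- 2 * (\<Lambda> - ?k + 1))) j = qpow q (poch_exponent j (a - b - ?n + ?k)) * poch (a - b - ?n + ?k) j"
    "ell_fact p q (qpow q (- 2 * (\<omega> - M - ?k))) j = qpow q (poch_exponent j (1 - b - d - ?n + ?k)) * poch (1 - b - d - ?n + ?k) j"
    "ell_fact p q (qpow q (2 * (\<Lambda> - \<omega> + 2 * M + 2))) j = qpow q (poch_exponent j (1 + c - d)) * poch (1 + c - d) j"
    "ell_fact p q (qpow q (- 2 * (?n - 2 - M - ?k) - \<omega> + 1) / z) j = qpow q (poch_exponent j (1 + a - d - ?n + ?k)) * poch (1 + a - d - ?n + ?k) j"
    "ell_fact p q (qpow q 2) j = qpow q (poch_exponent j 1) * fct j"
    "ell_fact p q (qpow q (2 * (\<Lambda> - ?n + M + 2))) j = qpow q (poch_exponent j (b + c)) * poch (b + c) j"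
    "ell_fact p q (qpow q (2 * (M + 1))) j = qpow q (poch_exponent j (a + c)) * poch (a + c) j"
    "ell_fact p q (qpow q (- 2 * (\<Lambda> - 2 * ?k + 1))) j = qpow q (poch_exponent j (a - b - ?n + 2 * ?k)) * poch (a - b - ?n + 2 * ?k) j"
    "ell_fact p q (qpow q (- 2 * ?n)) j = qpow q (poch_exponent j (- ?n)) * poch (- ?n) j"
    "ell_fact p q (qpow q (- 2 * (\<omega> - M))) j = qpow q (poch_exponent j (1 - b - d - ?n)) * poch (1 - b - d - ?n) j"
    "ell_fact p q (qpow q (2 * (\<Lambda> - ?n - \<omega> + M + 1))) j = qpow q (poch_exponent j (1 - a - d - ?n)) * poch (1 - a - d - ?n) j"
    "ell_fact p q (qpow q (2 * (M + ?l + 1))) j = qpow q (poch_exponent j (a + c + ?l)) * poch (a + c + ?l) j"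
    "ell_fact p q (qpow q (- 2 * (\<Lambda> - ?l + 1))) j = qpow q (poch_exponent j (a - b - ?n + ?l)) * poch (a - b - ?n + ?l) j"
    "ell_fact p q (qpow q (- 2 * (\<omega> - M - ?l))) j = qpow q (poch_exponent j (1 - b - d - ?n + ?l)) * poch (1 - b - d - ?n + ?l) j"
    "ell_fact p q (qpow q (- 2 * (?n - 3 - \<Lambda> + ?l - M) - \<omega> - 1) / z) j = qpow q (poch_exponent j (b - d - ?l)) * poch (b - d - ?l) j"
    "ell_fact p q (qpow q (- 2 * (\<Lambda> - 2 * ?l + 1))) j = qpow q (poch_exponent j (a - b - ?n + 2 * ?l)) * poch (a - b - ?n + 2 * ?l) j"
    "ell_fact p q (z * qpow q (2 * (M + ?l) - \<omega> - 1)) j = qpow q (poch_exponent j (1 + c - b - ?n + ?l)) * poch (1 + c - b - ?n + ?l) j"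
    unfolding z qpow_add[symmetric] qpow_diff[symmetric] fct_def
    by (rule pe, rule qpow_cong, simp add: \<Lambda> M \<omega> algebra_simps)+
  have pow: "qpow q (- 2 * ?k) = qpow q (2 * ?j - 2 * ?k) * qpow q (c - d - ?n + 2 * ?j) * qpow q (- (c - d - ?n))
    * qpow q (poch_exponent j (c - d - ?n)) * qpow q (poch_exponent j (c - a - ?k)) * qpow q (poch_exponent j (a + c + ?k))
    * qpow q (poch_exponent j (a - b - ?n + ?k)) * qpow q (poch_exponent j (1 - b - d - ?n + ?k))
    * qpow q (- poch_exponent j (1 + c - d)) * qpow q (- poch_exponent j (1 + a - d - ?n + ?k)) * qpow q (- poch_exponent j 1)
    * qpow q (- poch_exponent j (b + c)) * qpow q (- poch_exponent j (a + c)) * qpow q (- poch_exponent j (a - b - ?n + 2 * ?k))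
    * qpow q (- poch_exponent j (- ?n)) * qpow q (- poch_exponent j (1 - b - d - ?n)) * qpow q (- poch_exponent j (1 - a - d - ?n))
    * qpow q (poch_exponent j (a + c + ?l)) * qpow q (poch_exponent j (a - b - ?n + ?l)) * qpow q (poch_exponent j (1 - b - d - ?n + ?l))
    * qpow q (poch_exponent j (b - d - ?l)) * qpow q (- poch_exponent j (a - b - ?n + 2 * ?l)) * qpow q (- poch_exponent j (1 + c - b - ?n + ?l))
    * (qpow q (poch_exponent j (?k - ?n)) * qpow q (poch_exponent j (?l - ?n)))"
    unfolding qpow_add[symmetric] by (rule qpow_cong) (simp add: poch_exponent_def field_simps)
  show ?thesis
    unfolding pow w1_rest_def w2_rest_def w1_denominators_def w2_denominators_def weight_def Let_def
      ell_facts_def list.map prod_list.Cons prod_list.Nil mult_1_right th f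
    by (simp only: divide_inverse inverse_mult_distrib inverse_qpow mult_ac)
qed

lemma norm_h_eq:
  "norm_h p q N \<Lambda> M \<omega> z k = qpow q (- 2 * of_nat k) * norm_const N a b c d k"
proof -
  let ?n = "of_nat N :: complex" and ?k = "of_nat k :: complex"
  have f:
    "ell_fact p q (qpow q 2) k = qpow q (poch_exponent k 1) * fct k"
    "ell_fact p q (qpow q (- 2 * (\<Lambda> + M + 1))) i = qpow q (poch_exponent i (1 - b - c - ?n)) * poch (1 - b - c - ?n) i"
    "ell_fact p q (qpow q (- 2 * (\<Lambda> - \<omega> + M))) i = qpow q (poch_exponent i (a + d)) * poch (a + d) i"
    "ell_fact p q (qpow q (- 2 * (\<Lambda> - ?n))) k = qpow q (poch_exponent k (1 + a - b)) * poch (1 + a - b) k"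
    "ell_fact p q (qpow q (- 2 * (\<Lambda> + 1))) i = qpow q (poch_exponent i (a - b - ?n)) * poch (a - b - ?n) i"
    "ell_fact p q (z * qpow q (2 * M - \<omega> - 1)) i = qpow q (poch_exponent i (1 + c - b - ?n)) * poch (1 + c - b - ?n) i"
    "ell_fact p q (qpow q (2 * (M - ?n) - \<omega> + 5) / z) k = qpow q (poch_exponent k (1 + a - d - ?n)) * poch (1 + a - d - ?n) k"
    "ell_fact p q (qpow q (- 2 * (\<Lambda> - \<omega> + 2 * M + 1))) N = qpow q (poch_exponent N (d - c)) * poch (d - c) N"
    "ell_fact p q (qpow q (- 2 * \<Lambda>)) i = qpow q (poch_exponent i (1 + a - b - ?n)) * poch (1 + a - b - ?n) i"
    "ell_fact p q (z * qpow q (\<omega> - 1)) N = qpow q (poch_exponent N (c + d)) * poch (c + d) N"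
    "ell_fact p q (z * qpow q (- \<omega> - 3)) N = qpow q (poch_exponent N (1 - a - b - ?n)) * poch (1 - a - b - ?n) N"
    "ell_fact p q (qpow q (2 * (M + 1))) k = qpow q (poch_exponent k (a + c)) * poch (a + c) k"
    "ell_fact p q (qpow q (- 2 * ?n)) k = qpow q (poch_exponent k (- ?n)) * poch (- ?n) k"
    "ell_fact p q (qpow q (- 2 * (\<omega> - M))) k = qpow q (poch_exponent k (1 - b - d - ?n)) * poch (1 - b - d - ?n) k"
    "ell_fact p q (qpow q (- 2 * (\<Lambda> + M) + \<omega> + 1) / z) k = qpow q (poch_exponent k (a - c)) * poch (a - c) k"
    "ell_fact p q (z * qpow q (2 * (?n - \<Lambda> - M) + \<omega> - 5)) k = qpow q (poch_exponent k (d - b)) * poch (d - b) k"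
    "ell_fact p q (z * qpow q (- 2 * M + \<omega> - 3)) N = qpow q (poch_exponent N (d - a)) * poch (d - a) N"
    for i
    unfolding z qpow_add[symmetric] qpow_diff[symmetric] fct_def
    by (rule ell_fact_qpow, rule qpow_cong, simp add: \<Lambda> M \<omega> algebra_simps)+
  have pow: "qpow q (- 2 * ?k) = qpow q (- 4 * ?k)
    * qpow q (poch_exponent k 1) * qpow q (poch_exponent k (1 - b - c - ?n)) * qpow q (poch_exponent k (a + d))
    * qpow q (poch_exponent k (1 + a - b)) * qpow q (poch_exponent (2 * k) (a - b - ?n))
    * qpow q (poch_exponent k (1 + c - b - ?n)) * qpow q (poch_exponent k (1 + a - d - ?n))
    * qpow q (poch_exponent N (d - c)) * qpow q (poch_exponent N (1 + a - b - ?n))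
    * qpow q (poch_exponent N (c + d)) * qpow q (poch_exponent N (1 - a - b - ?n))
    * qpow q (- poch_exponent k (a + c)) * qpow q (- poch_exponent k (- ?n)) * qpow q (- poch_exponent k (1 - b - d - ?n))
    * qpow q (- poch_exponent k (a - b - ?n)) * qpow q (- poch_exponent (2 * k) (1 + a - b - ?n))
    * qpow q (- poch_exponent k (a - c)) * qpow q (- poch_exponent k (d - b))
    * qpow q (- poch_exponent N (1 - b - c - ?n)) * qpow q (- poch_exponent N (a + d))
    * qpow q (- poch_exponent N (1 + c - b - ?n)) * qpow q (- poch_exponent N (d - a))"
    unfolding qpow_add[symmetric] by (rule qpow_cong) (simp add: poch_exponent_def field_simps)
  show ?thesis
    unfolding pow norm_h_def norm_denominators_def norm_const_def Let_def
      ell_facts_def list.map prod_list.Cons prod_list.Nil mult_1_right f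
    by (simp only: divide_inverse inverse_mult_distrib inverse_qpow mult_ac)
qed

end

section \<open>Passage to all admissible parameters\<close>

text \<open>Comparing absolute values in the equation $q^{2(u+\kappa t+n)}=p^m$ determines the real number \<open>t\<close> from
  the integers \<open>m\<close> and \<open>n\<close>.\<close>

lemma countable_not_gen:
  fixes \<kappa> :: real
  assumes "\<kappa> \<noteq> 0"
  shows "countable {t. \<not> gen (u + of_real (\<kappa> * t))}"
proof (rule countable_subset)
  let ?f = "\<lambda>(m::int, n::int). (of_int m * ln p / (2 * ln q) - of_int n - Re u) / \<kappa>"
  show "countable (range ?f)" by simp
  show "{t. \<not> gen (u + of_real (\<kappa> * t))} \<subseteq> range ?f"
  proof
    fix t assume "t \<in> {t. \<not> gen (u + of_real (\<kappa> * t))}"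
    then obtain n :: int and m :: int
      where eq: "qpow q (2 * (u + of_real (\<kappa> * t) + of_int n)) = of_real p powi m"
      unfolding gen_def sig_eq_0_iff by blast
    have "norm (qpow q (2 * (u + of_real (\<kappa> * t) + of_int n))) = exp (2 * (Re u + \<kappa> * t + of_int n) * ln q)"
      by (simp add: qpow_def)
    moreover have "norm (complex_of_real p powi m) = exp (of_int m * ln p)"
      using p by (simp add: norm_power_int powr_real_of_int'[symmetric] powr_def)
    ultimately have "2 * (Re u + \<kappa> * t + of_int n) * ln q = of_int m * ln p"
      using eq by simp
    then have "Re u + \<kappa> * t + of_int n = of_int m * ln p / (2 * ln q)"
      using q by (simp add: field_simps)
    then have "\<kappa> * t = of_int m * ln p / (2 * ln q) - of_int n - Re u"
      by linarith
    then have "t = ?f (m, n)"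
      using assms by (simp add: field_simps)
    then show "t \<in> range ?f" by blast
  qed
qed

lemma at_0_within_cocountable:
  assumes "countable (B :: real set)"
  shows "at 0 within - B \<noteq> bot"
proof -
  have "0 islimpt - B"
    unfolding islimpt_approachable
  proof (intro allI impI)
    fix e :: real assume "e > 0"
    then have "uncountable {0<..<e}" by (simp add: uncountable_open_interval)
    then obtain x where "x \<in> {0<..<e}" "x \<notin> B"
      using assms countable_subset[of "{0<..<e}" B] by blast
    then show "\<exists>x'\<in>- B. x' \<noteq> 0 \<and> dist x' 0 < e"
      by (intro bexI[of _ x]) auto
  qed
  then show ?thesis by (simp add: trivial_limit_within)
qed

lemma tendsto_qpow [tendsto_intros]: "(f \<longlongrightarrow> l) F \<Longrightarrow> ((\<lambda>t. qpow q (f t)) \<longlongrightarrow> qpow q l) F"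
  unfolding qpow_def by (intro tendsto_intros)

lemma tendsto_ell_theta:
  assumes "(f \<longlongrightarrow> l) F" "l \<noteq> 0"
  shows "((\<lambda>t. ell_theta p (f t)) \<longlongrightarrow> ell_theta p l) F"
proof -
  have "isCont (half_theta p) x" for x
    using half_theta_holomorphic[OF p] holomorphic_on_imp_continuous_on continuous_on_eq_continuous_at[OF open_UNIV]
    by blast
  note * = isCont_tendsto_compose[OF this]
  show ?thesis
    unfolding ell_theta_eq_half_theta[OF p] using assms by (intro tendsto_intros *)
qed

lemma tendsto_ell_fact:
  assumes "(f \<longlongrightarrow> l) F" "l \<noteq> 0"
  shows "((\<lambda>t. ell_fact p q (f t) n) \<longlongrightarrow> ell_fact p q l n) F"
  unfolding ell_fact_def
  using assms q by (intro tendsto_prod tendsto_ell_theta tendsto_intros) auto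

lemma tendsto_ell_omega_reg:
  assumes lim: "(x \<longlongrightarrow> l) F" "(x1 \<longlongrightarrow> l1) F" "(x2 \<longlongrightarrow> l2) F" "(x3 \<longlongrightarrow> l3) F" "(x4 \<longlongrightarrow> l4) F"
      "(x5 \<longlongrightarrow> l5) F" "(x6 \<longlongrightarrow> l6) F" "(x7 \<longlongrightarrow> l7) F"
    and nz: "l \<noteq> 0" "l1 \<noteq> 0" "l2 \<noteq> 0" "l3 \<noteq> 0" "l4 \<noteq> 0" "l5 \<noteq> 0" "l6 \<noteq> 0" "l7 \<noteq> 0"
    and dfd: "ell_omega_defined p q n l ([l1, l2] @ [l4, l5, l6, l7])"
  shows "((\<lambda>t. ell_omega_reg p q j n (x t) [x1 t, x2 t] (x3 t) [x4 t, x5 t, x6 t, x7 t])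
    \<longlongrightarrow> ell_omega_reg p q j n l [l1, l2] l3 [l4, l5, l6, l7]) F"
  unfolding ell_omega_reg_def
proof (rule tendsto_sum)
  fix s assume "s \<in> {..n}"
  with dfd have "ell_theta p l \<noteq> 0"
    "ell_facts p q (of_real q ^ 2 # map (\<lambda>a. l * of_real q ^ 2 / a) ([l1, l2] @ [l4, l5, l6, l7])) s \<noteq> 0"
    unfolding ell_omega_defined_def by auto
  then show "((\<lambda>t. ell_theta p (x t * of_real q ^ (4 * s)) / ell_theta p (x t)
        * (ell_facts p q (x t # [x1 t, x2 t] @ x3 t # [x4 t, x5 t, x6 t, x7 t]) s * of_real q ^ (2 * s))
        / ell_facts p q (of_real q ^ 2 # map (\<lambda>a. x t * of_real q ^ 2 / a) ([x1 t, x2 t] @ [x4 t, x5 t, x6 t, x7 t])) s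
        * ell_fact p q (x t * of_real q ^ (2 + 2 * s) / x3 t) (j - s))
    \<longlongrightarrow> ell_theta p (l * of_real q ^ (4 * s)) / ell_theta p l
        * (ell_facts p q (l # [l1, l2] @ l3 # [l4, l5, l6, l7]) s * of_real q ^ (2 * s))
        / ell_facts p q (of_real q ^ 2 # map (\<lambda>a. l * of_real q ^ 2 / a) ([l1, l2] @ [l4, l5, l6, l7])) s
        * ell_fact p q (l * of_real q ^ (2 + 2 * s) / l3) (j - s)) F"
    unfolding ell_facts_def append.simps list.map prod_list.Cons prod_list.Nil mult_1_right
    by (intro tendsto_mult tendsto_divide tendsto_const tendsto_ell_theta tendsto_ell_fact lim)
      (use nz q in auto)
qed

context
  fixes N :: nat and \<Lambda> M \<omega> z :: complex and \<Lambda>' M' \<omega>' z' :: "'t \<Rightarrow> complex" and F :: "'t filter"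
  assumes lim: "(\<Lambda>' \<longlongrightarrow> \<Lambda>) F" "(M' \<longlongrightarrow> M) F" "(\<omega>' \<longlongrightarrow> \<omega>) F" "(z' \<longlongrightarrow> z) F" and z: "z \<noteq> 0"
begin

lemma tendsto_fact_series1:
  assumes "ell_omega_defined p q (min j l) (lead_par q \<Lambda> j l) (init_pars q j l @ tail_pars1 q N \<Lambda> M \<omega> z j l)"
  shows "((\<lambda>t. fact_series1 p q N (\<Lambda>' t) (M' t) (\<omega>' t) (z' t) j l) \<longlongrightarrow> fact_series1 p q N \<Lambda> M \<omega> z j l) F"
  using assms z unfolding fact_series1_def lead_par_def init_pars_def rem_par_def tail_pars1_def
  by (intro tendsto_mult tendsto_const tendsto_ell_omega_reg tendsto_intros lim) auto

lemma tendsto_fact_series2: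
  assumes "ell_omega_defined p q (min j l) (lead_par q \<Lambda> j l) (init_pars q j l @ tail_pars2 q N \<Lambda> M \<omega> z j l)"
  shows "((\<lambda>t. fact_series2 p q N (\<Lambda>' t) (M' t) (\<omega>' t) (z' t) j l) \<longlongrightarrow> fact_series2 p q N \<Lambda> M \<omega> z j l) F"
  using assms z unfolding fact_series2_def lead_par_def init_pars_def rem_par_def tail_pars2_def
  by (intro tendsto_mult tendsto_const tendsto_ell_omega_reg tendsto_intros lim) auto

lemma tendsto_w1_rest:
  assumes "w1_denominators p q N \<Lambda> M \<omega> z j k \<noteq> 0"
  shows "((\<lambda>t. w1_rest p q N (\<Lambda>' t) (M' t) (\<omega>' t) (z' t) j k) \<longlongrightarrow> w1_rest p q N \<Lambda> M \<omega> z j k) F"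
proof -
  have "((\<lambda>t. w1_denominators p q N (\<Lambda>' t) (M' t) (\<omega>' t) (z' t) j k) \<longlongrightarrow> w1_denominators p q N \<Lambda> M \<omega> z j k) F"
    unfolding w1_denominators_def ell_facts_def list.map prod_list.Cons prod_list.Nil mult_1_right
    by (intro tendsto_mult tendsto_const tendsto_ell_theta tendsto_ell_fact tendsto_intros lim) (use z in auto)
  then show ?thesis
    unfolding w1_rest_def ell_facts_def list.map prod_list.Cons prod_list.Nil mult_1_right
    using assms z
    by (intro tendsto_divide tendsto_mult tendsto_const tendsto_ell_theta tendsto_ell_fact tendsto_intros lim) auto
qed

lemma tendsto_w2_rest:
  assumes "w2_denominators p q \<Lambda> M \<omega> z j l \<noteq> 0"
  shows "((\<lambda>t. w2_rest p q N (\<Lambda>' t) (M' t) (\<omega>' t) (z' t) j l) \<longlongrightarrow> w2_rest p q N \<Lambda> M \<omega> z j l) F"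
proof -
  have "((\<lambda>t. w2_denominators p q (\<Lambda>' t) (M' t) (\<omega>' t) (z' t) j l) \<longlongrightarrow> w2_denominators p q \<Lambda> M \<omega> z j l) F"
    unfolding w2_denominators_def
    by (intro tendsto_mult tendsto_const tendsto_ell_fact tendsto_intros lim) (use z in auto)
  then show ?thesis
    unfolding w2_rest_def ell_facts_def list.map prod_list.Cons prod_list.Nil mult_1_right
    using assms z
    by (intro tendsto_divide tendsto_mult tendsto_const tendsto_ell_fact tendsto_intros lim) auto
qed

lemma tendsto_norm_h:
  assumes "norm_denominators p q N \<Lambda> M \<omega> z k \<noteq> 0"
  shows "((\<lambda>t. norm_h p q N (\<Lambda>' t) (M' t) (\<omega>' t) (z' t) k) \<longlongrightarrow> norm_h p q N \<Lambda> M \<omega> z k) F"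
proof -
  have "((\<lambda>t. norm_denominators p q N (\<Lambda>' t) (M' t) (\<omega>' t) (z' t) k) \<longlongrightarrow> norm_denominators p q N \<Lambda> M \<omega> z k) F"
    unfolding norm_denominators_def ell_facts_def list.map prod_list.Cons prod_list.Nil mult_1_right
    by (intro tendsto_mult tendsto_const tendsto_ell_fact tendsto_intros lim) (use z in auto)
  then show ?thesis
    unfolding norm_h_def ell_facts_def list.map prod_list.Cons prod_list.Nil mult_1_right
    using assms z
    by (intro tendsto_divide tendsto_mult tendsto_const tendsto_ell_fact tendsto_intros lim) auto
qed

text \<open>The hypothesis on the limit point covers all denominators of the summand; the regularized factors
  have none.\<close>

lemma tendsto_biorth_summand:
  assumes "generic_params p q N \<Lambda> M \<omega> z k l" "j \<le> N"
  shows "((\<lambda>t. biorth_summand p q N (\<Lambda>' t) (M' t) (\<omega>' t) (z' t) j k l) \<longlongrightarrow> biorth_summand p q N \<Lambda> M \<omega> z j k l) F"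
  using assms unfolding biorth_summand_def generic_params_def
  by (intro tendsto_mult tendsto_w1_rest tendsto_w2_rest tendsto_fact_series1 tendsto_fact_series2) auto

end

lemma biorthogonality_at_generic_point:
  assumes \<Lambda>: "\<Lambda> = of_nat N - 1 - a + b" and M: "M = a + c - 1" and \<omega>: "\<omega> = a + b + c + d + of_nat N - 2"
    and z: "z = qpow q (3 - of_nat N - a - b + c + d)"
    and gen: "\<forall>u\<in>set [a + b, a - b, a + c, a - c, a + d, a - d, b + c, b - c, b + d, b - d, c + d, c - d,
      2 * a, a - b + c + d]. gen u"
    and le: "k \<le> N" "l \<le> N"
  shows "(\<Sum>j\<le>N. biorth_summand p q N \<Lambda> M \<omega> z j k l) = (if k = l then norm_h p q N \<Lambda> M \<omega> z k else 0)"
proof -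
  define g where "g = (a + b + c + d) / 2"
  have d: "d = 2 * g - a - b - c" by (simp add: g_def field_simps)
  have "biorth_summand p q N \<Lambda> M \<omega> z j k l = qpow q (- 2 * of_nat k) * (weight N a b c d j k l
      * (\<Sum>s\<le>min j l. vwp_term N (g - b) (g - a) (g - d) (g - c) j l s)
      * (\<Sum>s\<le>min j k. vwp_term N a b c d j k s))" for j
  proof -
    have "(- 1) ^ j * (- 1) ^ j = (1 :: complex)"
      by (simp flip: power_mult_distrib)
    then have "biorth_summand p q N \<Lambda> M \<omega> z j k l
      = (w1_rest p q N \<Lambda> M \<omega> z j k * w2_rest p q N \<Lambda> M \<omega> z j l
          * (qpow q (poch_exponent j (of_nat k - of_nat N)) * qpow q (poch_exponent j (of_nat l - of_nat N))))
        * (\<Sum>s\<le>min j l. vwp_term N (g - b) (g - a) (g - d) (g - c) j l s)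
        * (\<Sum>s\<le>min j k. vwp_term N a b c d j k s)"
      unfolding biorth_summand_def fact_series1_eq[OF \<Lambda> M \<omega> z d] fact_series2_eq[OF \<Lambda> M \<omega> z] 
      by (simp add: mult_ac)
    then show ?thesis
      unfolding w1_w2_eq[OF \<Lambda> M \<omega> z] by (simp only: mult.assoc)
  qed
  then have "(\<Sum>j\<le>N. biorth_summand p q N \<Lambda> M \<omega> z j k l)
      = qpow q (- 2 * of_nat k) * (if k = l then norm_const N a b c d k else 0)"
    using vwp_biorthogonality[of a b c d g k N l] gen d le by (simp add: sum_distrib_left[symmetric])
  then show ?thesis
    unfolding norm_h_eq[OF \<Lambda> M \<omega> z] by simp
qed

text \<open>The parameters are moved to $(a+t,b+3t,c+9t,d+27t)$, so that none of the combinations on which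
  genericity depends stays constant. For \<open>t\<close> outside a countable set the relation is known, and \<open>t\<close> may
  tend to \<open>0\<close> within the complement of this set.\<close>

lemma biorthogonality:
  assumes le: "k \<le> N" "l \<le> N" and "z \<noteq> 0" and generic: "generic_params p q N \<Lambda> M \<omega> z k l"
  shows "(\<Sum>j\<le>N. biorth_summand p q N \<Lambda> M \<omega> z j k l) = (if k = l then norm_h p q N \<Lambda> M \<omega> z k else 0)"
proof -
  define W where "W = Ln z / of_real (ln q)"
  have W: "z = qpow q W"
    using q \<open>z \<noteq> 0\<close> by (simp add: W_def qpow_def)
  \<comment> \<open>The solution of the linear relations between the two sets of parameters.\<close>
  define a where "a = (\<omega> + 3 - W) / 4 - \<Lambda> / 2"
  define b where "b = a + \<Lambda> + 1 - of_nat N"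
  define c where "c = M + 1 - a"
  define d where "d = \<omega> + 2 - of_nat N - a - b - c"
  define a' b' c' d' where "a' t = a + of_real t" and "b' t = b + of_real (3 * t)"
    and "c' t = c + of_real (9 * t)" and "d' t = d + of_real (27 * t)" for t :: real
  note pars = a'_def b'_def c'_def d'_def
  define \<Lambda>' where "\<Lambda>' t = of_nat N - 1 - a' t + b' t" for t
  define M' where "M' t = a' t + c' t - 1" for t
  define \<omega>' where "\<omega>' t = a' t + b' t + c' t + d' t + of_nat N - 2" for t
  define z' where "z' t = qpow q (3 - of_nat N - a' t - b' t + c' t + d' t)" for t
  define L where "L = [(a + b, 4), (a - b, - 2), (a + c, 10), (a - c, - 8), (a + d, 28), (a - d, - 26),
      (b + c, 12), (b - c, - 6), (b + d, 30), (b - d, - 24), (c + d, 36), (c - d, - 18),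
      (2 * a, 2), (a - b + c + d, 34 :: real)]"
  define B where "B = (\<Union>(u, \<kappa>)\<in>set L. {t. \<not> gen (u + of_real (\<kappa> * t))})"
  have L: "\<kappa> \<noteq> 0" if "(u, \<kappa>) \<in> set L" for u \<kappa>
    using that by (auto simp: L_def)
  have "countable B"
    unfolding B_def
  proof (rule countable_UN[OF countable_finite[OF finite_set]])
    fix x assume "x \<in> set L"
    moreover obtain u \<kappa> where x: "x = (u, \<kappa>)" by (cases x)
    ultimately have "\<kappa> \<noteq> 0" using L by simp
    then show "countable (case x of (u, \<kappa>) \<Rightarrow> {t. \<not> gen (u + of_real (\<kappa> * t))})"
      unfolding x prod.case by (rule countable_not_gen)
  qed
  then have nontriv: "at 0 within - B \<noteq> bot"
    by (rule at_0_within_cocountable)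
  have eq: "(\<Sum>j\<le>N. biorth_summand p q N (\<Lambda>' t) (M' t) (\<omega>' t) (z' t) j k l)
      = (if k = l then norm_h p q N (\<Lambda>' t) (M' t) (\<omega>' t) (z' t) k else 0)" if "t \<notin> B" for t
  proof (rule biorthogonality_at_generic_point[where a = "a' t" and b = "b' t" and c = "c' t" and d = "d' t"])
    show "\<forall>u\<in>set [a' t + b' t, a' t - b' t, a' t + c' t, a' t - c' t, a' t + d' t, a' t - d' t, b' t + c' t,
        b' t - c' t, b' t + d' t, b' t - d' t, c' t + d' t, c' t - d' t, 2 * a' t, a' t - b' t + c' t + d' t]. gen u"
      using that by (simp add: B_def L_def pars algebra_simps)
  qed (simp_all add: \<Lambda>'_def M'_def \<omega>'_def z'_def le)
  have "((\<lambda>t. of_real (r * t)) \<longlongrightarrow> (0 :: complex)) (at 0 within - B)" for r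
    by (auto intro!: tendsto_eq_intros)
  then have lim': "(a' \<longlongrightarrow> a) (at 0 within - B)" "(b' \<longlongrightarrow> b) (at 0 within - B)"
      "(c' \<longlongrightarrow> c) (at 0 within - B)" "(d' \<longlongrightarrow> d) (at 0 within - B)"
    unfolding pars[abs_def] by (auto intro!: tendsto_eq_intros)
  have "4 * a = \<omega> + 3 - W - 2 * \<Lambda>"
    by (simp add: a_def field_simps)
  then have W': "W = 3 - of_nat N - a - b + c + d"
    by (simp add: b_def c_def d_def algebra_simps)
  have lim: "(\<Lambda>' \<longlongrightarrow> \<Lambda>) (at 0 within - B)" "(M' \<longlongrightarrow> M) (at 0 within - B)"
      "(\<omega>' \<longlongrightarrow> \<omega>) (at 0 within - B)" "(z' \<longlongrightarrow> z) (at 0 within - B)"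
    unfolding W W' \<Lambda>'_def[abs_def] M'_def[abs_def] \<omega>'_def[abs_def] z'_def[abs_def]
    by (rule tendsto_eq_intros tendsto_qpow lim' refl | simp add: b_def c_def d_def)+
  have "((\<lambda>t. \<Sum>j\<le>N. biorth_summand p q N (\<Lambda>' t) (M' t) (\<omega>' t) (z' t) j k l)
      \<longlongrightarrow> (\<Sum>j\<le>N. biorth_summand p q N \<Lambda> M \<omega> z j k l)) (at 0 within - B)"
    by (intro tendsto_sum tendsto_biorth_summand[OF lim \<open>z \<noteq> 0\<close> generic]) simp
  moreover have "eventually (\<lambda>t. (\<Sum>j\<le>N. biorth_summand p q N (\<Lambda>' t) (M' t) (\<omega>' t) (z' t) j k l)
      = (if k = l then norm_h p q N (\<Lambda>' t) (M' t) (\<omega>' t) (z' t) k else 0)) (at 0 within - B)"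
    using eq by (auto simp: eventually_at_filter)
  moreover have "((\<lambda>t. if k = l then norm_h p q N (\<Lambda>' t) (M' t) (\<omega>' t) (z' t) k else 0)
      \<longlongrightarrow> (if k = l then norm_h p q N \<Lambda> M \<omega> z k else 0)) (at 0 within - B)"
    using generic tendsto_norm_h[OF lim \<open>z \<noteq> 0\<close>, of N k] by (auto simp: generic_params_def)
  ultimately show ?thesis
    by (rule tendsto_unique[OF nontriv Lim_transform_eventually])
qed

end

theorem theorem4p5:
  fixes p q :: real and N k l :: nat and \<Lambda> M \<omega> z :: complex
  assumes "0 < p" "p < 1" "0 < q" "q < 1" "alg_independent p q"
    and "k \<le> N" "l \<le> N" "z \<noteq> 0"
    and "generic_params p q N \<Lambda> M \<omega> z k l"
  shows "(if k = l then norm_h p q N \<Lambda> M \<omega> z k else 0)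
           = (\<Sum>j\<le>N. biorth_summand p q N \<Lambda> M \<omega> z j k l)"
proof -
  interpret independent_nome p q
    by unfold_locales fact+
  show ?thesis
    using biorthogonality[OF assms(6-9)] by simp
qed

end
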